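(* Suppose there exists an algorithm StrEdit which, on inputs of length $n$, runs in time $\alpha(n)$ and achieves approximation factor $\beta(n)$ for string edit distance. Then for any $s\ge 2$ there exists an algorithm that, given a string $\sigma$ of length $n$ over $T\cup\bar{T}$ ($|T|=s$), obtains an $O(\beta(n)\log z\sqrt{\log d})$-approximation for the edit distance from $\sigma$ to $\mathrm{Dyck}(s)$ in $O(n\log n + \alpha(n))$ time with probability at least $1-\frac{1}{n}-\frac{1}{d}$, where $d$ is the optimal edit distance from $\sigma$ to $\mathrm{Dyck}(s)$ and $z$ is the number of blocks of $\sigma$.
   Context: $T$ is a finite set of open parentheses, each $x\in T$ with a unique congruent close parenthesis $\bar{x}$; $\mathrm{Dyck}(s)$ is the set of well-balanced strings over $T\cup\bar{T}$, generated by $S\to SS\mid\varepsilon\mid aS\bar{a}$ ($a\in T$). Edit distance allows insertions, deletions and substitutions. Number of blocks $z$: after removing from $\sigma$ any prefix of close parentheses, any suffix of open parentheses and (repeatedly) contiguous well-balanced substrings (operations that do not change the edit distance), the string can be written $Y_1X_1Y_2X_2\cdots Y_zX_z$ with each $Y_a$ a nonempty string of open parentheses and each $X_a$ a nonempty string of close parentheses; one has $z\le d$. StrEdit between a string $Z$ of open parentheses and a string $X$ of close parentheses is the string edit distance between $Z$ and the reverse of $X$ with each $\bar{t}$ replaced by $t$.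
   Formalization: The factor log z is read as max(1, log z): for z = 1 (e.g. "(((]]]") the literal factor would be 0, which is impossible, and for z = 0 (e.g. "))))") log z is undefined; for z ≥ 2 nothing changes. For d = 0 the term 1/d is taken as 0. *)

theory Defs
  imports "HOL-Probability.Probability"
begin

section \<open>Edit distance\<close>

inductive edit_step :: "'a list \<Rightarrow> 'a list \<Rightarrow> bool" where
  insertion: "edit_step (u @ v) (u @ [a] @ v)"
| deletion: "edit_step (u @ [a] @ v) (u @ v)"
| substitution: "edit_step (u @ [a] @ v) (u @ [b] @ v)"

definition edit_dist :: "'a list \<Rightarrow> 'a list \<Rightarrow> nat" where
  "edit_dist x y = (LEAST k. (edit_step ^^ k) x y)"

section \<open>Dyck languages\<close>

text \<open>The set of parenthesis types with \<open>s\<close> elements is taken to be \<open>{..<s}\<close>.\<close>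

datatype paren = Open nat | Close nat

definition parens :: "nat \<Rightarrow> paren set" where
  "parens s = Open ` {..<s} \<union> Close ` {..<s}"

inductive_set Dyck :: "nat \<Rightarrow> paren list set" for s :: nat where
  empty: "[] \<in> Dyck s"
| concat: "u \<in> Dyck s \<Longrightarrow> v \<in> Dyck s \<Longrightarrow> u @ v \<in> Dyck s"
| wrap: "a < s \<Longrightarrow> u \<in> Dyck s \<Longrightarrow> [Open a] @ u @ [Close a] \<in> Dyck s"

definition dyck_dist :: "nat \<Rightarrow> paren list \<Rightarrow> nat" where
  "dyck_dist s \<sigma> = (INF w\<in>Dyck s. edit_dist \<sigma> w)"

section \<open>Number of blocks\<close>

inductive simplify :: "nat \<Rightarrow> paren list \<Rightarrow> paren list \<Rightarrow> bool" for s :: nat where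
  prefix_close: "simplify s (Close a # v) v"
| suffix_open: "simplify s (u @ [Open a]) u"
| balanced: "w \<in> Dyck s \<Longrightarrow> w \<noteq> [] \<Longrightarrow> simplify s (u @ w @ v) (u @ v)"

definition simplified_form :: "nat \<Rightarrow> paren list \<Rightarrow> paren list \<Rightarrow> bool" where
  "simplified_form s \<sigma> \<tau> \<longleftrightarrow> (simplify s)\<^sup>*\<^sup>* \<sigma> \<tau> \<and> (\<nexists>\<tau>'. simplify s \<tau> \<tau>')"

fun block_string :: "(nat list \<times> nat list) list \<Rightarrow> paren list" where
  "block_string [] = []"
| "block_string ((Y, X) # bs) = map Open Y @ map Close X @ block_string bs"

definition has_blocks :: "paren list \<Rightarrow> nat \<Rightarrow> bool" where
  "has_blocks \<tau> z \<longleftrightarrow>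
     (\<exists>bs. length bs = z \<and> (\<forall>(Y, X) \<in> set bs. Y \<noteq> [] \<and> X \<noteq> []) \<and> \<tau> = block_string bs)"

definition num_blocks :: "nat \<Rightarrow> paren list \<Rightarrow> nat" where
  "num_blocks s \<sigma> = (THE z. \<exists>\<tau>. simplified_form s \<sigma> \<tau> \<and> has_blocks \<tau> z)"

text \<open>\<open>num_blocks\<close> is well defined: the simplified form and its block count exist and are
  unique.\<close>

lemma simplified_form_exists: "\<exists>\<tau>. simplified_form s \<sigma> \<tau>"
proof (induction \<sigma> rule: length_induct)
  case (1 \<sigma>)
  show ?case
  proof (cases "\<exists>\<tau>'. simplify s \<sigma> \<tau>'")
    case True
    then obtain \<tau>' where st: "simplify s \<sigma> \<tau>'" by blast
    then have "length \<tau>' < length \<sigma>" by cases auto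
    with 1 obtain \<tau> where "simplified_form s \<tau>' \<tau>" by blast
    with st show ?thesis
      unfolding simplified_form_def by (meson converse_rtranclp_into_rtranclp)
  next
    case False
    then show ?thesis unfolding simplified_form_def by blast
  qed
qed

lemma has_blocks_exists:
  assumes "\<nexists>a v. \<tau> = Close a # v" "\<nexists>a u. \<tau> = u @ [Open a]"
  shows "\<exists>z. has_blocks \<tau> z"
  using assms
proof (induction \<tau> rule: length_induct)
  case (1 \<tau>)
  show ?case
  proof (cases "\<tau> = []")
    case True
    then show ?thesis unfolding has_blocks_def by (auto intro!: exI[of _ "[]"])
  next
    case False
    define P where "P = (\<lambda>p. \<exists>a. p = Open a)"
    define ys where "ys = takeWhile P \<tau>"
    define r where "r = dropWhile P \<tau>"
    define xs where "xs = takeWhile (Not \<circ> P) r"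
    define q where "q = dropWhile (Not \<circ> P) r"
    have \<tau>: "\<tau> = ys @ xs @ q" "r = xs @ q" unfolding ys_def r_def xs_def q_def by simp_all
    have "\<forall>p\<in>set ys. P p" unfolding ys_def by (auto dest: set_takeWhileD)
    then have "\<exists>Y. ys = map Open Y" unfolding P_def by (induction ys) (auto simp: Cons_eq_map_conv)
    then obtain Y where Y: "ys = map Open Y" by blast
    have "\<forall>p\<in>set xs. \<not> P p" unfolding xs_def by (auto dest: set_takeWhileD)
    then have "\<forall>p\<in>set xs. \<exists>a. p = Close a" unfolding P_def by (metis paren.exhaust)
    then have "\<exists>X. xs = map Close X" by (induction xs) (auto simp: Cons_eq_map_conv)
    then obtain X where X: "xs = map Close X" by blast
    have hd: "P (hd \<tau>)" using 1(2) False unfolding P_def by (metis list.collapse paren.exhaust)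
    have "ys \<noteq> []" using hd False unfolding ys_def by (cases \<tau>) auto
    then have "Y \<noteq> []" using Y by simp
    have "r \<noteq> []"
    proof
      assume "r = []"
      then have "\<tau> = map Open Y" using \<tau> Y by simp
      then have "\<tau> = map Open (butlast Y) @ [Open (last Y)]"
        using \<open>Y \<noteq> []\<close> by (metis append_butlast_last_id list.simps(8,9) map_append)
      with 1(3) show False by blast
    qed
    have "\<not> P (hd r)" using \<open>r \<noteq> []\<close> unfolding r_def by (rule hd_dropWhile)
    then have "xs \<noteq> []" using \<open>r \<noteq> []\<close> unfolding xs_def by (cases r) auto
    then have "X \<noteq> []" using X by simp
    have q1: "\<nexists>a v. q = Close a # v"
    proof clarify
      fix a v assume q: "q = Close a # v"
      then have "\<not> (Not \<circ> P) (hd q)" unfolding q_def by (metis hd_dropWhile list.distinct(1))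
      with q show False unfolding P_def by simp
    qed
    have q2: "\<nexists>a u. q = u @ [Open a]" using 1(3) \<tau> by (metis append.assoc)
    have "length q < length \<tau>" using \<tau> \<open>ys \<noteq> []\<close> by simp
    with 1(1) q1 q2 obtain z where "has_blocks q z" by blast
    then obtain bs where "\<forall>(Y, X) \<in> set bs. Y \<noteq> [] \<and> X \<noteq> []" "q = block_string bs"
      unfolding has_blocks_def by blast
    then show ?thesis unfolding has_blocks_def
      using \<tau> X Y \<open>X \<noteq> []\<close> \<open>Y \<noteq> []\<close> by (intro exI[of _ "Suc (length bs)"] exI[of _ "(Y, X) # bs"]) auto
  qed
qed

lemma map_Open_Close_split:
  assumes "map Open Y @ map Close X @ u = map Open Y' @ map Close X' @ u'"
    and "X \<noteq> []" "X' \<noteq> []" "\<nexists>a v. u = Close a # v" "\<nexists>a v. u' = Close a # v"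
  shows "u = u'"
proof -
  have A: "map Close X @ u = map Close X' @ u'"
    using assms(1)
  proof (induction Y arbitrary: Y')
    case Nil
    then show ?case using assms(2) by (cases Y'; cases X) auto
  next
    case (Cons y Y)
    then show ?case using assms(3) by (cases Y'; cases X') auto
  qed
  show ?thesis using A
  proof (induction X arbitrary: X')
    case Nil
    then show ?case using assms(4) by (cases X') auto
  next
    case (Cons x X)
    then show ?case using assms(5) by (cases X') auto
  qed
qed

lemma block_string_hd:
  "\<forall>(Y, X) \<in> set bs. Y \<noteq> [] \<and> X \<noteq> [] \<Longrightarrow> \<nexists>a v. block_string bs = Close a # v"
proof (cases bs)
  case (Cons p bs')
  assume "\<forall>(Y, X) \<in> set bs. Y \<noteq> [] \<and> X \<noteq> []"
  with Cons show ?thesis by (cases p; cases "fst p") auto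
qed simp

lemma has_blocks_unique: "has_blocks \<tau> z \<Longrightarrow> has_blocks \<tau> z' \<Longrightarrow> z = z'"
proof -
  have "length bs = length bs'"
    if "\<forall>(Y, X) \<in> set bs. Y \<noteq> [] \<and> X \<noteq> []" "\<forall>(Y, X) \<in> set bs'. Y \<noteq> [] \<and> X \<noteq> []"
      "block_string bs = block_string bs'" for bs bs'
    using that
  proof (induction bs arbitrary: bs')
    case Nil
    then show ?case by (cases bs') auto
  next
    case (Cons p bs)
    obtain Y X where p: "p = (Y, X)" by fastforce
    then have "bs' \<noteq> []" using Cons.prems by auto
    then obtain Y' X' cs where bs': "bs' = (Y', X') # cs" by (metis list.exhaust surj_pair)
    have "block_string bs = block_string cs"
    proof (rule map_Open_Close_split[of Y X _ Y' X'])
      show "\<nexists>a v. block_string bs = Close a # v" "\<nexists>a v. block_string cs = Close a # v"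
        using Cons.prems p bs' by (intro block_string_hd; simp)+
    qed (use Cons.prems p bs' in auto)
    then show ?case using Cons p bs' by auto
  qed
  then show "has_blocks \<tau> z \<Longrightarrow> has_blocks \<tau> z' \<Longrightarrow> z = z'"
    unfolding has_blocks_def by blast
qed

fun push :: "nat \<Rightarrow> paren \<Rightarrow> paren list \<Rightarrow> paren list" where
  "push s (Close a) (Open b # st) = (if a = b \<and> a < s then st else Close a # Open b # st)"
| "push s p st = p # st"

lemma push_Open [simp]: "push s (Open a) st = Open a # st"
  by simp

lemma push_bottom: "push s p (st @ [Close a]) = push s p st @ [Close a]"
  by (induction s p st rule: push.induct) auto

lemma fold_push_bottom: "fold (push s) v (st @ [Close a]) = fold (push s) v st @ [Close a]"
  by (induction v arbitrary: st) (simp_all add: push_bottom)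

lemma fold_push_Dyck: "w \<in> Dyck s \<Longrightarrow> fold (push s) w st = st"
  by (induction arbitrary: st rule: Dyck.induct) auto

definition is_open :: "paren \<Rightarrow> bool" where
  "is_open p \<longleftrightarrow> (\<exists>a. p = Open a)"

definition strip :: "paren list \<Rightarrow> paren list" where
  "strip l = dropWhile (Not \<circ> is_open) (rev (dropWhile is_open l))"

lemma strip_simps:
  "strip (Open a # l) = strip l"
  "strip (l @ [Close a]) = strip l"
proof -
  show "strip (Open a # l) = strip l" by (simp add: strip_def is_open_def)
  have c: "\<not> is_open (Close a)" by (simp add: is_open_def)
  show "strip (l @ [Close a]) = strip l"
  proof (cases "\<forall>p\<in>set l. is_open p")
    case True
    then have e1: "dropWhile is_open l = []" by (simp add: dropWhile_eq_Nil_conv)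
    from True c have e2: "dropWhile is_open (l @ [Close a]) = [Close a]"
      by (simp add: dropWhile_append2)
    show ?thesis unfolding strip_def e1 e2 using c by simp
  next
    case False
    with c show ?thesis by (auto simp: strip_def dropWhile_append)
  qed
qed

lemma simplify_strip:
  "simplify s \<sigma> \<tau> \<Longrightarrow> strip (fold (push s) \<sigma> []) = strip (fold (push s) \<tau> [])"
proof (induction rule: simplify.induct)
  case (prefix_close a v)
  show ?case using fold_push_bottom[of s v "[]" a] by (simp add: strip_simps)
qed (simp_all add: strip_simps fold_push_Dyck)

lemma irreducible_fold_push:
  assumes "\<nexists>\<tau>'. simplify s \<tau> \<tau>'"
  shows "strip (fold (push s) \<tau> []) = \<tau>"
proof -
  have nobal: "\<tau> \<noteq> u @ [Open a, Close a] @ v" if "a < s" for u a v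
    using simplify.balanced[of "[Open a, Close a]" s u v] Dyck.wrap[OF that Dyck.empty] assms by auto
  have "fold (push s) u [] = rev u" if "\<tau> = u @ v" for u v
    using that
  proof (induction u arbitrary: v rule: rev_induct)
    case (snoc p u)
    then have IH: "fold (push s) u [] = rev u" by simp
    show ?case
    proof (cases "\<exists>a u'. p = Close a \<and> u = u' @ [Open a] \<and> a < s")
      case True
      with snoc.prems nobal show ?thesis by fastforce
    next
      case False
      then show ?thesis using IH
        by (cases u rule: rev_cases; cases p; cases "last u") auto
    qed
  qed simp
  then have f: "fold (push s) \<tau> [] = rev \<tau>" by simp
  have 1: "\<not> is_open (hd (rev \<tau>))" if "\<tau> \<noteq> []"
    using that assms simplify.suffix_open[of s "butlast \<tau>"]
    unfolding is_open_def by (metis append_butlast_last_id hd_rev)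
  have 2: "is_open (hd \<tau>)" if "\<tau> \<noteq> []"
    using that assms simplify.prefix_close[of s]
    unfolding is_open_def by (metis list.collapse paren.exhaust)
  have "dropWhile is_open (rev \<tau>) = rev \<tau>" using 1 by (cases "rev \<tau>") auto
  moreover have "dropWhile (Not \<circ> is_open) \<tau> = \<tau>" using 2 by (cases \<tau>) auto
  ultimately show ?thesis unfolding f strip_def by simp
qed

lemma simplified_form_unique:
  assumes "simplified_form s \<sigma> \<tau>"
  shows "\<tau> = strip (fold (push s) \<sigma> [])"
proof -
  have "(simplify s)\<^sup>*\<^sup>* \<sigma> \<tau>" and irr: "\<nexists>\<tau>'. simplify s \<tau> \<tau>'"
    using assms unfolding simplified_form_def by auto
  from this(1) have "strip (fold (push s) \<sigma> []) = strip (fold (push s) \<tau> [])"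
    by (induction rule: rtranclp_induct) (auto dest: simplify_strip)
  then show ?thesis using irreducible_fold_push[OF irr] by simp
qed

lemma num_blocks_ex1: "\<exists>!z. \<exists>\<tau>. simplified_form s \<sigma> \<tau> \<and> has_blocks \<tau> z"
proof -
  obtain \<tau> where \<tau>: "simplified_form s \<sigma> \<tau>" using simplified_form_exists by blast
  then have "\<exists>z. has_blocks \<tau> z"
    unfolding simplified_form_def
    by (intro has_blocks_exists) (blast intro: simplify.intros)+
  with \<tau> show ?thesis
    using simplified_form_unique has_blocks_unique by metis
qed

section \<open>Randomized word RAM\<close>

text \<open>Registers and memory cells hold natural numbers, every instruction takes one time unit,
  and \<open>Coin\<close> flips a fair coin. A program is a finite instruction list; it halts when the
  program counter leaves the list, and its output is then the content of register 0.
  The bound on the word length is imposed by \<open>word_bounded\<close> below.\<close>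

datatype instr =
    Const nat nat
  | Add nat nat nat
  | Sub nat nat nat
  | Mul nat nat nat
  | Div nat nat nat
  | Load nat nat
  | Store nat nat
  | Jump nat
  | JumpZero nat nat
  | Coin nat

type_synonym program = "instr list"

record config =
  pc :: nat
  regs :: "nat \<Rightarrow> nat"
  mem :: "nat \<Rightarrow> nat"

definition set_reg :: "nat \<Rightarrow> nat \<Rightarrow> config \<Rightarrow> config" where
  "set_reg r v c = c\<lparr>pc := Suc (pc c), regs := (regs c)(r := v)\<rparr>"

fun exec :: "instr \<Rightarrow> config \<Rightarrow> config pmf" where
  "exec (Const r v) c = return_pmf (set_reg r v c)"
| "exec (Add r i j) c = return_pmf (set_reg r (regs c i + regs c j) c)"
| "exec (Sub r i j) c = return_pmf (set_reg r (regs c i - regs c j) c)"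
| "exec (Mul r i j) c = return_pmf (set_reg r (regs c i * regs c j) c)"
| "exec (Div r i j) c = return_pmf (set_reg r (regs c i div regs c j) c)"
| "exec (Load r i) c = return_pmf (set_reg r (mem c (regs c i)) c)"
| "exec (Store i r) c =
     return_pmf (c\<lparr>pc := Suc (pc c), mem := (mem c)(regs c i := regs c r)\<rparr>)"
| "exec (Jump l) c = return_pmf (c\<lparr>pc := l\<rparr>)"
| "exec (JumpZero r l) c = return_pmf (c\<lparr>pc := (if regs c r = 0 then l else Suc (pc c))\<rparr>)"
| "exec (Coin r) c = map_pmf (\<lambda>b. set_reg r (of_bool b) c) (bernoulli_pmf (1/2))"

definition halted :: "program \<Rightarrow> config \<Rightarrow> bool" where
  "halted P c \<longleftrightarrow> length P \<le> pc c"

definition step :: "program \<Rightarrow> config \<Rightarrow> config pmf" where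
  "step P c = (if halted P c then return_pmf c else exec (P ! pc c) c)"

primrec run :: "program \<Rightarrow> nat \<Rightarrow> config \<Rightarrow> config pmf" where
  "run P 0 c = return_pmf c"
| "run P (Suc t) c = bind_pmf (run P t c) (step P)"

definition initial :: "nat list \<Rightarrow> config" where
  "initial ws = \<lparr>pc = 0, regs = (\<lambda>_. 0), mem = (\<lambda>i. if i < length ws then ws ! i else 0)\<rparr>"

definition result :: "config \<Rightarrow> nat" where
  "result c = regs c 0"

definition word_bounded :: "program \<Rightarrow> config \<Rightarrow> nat \<Rightarrow> bool" where
  "word_bounded P c B \<longleftrightarrow>
     (\<forall>t. \<forall>c' \<in> set_pmf (run P t c). (\<forall>r. regs c' r \<le> B) \<and> (\<forall>i. mem c' i \<le> B))"

section \<open>Approximation algorithms\<close>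

text \<open>In both definitions the bound \<open>(n + k + 2) ^ e\<close> resp. \<open>(n + s + 2) ^ e\<close> on the
  values that occur says that words have logarithmic length in the input length and the alphabet
  size.\<close>

definition string_input :: "nat list \<Rightarrow> nat list \<Rightarrow> config" where
  "string_input x y = initial (length x # length y # x @ y)"

text \<open>The input length is the total length of both strings. The guarantees hold for every outcome
  of the coin flips, and \<open>k\<close> ranges over all alphabet sizes.\<close>

definition str_edit_algorithm :: "program \<Rightarrow> (nat \<Rightarrow> real) \<Rightarrow> (nat \<Rightarrow> real) \<Rightarrow> bool" where
  "str_edit_algorithm P \<alpha> \<beta> \<longleftrightarrow>
     (\<exists>e. \<forall>k x y n. set x \<subseteq> {..<k} \<and> set y \<subseteq> {..<k} \<and> n = length x + length y \<longrightarrow>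
        word_bounded P (string_input x y) ((n + k + 2) ^ e) \<and>
        (\<forall>c \<in> set_pmf (run P (nat \<lfloor>\<alpha> n\<rfloor>) (string_input x y)).
           halted P c \<and> edit_dist x y \<le> result c \<and> real (result c) \<le> \<beta> n * real (edit_dist x y)))"

fun paren_code :: "paren \<Rightarrow> nat" where
  "paren_code (Open a) = 2 * a"
| "paren_code (Close a) = 2 * a + 1"

definition paren_input :: "paren list \<Rightarrow> config" where
  "paren_input \<sigma> = initial (length \<sigma> # map paren_code \<sigma>)"

definition fits_words :: "program \<Rightarrow> nat \<Rightarrow> bool" where
  "fits_words P s \<longleftrightarrow>
     (\<exists>e. \<forall>\<sigma> \<in> lists (parens s). word_bounded P (paren_input \<sigma>) ((length \<sigma> + s + 2) ^ e))"

text \<open>The probability that \<open>P\<close> halts on input \<open>\<sigma>\<close> within time \<open>t\<close> and outputs a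
  \<open>\<rho>\<close>-approximation of the distance from \<open>\<sigma>\<close> to the Dyck language.\<close>

definition success_prob :: "program \<Rightarrow> nat \<Rightarrow> paren list \<Rightarrow> real \<Rightarrow> real \<Rightarrow> real" where
  "success_prob P s \<sigma> t \<rho> =
     measure_pmf.prob (run P (nat \<lfloor>t\<rfloor>) (paren_input \<sigma>))
       {c. halted P c \<and> dyck_dist s \<sigma> \<le> result c \<and> real (result c) \<le> \<rho> * real (dyck_dist s \<sigma>)}"

end

theory Submission
  imports Defs "HOL-Library.Sublist"
begin

text \<open>A deterministic algorithm suffices, and it calls the string edit distance algorithm only once, on an
  input of length exactly \<open>n\<close>.

  Ignore the types and match every maximal run of open parentheses with the adjacent run of close
  parentheses as far as the shorter of the two allows; remove the matched chains and repeat. In any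
  noncrossing matching, a removed chain of \<open>k\<close> open and \<open>k\<close> close parentheses cannot have partners
  outside on both sides, so it has at least as many unmatched symbols as outside partners.
  Hence removing chains does not increase the number of deletions needed. For the same reason the
  string edit distances of all chains of one pass sum up to at most twice the number of deletions
  needed, because the cost of turning a string into a factor of a Dyck word is superadditive under
  concatenation. After correctly typed pairs have been cancelled there are \<open>z\<close> blocks, and every pass
  halves their number, so there are about \<open>log z\<close> passes.

  All chains are glued into one pair of strings in which the symbols of different chains are tagged
  differently: common subsequences then split along the chains, and each of them is a Dyck word
  inside its chain.\<close>

subsection \<open>Edit distance and common subsequences\<close>

text \<open>Nothing is known about \<open>\<alpha>\<close> and \<open>\<beta>\<close> beyond the
  guarantee itself, neither monotonicity nor superadditivity. Separate calls for separate chains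
  could not be compared with \<open>\<alpha> n\<close> and \<open>\<beta> n\<close>, which forces
  one instance of total length exactly \<open>n\<close>; symbols left after the last pass stay in it
  as padding that can never be matched. The factor collects these losses. Restricting edits to
  deletions costs a factor 2. If \<open>D\<close> deletions are needed, each of the \<open>p\<close>
  passes adds at most \<open>2 * D\<close> to the edit distance of the instance and the padding at
  most \<open>D\<close>, so the instance has distance at most \<open>(4 * p + 2) * d\<close>.
  Conversely its distance bounds \<open>d\<close> only up to a factor 2, so the program returns
  twice the computed value. The tags must stay polynomial in \<open>n + s\<close>, since words have
  logarithmic length and the simulated algorithm may use a power of its alphabet size.\<close>

lemma edit_step_context: "edit_step x y \<Longrightarrow> edit_step (p @ x @ q) (p @ y @ q)"
proof (induction rule: edit_step.induct)
  case (insertion u v a)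
  show ?case using edit_step.insertion[of "p @ u" "v @ q" a] by simp
next
  case (deletion u a v)
  show ?case using edit_step.deletion[of "p @ u" a "v @ q"] by simp
next
  case (substitution u a v b)
  show ?case using edit_step.substitution[of "p @ u" a "v @ q" b] by simp
qed

lemma edit_steps_context: "(edit_step ^^ k) x y \<Longrightarrow> (edit_step ^^ k) (p @ x @ q) (p @ y @ q)"
  by (induction k arbitrary: y) (auto intro: edit_step_context)

lemma edit_steps_trans:
  "(edit_step ^^ k) x y \<Longrightarrow> (edit_step ^^ l) y z \<Longrightarrow> (edit_step ^^ (k + l)) x z"
  by (auto simp: relpowp_add)

lemma edit_steps_subseq: "subseq c x \<Longrightarrow> (edit_step ^^ (length x - length c)) x c"
proof (induction rule: list_emb.induct)
  case (list_emb_Nil ys)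
  show ?case
  proof (induction ys)
    case (Cons a ys)
    have "edit_step (a # ys) ys" using edit_step.deletion[of "[]" a ys] by simp
    with Cons show ?case using relpowp_Suc_I2[of edit_step "a # ys" ys "length ys" "[]"] by simp
  qed simp
next
  case (list_emb_Cons xs ys y)
  have "edit_step (y # ys) ys" using edit_step.deletion[of "[]" y ys] by simp
  moreover have "length (y # ys) - length xs = Suc (length ys - length xs)"
    using list_emb_length[OF list_emb_Cons.hyps] by simp
  ultimately show ?case using list_emb_Cons.IH by (metis relpowp_Suc_I2)
next
  case (list_emb_Cons2 x y xs ys)
  then show ?case using edit_steps_context[of _ ys xs "[x]" "[]"] by simp
qed

lemma edit_step_sym: "edit_step x y \<Longrightarrow> edit_step y x"
  by (induction rule: edit_step.induct) (rule edit_step.intros)+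

lemma edit_steps_sym: "(edit_step ^^ k) x y \<Longrightarrow> (edit_step ^^ k) y x"
proof (induction k arbitrary: y)
  case (Suc k)
  then obtain b where "(edit_step ^^ k) x b" "edit_step b y" by auto
  with Suc.IH show ?case by (metis relpowp_Suc_I2 edit_step_sym)
qed simp

lemma edit_steps_common_subseq:
  assumes "subseq c x" "subseq c y"
  shows "(edit_step ^^ ((length x - length c) + (length y - length c))) x y"
  using assms by (intro edit_steps_trans[OF edit_steps_subseq edit_steps_sym[OF edit_steps_subseq]])

lemma edit_steps_edit_dist: "(edit_step ^^ edit_dist x y) x y"
  unfolding edit_dist_def by (rule LeastI) (rule edit_steps_common_subseq[of "[]"]; simp)

lemma edit_dist_le: "(edit_step ^^ k) x y \<Longrightarrow> edit_dist x y \<le> k"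
  unfolding edit_dist_def by (rule Least_le)

lemma edit_dist_common_subseq:
  "subseq c x \<Longrightarrow> subseq c y \<Longrightarrow> edit_dist x y \<le> (length x - length c) + (length y - length c)"
  by (intro edit_dist_le edit_steps_common_subseq)

lemma edit_dist_append: "edit_dist (a @ b) (c @ d) \<le> edit_dist a c + edit_dist b d"
proof (rule edit_dist_le, rule edit_steps_trans)
  show "(edit_step ^^ edit_dist a c) (a @ b) (c @ b)"
    using edit_steps_context[OF edit_steps_edit_dist[of a c], of "[]" b] by simp
  show "(edit_step ^^ edit_dist b d) (c @ b) (c @ d)"
    using edit_steps_context[OF edit_steps_edit_dist[of b d], of c "[]"] by simp
qed

lemma subseq_remove_one:
  assumes "subseq c (u @ [a] @ v)"
  obtains c' where "subseq c' c" "subseq c' (u @ v)" "length c \<le> Suc (length c')"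
proof -
  from assms obtain c1 c2 c3 where c: "c = c1 @ c2 @ c3"
    "subseq c1 u" "subseq c2 [a]" "subseq c3 v"
    by (metis subseq_appendE)
  then have "length c2 \<le> 1" using list_emb_length by fastforce
  with c show thesis
    by (intro that[of "c1 @ c3"]) (auto intro: list_emb_append_mono subseq_drop_many)
qed

text \<open>Per step the common subsequence loses at most one symbol, and a deletion that hits it
  shortens the string as well; hence each of the two lengths is bounded on its own.\<close>

lemma common_subseq_of_edit_steps:
  "(edit_step ^^ k) x y \<Longrightarrow>
    \<exists>c. subseq c x \<and> subseq c y \<and> length x \<le> length c + k \<and> length y \<le> length c + k"
proof (induction k arbitrary: y)
  case 0
  then show ?case by (auto intro!: exI[of _ x])
next
  case (Suc k)
  then obtain w where w: "(edit_step ^^ k) x w" "edit_step w y" by auto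
  from Suc.IH[OF w(1)] obtain c where c: "subseq c x" "subseq c w"
    "length x \<le> length c + k" "length w \<le> length c + k" by blast
  from w(2) show ?case
  proof cases
    case (insertion u v a)
    with c have "subseq c y"
      by (auto intro!: subseq_order.trans[of c "u @ v"] list_emb_append_mono)
    with c insertion show ?thesis by (intro exI[of _ c]) auto
  next
    case (deletion u a v)
    with c(2) obtain c' where "subseq c' c" "subseq c' (u @ v)" "length c \<le> Suc (length c')"
      by (metis subseq_remove_one)
    with c deletion show ?thesis
      by (intro exI[of _ c']) (auto intro: subseq_order.trans)
  next
    case (substitution u a v b)
    with c(2) obtain c' where c': "subseq c' c" "subseq c' (u @ v)" "length c \<le> Suc (length c')"
      by (metis subseq_remove_one)
    then have "subseq c' y" unfolding substitution
      by (auto intro!: subseq_order.trans[of c' "u @ v"] list_emb_append_mono)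
    with c c' substitution show ?thesis
      by (intro exI[of _ c']) (auto intro: subseq_order.trans)
  qed
qed

lemma common_subseq_of_edit_dist:
  obtains c where "subseq c x" "subseq c y"
    "length x \<le> length c + edit_dist x y" "length y \<le> length c + edit_dist x y"
  using common_subseq_of_edit_steps[OF edit_steps_edit_dist] by blast

subsection \<open>Deletion distance to the Dyck language and to its factors\<close>

text \<open>Each symbol missing from \<open>c\<close> strands at most its partner, which is dropped
  too: \<open>length c - length w'\<close> is at most \<open>length w - length c\<close>, here
  written without subtraction.\<close>

lemma Dyck_subseq_of_subseq:
  "w \<in> Dyck s \<Longrightarrow> subseq c w \<Longrightarrow>
    \<exists>w' \<in> Dyck s. subseq w' c \<and> 2 * length c \<le> length w' + length w"
proof (induction arbitrary: c rule: Dyck.induct)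
  case (concat u v)
  from concat.prems obtain c1 c2 where c: "c = c1 @ c2" "subseq c1 u" "subseq c2 v"
    by (rule subseq_appendE)
  from concat.IH(1)[OF c(2)] concat.IH(2)[OF c(3)] obtain w1 w2 where
    "w1 \<in> Dyck s" "w2 \<in> Dyck s" "subseq w1 c1" "subseq w2 c2"
    "2 * length c1 \<le> length w1 + length u" "2 * length c2 \<le> length w2 + length v" by blast
  then show ?case unfolding c(1)
    by (intro bexI[of _ "w1 @ w2"]) (auto intro: Dyck.concat list_emb_append_mono)
next
  case (wrap a u)
  from wrap.prems obtain c1 c2 c3 where c: "c = c1 @ c2 @ c3"
    "subseq c1 [Open a]" "subseq c2 u" "subseq c3 [Close a]"
    by (metis subseq_appendE)
  from wrap.IH[OF c(3)] obtain w' where w': "w' \<in> Dyck s" "subseq w' c2"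
    "2 * length c2 \<le> length w' + length u" by blast
  have c13: "length c1 \<le> 1" "length c3 \<le> 1"
    using c(2,4) list_emb_length by fastforce+
  show ?case
  proof (cases "length c1 = 1 \<and> length c3 = 1")
    case True
    with c have "c1 = [Open a]" "c3 = [Close a]"
      by (auto dest!: subseq_same_length)
    with w' wrap.hyps c(1) show ?thesis
      by (intro bexI[of _ "[Open a] @ w' @ [Close a]"]) (auto intro: Dyck.wrap[simplified])
  next
    case False
    with c13 have "length c1 + length c3 \<le> 1" by linarith
    with w' c(1) show ?thesis
      by (intro bexI[of _ w']) (auto intro: subseq_drop_many subseq_rev_drop_many)
  qed
qed (use Dyck.empty in auto)


text \<open>\<open>push\<close> only ever pops open parentheses, so a close parenthesis that reaches
  the stack never disappears and shields everything below it.\<close>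

lemma fold_push_above_Close:
  "fold (push s) v (st @ Close a # st') = fold (push s) v st @ Close a # st'"
proof (induction v arbitrary: st)
  case (Cons p v)
  have "push s p (st @ Close a # st') = push s p st @ Close a # st'"
    by (induction s p st rule: push.induct) auto
  with Cons show ?case by simp
qed simp

text \<open>A close parenthesis that meets an open one of another type would stay on the stack for
  good, so an empty final stack forces agreement until one of the two runs is exhausted.\<close>

lemma fold_push_Closes_Nil:
  assumes "fold (push s) (map Close X @ q) (map Open A @ st) = []"
  shows "\<exists>n. take n A = take n X \<and> n = min (length A) (length X)"
  using assms
proof (induction X arbitrary: A)
  case (Cons b X)
  show ?case
  proof (cases A)
    case (Cons a A')
    have "a = b \<and> a < s"
    proof (rule ccontr)
      assume "\<not> ?thesis"
      then have "push s (Close b) (map Open A @ st) = [] @ Close b # map Open A @ st"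
        using Cons by auto
      with Cons.prems fold_push_above_Close[of s "map Close X @ q" "[]" b] show False by auto
    qed
    with Cons.prems Cons Cons.IH[of A'] show ?thesis by auto
  qed simp
qed simp

section \<open>Deletions needed to reach a Dyck word or a factor of one\<close>

definition dyck_near :: "nat \<Rightarrow> paren list \<Rightarrow> nat \<Rightarrow> bool" where
  "dyck_near s w k \<longleftrightarrow> (\<exists>w' \<in> Dyck s. subseq w' w \<and> length w \<le> length w' + k)"

text \<open>The context \<open>p\<close>, \<open>q\<close> supplies outside partners for free. This
  makes concatenation superadditive; for \<open>dyck_near\<close> that fails, as
  \<open>[Open a]\<close> and \<open>[Close a]\<close> with \<open>a < s\<close> need one deletion
  each and their concatenation none.\<close>

definition factor_near :: "nat \<Rightarrow> paren list \<Rightarrow> nat \<Rightarrow> bool" where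
  "factor_near s w k \<longleftrightarrow> (\<exists>w' p q. p @ w' @ q \<in> Dyck s \<and> subseq w' w \<and> length w \<le> length w' + k)"

definition dyck_del :: "nat \<Rightarrow> paren list \<Rightarrow> nat" where
  "dyck_del s w = (LEAST k. dyck_near s w k)"

definition factor_del :: "nat \<Rightarrow> paren list \<Rightarrow> nat" where
  "factor_del s w = (LEAST k. factor_near s w k)"

lemma dyck_near_dyck_del: "dyck_near s w (dyck_del s w)"
  unfolding dyck_del_def
  by (rule LeastI[of _ "length w"]) (auto simp: dyck_near_def intro: Dyck.empty)

lemma dyck_del_le: "dyck_near s w k \<Longrightarrow> dyck_del s w \<le> k"
  unfolding dyck_del_def by (rule Least_le)

lemma factor_near_factor_del: "factor_near s w (factor_del s w)"
  unfolding factor_del_def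
  by (rule LeastI[of _ "length w"])
    (auto simp: factor_near_def intro: Dyck.empty intro!: exI[of _ "[]"])

lemma factor_del_le: "factor_near s w k \<Longrightarrow> factor_del s w \<le> k"
  unfolding factor_del_def by (rule Least_le)

lemma factor_del_le_dyck_del: "factor_del s w \<le> dyck_del s w"
proof (rule factor_del_le)
  obtain w' where "w' \<in> Dyck s" "subseq w' w" "length w \<le> length w' + dyck_del s w"
    using dyck_near_dyck_del unfolding dyck_near_def by blast
  then show "factor_near s w (dyck_del s w)" unfolding factor_near_def
    by (intro exI[of _ w'] exI[of _ "[]"]) simp
qed

text \<open>An optimal subsequence for \<open>u @ v\<close> splits into two parts, and each part is
  a factor of the same Dyck word once the other part is moved into its context.\<close>

lemma factor_del_append: "factor_del s u + factor_del s v \<le> factor_del s (u @ v)"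
proof -
  obtain w p q where w: "p @ w @ q \<in> Dyck s" "subseq w (u @ v)"
    "length (u @ v) \<le> length w + factor_del s (u @ v)"
    using factor_near_factor_del unfolding factor_near_def by blast
  from w(2) obtain u' v' where uv: "w = u' @ v'" "subseq u' u" "subseq v' v"
    by (rule subseq_appendE)
  have "factor_del s u \<le> length u - length u'"
    using w(1) uv by (intro factor_del_le) (unfold factor_near_def, rule exI[of _ u'], rule exI[of _ p], rule exI[of _ "v' @ q"], simp)
  moreover have "factor_del s v \<le> length v - length v'"
    using w(1) uv by (intro factor_del_le) (unfold factor_near_def, rule exI[of _ v'], rule exI[of _ "p @ u'"], rule exI[of _ q], simp)
  ultimately show ?thesis using w(3) uv list_emb_length[OF uv(2)] list_emb_length[OF uv(3)] by simp
qed

lemma factor_del_factor: "factor_del s w \<le> factor_del s (u @ w @ v)"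
  using factor_del_append[of s u "w @ v"] factor_del_append[of s w v] by linarith

lemma Dyck_not_start_Close: "w \<in> Dyck s \<Longrightarrow> w \<noteq> Close a # v"
proof
  assume "w \<in> Dyck s" "w = Close a # v"
  then show False using fold_push_Dyck[of w s "[]"] fold_push_above_Close[of s v "[]" a "[]"] by simp
qed

lemma Dyck_not_end_Open: "w \<in> Dyck s \<Longrightarrow> w \<noteq> v @ [Open a]"
proof
  assume "w \<in> Dyck s" "w = v @ [Open a]"
  then show False using fold_push_Dyck[of w s "[]"] by simp
qed

lemma Dyck_insert: "u @ v \<in> Dyck s \<Longrightarrow> w \<in> Dyck s \<Longrightarrow> u @ w @ v \<in> Dyck s"
proof (induction "u @ v" arbitrary: u v rule: Dyck.induct)
  case empty
  then show ?case by simp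
next
  case (concat x y)
  from concat.hyps(5) consider r where "x = u @ r" "v = r @ y" | r where "u = x @ r" "y = r @ v"
    by (auto simp: append_eq_append_conv2)
  then show ?case
  proof cases
    case 1
    then have "u @ w @ r \<in> Dyck s" using concat by blast
    from Dyck.concat[OF this concat.hyps(3)] 1 show ?thesis by simp
  next
    case 2
    then have "r @ w @ v \<in> Dyck s" using concat by blast
    from Dyck.concat[OF concat.hyps(1) this] 2 show ?thesis by simp
  qed
next
  case (wrap a x)
  from wrap.hyps(4) consider "u = []" "v = [Open a] @ x @ [Close a]"
    | "u = [Open a] @ x @ [Close a]" "v = []"
    | u' v' where "u = Open a # u'" "v = v' @ [Close a]" "x = u' @ v'"
    by (cases u; cases v rule: rev_cases) auto
  then show ?case
  proof cases
    case 3
    with wrap.hyps(3) wrap.prems have "u' @ w @ v' \<in> Dyck s" by blast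
    from Dyck.wrap[OF wrap.hyps(1) this] 3 show ?thesis by simp
  qed (use wrap Dyck.wrap[OF wrap.hyps(1,2)] in \<open>auto intro: Dyck.concat dest: Dyck.concat\<close>)
qed

text \<open>The two symbols are partners in every derivation: a boundary between them would yield a
  Dyck word that ends with an open or begins with a close parenthesis.\<close>

lemma Dyck_cancel: "u @ [Open a, Close b] @ v \<in> Dyck s \<Longrightarrow> u @ v \<in> Dyck s"
proof (induction "u @ [Open a, Close b] @ v" arbitrary: u v rule: Dyck.induct)
  case empty
  then show ?case by simp
next
  case (concat x y)
  from concat.hyps(5) consider r where "x = u @ [Open a, Close b] @ r" "v = r @ y"
    | r where "u = x @ r" "y = r @ [Open a, Close b] @ v" | "x = u @ [Open a]"
    by (auto simp: append_eq_append_conv2 Cons_eq_append_conv append_eq_Cons_conv)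
  then show ?case
  proof cases
    case 1
    then have "u @ r \<in> Dyck s" using concat by blast
    from Dyck.concat[OF this concat.hyps(3)] 1 show ?thesis by simp
  next
    case 2
    then have "r @ v \<in> Dyck s" using concat by blast
    from Dyck.concat[OF concat.hyps(1) this] 2 show ?thesis by simp
  next
    case 3
    with Dyck_not_end_Open concat.hyps(1) show ?thesis by blast
  qed
next
  case (wrap c x)
  show ?case
  proof (cases u)
    case Nil
    with wrap.hyps(4) have x: "x @ [Close c] = Close b # v" by auto
    with Dyck_not_start_Close[OF wrap.hyps(2)] have "x = []" by (cases x) auto
    with x Nil show ?thesis by (auto intro: Dyck.empty)
  next
    case (Cons p u')
    with wrap.hyps(4) have p: "p = Open c" and x: "x @ [Close c] = u' @ [Open a, Close b] @ v" by auto
    show ?thesis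
    proof (cases v rule: rev_cases)
      case Nil
      with x have "x = u' @ [Open a]" by simp
      with Dyck_not_end_Open wrap.hyps(2) show ?thesis by blast
    next
      case (snoc v' q)
      with x have "q = Close c" "x = u' @ [Open a, Close b] @ v'" by auto
      with wrap.hyps(3) have "u' @ v' \<in> Dyck s" by blast
      from Dyck.wrap[OF wrap.hyps(1) this] show ?thesis using p Cons snoc \<open>q = Close c\<close> by simp
    qed
  qed
qed

text \<open>The types \<open>a\<close> and \<open>b\<close> may differ: the two parentheses cannot both be matched outwards, since these
  matches would cross.\<close>

lemma dyck_del_cancel: "dyck_del s (u @ v) \<le> dyck_del s (u @ [Open a, Close b] @ v)"
proof (rule dyck_del_le)
  let ?k = "dyck_del s (u @ [Open a, Close b] @ v)"
  obtain w where w: "w \<in> Dyck s" "subseq w (u @ [Open a, Close b] @ v)"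
    "length (u @ [Open a, Close b] @ v) \<le> length w + ?k"
    using dyck_near_dyck_del unfolding dyck_near_def by blast
  from w(2) obtain u' m v' where m: "w = u' @ m @ v'" "subseq u' u" "subseq m [Open a, Close b]"
    "subseq v' v" by (metis subseq_appendE)
  have uv: "subseq (u' @ v') (u @ v)" using m by (auto intro: list_emb_append_mono)
  have "length m \<le> 2" using list_emb_length[OF m(3)] by simp
  then consider "m = [Open a, Close b]" | "length m \<le> 1"
    using m(3) by (auto dest: subseq_same_length simp: le_Suc_eq numeral_2_eq_2)
  then show "dyck_near s (u @ v) ?k"
  proof cases
    case 1
    with w m have "u' @ v' \<in> Dyck s" using Dyck_cancel by metis
    with uv w(3) m(1) 1 show ?thesis unfolding dyck_near_def by (intro bexI[of _ "u' @ v'"]) auto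
  next
    case 2
    \<comment> \<open>Dropping the at most one survivor of the pair may cost its partner too, hence
      up to two symbols; the two symbols by which the whole string becomes shorter pay for
      them.\<close>
    have "subseq (u' @ v') w" unfolding m(1) by (auto intro: list_emb_append_mono subseq_drop_many)
    from Dyck_subseq_of_subseq[OF w(1) this] obtain w' where
      "w' \<in> Dyck s" "subseq w' (u' @ v')" "2 * length (u' @ v') \<le> length w' + length w" by blast
    with uv w(3) m(1) 2 show ?thesis unfolding dyck_near_def
      by (intro bexI[of _ w']) (auto intro: subseq_order.trans)
  qed
qed

section \<open>Deletion distance against edit distance\<close>

lemma dyck_dist_le_dyck_del: "dyck_dist s w \<le> dyck_del s w"
proof -
  obtain w' where w': "w' \<in> Dyck s" "subseq w' w" "length w \<le> length w' + dyck_del s w"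
    using dyck_near_dyck_del unfolding dyck_near_def by blast
  have "dyck_dist s w \<le> edit_dist w w'"
    unfolding dyck_dist_def using w'(1) by (intro cINF_lower) auto
  also have "\<dots> \<le> length w - length w'" by (intro edit_dist_le edit_steps_subseq w')
  finally show ?thesis using w'(3) by linarith
qed

text \<open>With \<open>D\<close> edits, \<open>c\<close> lacks at most \<open>D\<close> symbols of
  \<open>w\<close> and at most \<open>D\<close> of the Dyck word \<open>v\<close>. The latter leave
  partners behind in \<open>c\<close>, whose removal costs up to \<open>D\<close> more
  deletions.\<close>

lemma dyck_del_le_dyck_dist: "dyck_del s w \<le> 2 * dyck_dist s w"
proof -
  have "dyck_dist s w \<in> edit_dist w ` Dyck s"
    unfolding dyck_dist_def using Dyck.empty by (intro Inf_nat_def1) blast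
  then obtain v where v: "v \<in> Dyck s" "dyck_dist s w = edit_dist w v" by blast
  obtain c where c: "subseq c w" "subseq c v" "length w \<le> length c + edit_dist w v"
    "length v \<le> length c + edit_dist w v" by (rule common_subseq_of_edit_dist)
  from Dyck_subseq_of_subseq[OF v(1) c(2)] obtain w' where
    "w' \<in> Dyck s" "subseq w' c" "2 * length c \<le> length w' + length v" by blast
  with c v show ?thesis
    by (intro dyck_del_le) (auto simp: dyck_near_def intro!: bexI[of _ w'] intro: subseq_order.trans)
qed

subsection \<open>Nested chains of pairs\<close>

text \<open>The pairs of \<open>g\<close> are listed from the innermost to the outermost one.\<close>

definition chain :: "(nat \<times> nat) list \<Rightarrow> paren list" where
  "chain g = map Open (rev (map fst g)) @ map Close (map snd g)"

lemma chain_Nil [simp]: "chain [] = []"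
  by (simp add: chain_def)

lemma chain_snoc: "chain (g @ [(a, b)]) = Open a # chain g @ [Close b]"
  by (simp add: chain_def)

lemma dyck_del_chain: "dyck_del s (u @ v) \<le> dyck_del s (u @ chain g @ v)"
proof (induction g arbitrary: u v rule: rev_induct)
  case (snoc p g)
  obtain a b where p: "p = (a, b)" by fastforce
  have "dyck_del s (u @ v) \<le> dyck_del s (u @ [Open a, Close b] @ v)" by (rule dyck_del_cancel)
  also have "\<dots> \<le> dyck_del s ((u @ [Open a]) @ chain g @ Close b # v)"
    using snoc[of "u @ [Open a]" "Close b # v"] by simp
  finally show ?case by (simp add: p chain_snoc)
qed simp

lemma Dyck_chain_diag: "set c \<subseteq> {..<s} \<Longrightarrow> map Open (rev c) @ map Close c \<in> Dyck s"
proof (induction c rule: rev_induct)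
  case (snoc a c)
  then show ?case using Dyck.wrap[of a s "map Open (rev c) @ map Close c"] by simp
qed (simp add: Dyck.empty)

lemma subseq_map_conv: "subseq c (map f xs) \<Longrightarrow> \<exists>ys. c = map f ys \<and> subseq ys xs"
proof -
  assume "subseq c (map f xs)"
  then obtain N where "c = nths (map f xs) N" using subseq_conv_nths by blast
  then show ?thesis by (auto simp: nths_map subseq_conv_nths)
qed

lemma subseq_rev: "subseq x y \<Longrightarrow> subseq (rev x) (rev y)"
  by (induction rule: list_emb.induct) (auto intro: list_emb_append_mono subseq_rev_drop_many)

text \<open>Inside a factor of a Dyck word either all open or all close parentheses of the chain are matched
  within the chain, so every unmatched one on that side has been deleted.\<close>

lemma edit_dist_chain: "edit_dist (map (f \<circ> fst) g) (map (f \<circ> snd) g) \<le> 2 * factor_del s (chain g)"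
proof -
  obtain w p q where w: "p @ w @ q \<in> Dyck s" "subseq w (chain g)"
    "length (chain g) \<le> length w + factor_del s (chain g)"
    using factor_near_factor_del unfolding factor_near_def by blast
  from w(2) obtain u v where uv: "w = u @ v" "subseq u (map Open (rev (map fst g)))"
    "subseq v (map Close (map snd g))" unfolding chain_def by (rule subseq_appendE)
  then obtain Y X where Y: "u = map Open Y" "subseq Y (rev (map fst g))"
    and X: "v = map Close X" "subseq X (map snd g)"
    by (metis subseq_map_conv)
  \<comment> \<open>\<open>rev Y\<close> lies on the stack with the innermost open parenthesis on
    top, and \<open>X\<close> starts with the innermost close one, so the survivors are compared
    from the inside outwards.\<close>
  have "fold (push s) (map Close X @ q) (map Open (rev Y) @ fold (push s) p []) = []"
  proof -
    have "fold (push s) (map Open Y) st = map Open (rev Y) @ st" for st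
      by (induction Y arbitrary: st) simp_all
    with fold_push_Dyck[OF w(1), of "[]"] uv(1) Y(1) X(1) show ?thesis by simp
  qed
  from fold_push_Closes_Nil[OF this] obtain n where
    n: "take n (rev Y) = take n X" "n = min (length Y) (length X)" by auto
  let ?c = "take n X"
  have len: "length ?c = n" using n by simp
  have "subseq (rev Y) (rev (rev (map fst g)))" using Y(2) subseq_rev by blast
  then have c1: "subseq ?c (map fst g)"
    unfolding n(1)[symmetric] by (auto intro: subseq_order.trans[rotated] prefix_imp_subseq take_is_prefix)
  have c2: "subseq ?c (map snd g)"
    using X(2) by (auto intro: subseq_order.trans[rotated] prefix_imp_subseq take_is_prefix)
  have "edit_dist (map f (map fst g)) (map f (map snd g))
    \<le> (length (map f (map fst g)) - length (map f ?c)) + (length (map f (map snd g)) - length (map f ?c))"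
    by (intro edit_dist_common_subseq subseq_map c1 c2)
  also have "\<dots> = 2 * (length g - n)" using len by simp
  also have "\<dots> \<le> 2 * factor_del s (chain g)"
    using w(3) uv(1) X(1) Y(1) n(2) list_emb_length[OF X(2)] list_emb_length[OF Y(2)]
    by (simp add: chain_def)
  finally show ?thesis by simp
qed

subsection \<open>Removing chains and tagging their symbols\<close>

text \<open>The groups are listed in the order of their removal: a chain has to be contiguous only
  after the ones before it in the list are gone, so later chains may enclose earlier ones.\<close>

inductive reduces :: "paren list \<Rightarrow> (nat \<times> nat) list list \<Rightarrow> paren list \<Rightarrow> bool" where
  reduces_Nil: "reduces w [] w"
| reduces_Cons: "reduces (u @ v) gs w \<Longrightarrow> reduces (u @ chain g @ v) (g # gs) w"

lemma reduces_append: "reduces u gs v \<Longrightarrow> reduces v hs w \<Longrightarrow> reduces u (gs @ hs) w"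
  by (induction rule: reduces.induct) (auto intro: reduces.intros)

lemma dyck_del_reduces: "reduces w gs w' \<Longrightarrow> dyck_del s w' \<le> dyck_del s w"
  by (induction rule: reduces.induct) (auto intro: order_trans[OF _ dyck_del_chain])

lemma set_chain: "set (chain g) = Open ` fst ` set g \<union> Close ` snd ` set g"
  by (auto simp: chain_def)

lemma reduces_lists:
  "reduces w gs w' \<Longrightarrow> w \<in> lists (parens s) \<Longrightarrow>
    w' \<in> lists (parens s) \<and> (\<forall>g \<in> set gs. set g \<subseteq> {..<s} \<times> {..<s})"
proof (induction rule: reduces.induct)
  case (reduces_Cons u v gs w g)
  have "set (chain g) \<subseteq> parens s" using reduces_Cons.prems by auto
  then have "set g \<subseteq> {..<s} \<times> {..<s}" unfolding set_chain parens_def by fastforce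
  with reduces_Cons show ?case by auto
qed simp

lemma reduces_filter_length:
  "reduces w gs w' \<Longrightarrow> length (filter is_open w) = length (concat gs) + length (filter is_open w')"
  "reduces w gs w' \<Longrightarrow>
    length (filter (Not \<circ> is_open) w) = length (concat gs) + length (filter (Not \<circ> is_open) w')"
proof -
  have o: "filter is_open (chain g) = map Open (rev (map fst g))" for g
    by (auto simp: chain_def is_open_def filter_empty_conv intro!: filter_True)
  have c: "filter (Not \<circ> is_open) (chain g) = map Close (map snd g)" for g
    by (auto simp: chain_def is_open_def filter_empty_conv intro!: filter_True)
  show "reduces w gs w' \<Longrightarrow> length (filter is_open w) = length (concat gs) + length (filter is_open w')"
    by (induction rule: reduces.induct) (simp_all add: o)
  note c' = c[unfolded comp_def]
  show "reduces w gs w' \<Longrightarrow>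
    length (filter (Not \<circ> is_open) w) = length (concat gs) + length (filter (Not \<circ> is_open) w')"
    by (induction rule: reduces.induct) (simp_all add: c')
qed

text \<open>Group \<open>i\<close> gets even codes from \<open>2 * s * i\<close> up to
  \<open>2 * s * Suc i\<close>. The factor 2 agrees with the input code \<open>2 * a\<close> of
  \<open>Open a\<close> and leaves the odd numbers to the padding.\<close>

fun tagged :: "nat \<Rightarrow> (nat \<times> nat \<Rightarrow> nat) \<Rightarrow> nat \<Rightarrow> (nat \<times> nat) list list \<Rightarrow> nat list" where
  "tagged s f i [] = []"
| "tagged s f i (g # gs) = map (\<lambda>p. 2 * s * i + 2 * f p) g @ tagged s f (Suc i) gs"

lemma tagged_append: "tagged s f i (gs @ hs) = tagged s f i gs @ tagged s f (i + length gs) hs"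
  by (induction gs arbitrary: i) simp_all

lemma length_tagged: "length (tagged s f i gs) = length (concat gs)"
  by (induction gs arbitrary: i) simp_all

lemma tagged_bounds:
  assumes "\<forall>g \<in> set gs. \<forall>p \<in> set g. f p < s" "t \<in> set (tagged s f i gs)"
  shows "2 * s * i \<le> t" "t < 2 * s * (i + length gs)" "even t"
proof -
  have "2 * s * i \<le> t \<and> t < 2 * s * (i + length gs) \<and> even t"
    using assms
  proof (induction gs arbitrary: i)
    case (Cons g gs)
    show ?case
    proof (cases "t \<in> set (tagged s f (Suc i) gs)")
      case True
      from Cons.IH[OF _ True] Cons.prems(1) show ?thesis by (simp add: algebra_simps)
    next
      case False
      with Cons.prems obtain p where "p \<in> set g" "t = 2 * s * i + 2 * f p" by auto
      moreover from this Cons.prems(1) have "f p < s" by auto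
      moreover have "2 * s * i + 2 * s \<le> 2 * s * (i + length (g # gs))" by (simp add: algebra_simps)
      ultimately show ?thesis by (auto simp del: list.size)
    qed
  qed simp
  then show "2 * s * i \<le> t" "t < 2 * s * (i + length gs)" "even t" by auto
qed

lemma edit_dist_tagged:
  "edit_dist (tagged s fst i gs) (tagged s snd i gs) \<le> 2 * (\<Sum>g\<leftarrow>gs. factor_del s (chain g))"
proof (induction gs arbitrary: i)
  case Nil
  show ?case using edit_dist_common_subseq[of "[]" "[]" "[]"] by simp
next
  case (Cons g gs)
  have "edit_dist (map (\<lambda>p. 2 * s * i + 2 * fst p) g) (map (\<lambda>p. 2 * s * i + 2 * snd p) g)
    \<le> 2 * factor_del s (chain g)"
    using edit_dist_chain[of "\<lambda>a. 2 * s * i + 2 * a" g s] by (simp add: comp_def)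
  with Cons[of "Suc i"]
    edit_dist_append[of "map (\<lambda>p. 2 * s * i + 2 * fst p) g" "tagged s fst (Suc i) gs"
      "map (\<lambda>p. 2 * s * i + 2 * snd p) g" "tagged s snd (Suc i) gs"]
  show ?case by simp
qed

text \<open>Chains of different groups carry disjoint alphabets, so a common subsequence splits into common
  subsequences of the individual chains, each of which is a Dyck word inside its chain.\<close>

lemma Dyck_subseq_of_common_tagged:
  "reduces w gs w' \<Longrightarrow> \<forall>g \<in> set gs. set g \<subseteq> {..<s} \<times> {..<s} \<Longrightarrow>
    subseq c (tagged s fst i gs) \<Longrightarrow> subseq c (tagged s snd i gs) \<Longrightarrow>
    \<exists>v \<in> Dyck s. subseq v w \<and> length v = 2 * length c"
proof (induction arbitrary: c i rule: reduces.induct)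
  case (reduces_Nil w)
  then show ?case by (auto intro: Dyck.empty)
next
  case (reduces_Cons u v gs w g)
  let ?e = "\<lambda>a. 2 * s * i + 2 * a"
  have g: "set g \<subseteq> {..<s} \<times> {..<s}" and gs: "\<forall>g \<in> set gs. set g \<subseteq> {..<s} \<times> {..<s}"
    using reduces_Cons.prems by auto
  from reduces_Cons.prems(2) obtain c0 c1 where c: "c = c0 @ c1"
    "subseq c0 (map (?e \<circ> fst) g)" "subseq c1 (tagged s fst (Suc i) gs)"
    by (auto elim: subseq_appendE simp: comp_def)
  from reduces_Cons.prems(3) obtain d0 d1 where d: "c = d0 @ d1"
    "subseq d0 (map (?e \<circ> snd) g)" "subseq d1 (tagged s snd (Suc i) gs)"
    by (auto elim: subseq_appendE simp: comp_def)
  let ?P = "\<lambda>t. t < 2 * s * Suc i"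
  have small: "?P t" if "t \<in> set c0 \<union> set d0" for t
  proof -
    have "t \<in> set (map (?e \<circ> fst) g) \<union> set (map (?e \<circ> snd) g)"
      using that list_emb_set[OF c(2)] list_emb_set[OF d(2)] by blast
    with g show ?thesis by auto
  qed
  have large: "\<not> ?P t" if "t \<in> set c1 \<union> set d1" for t
  proof -
    have "t \<in> set (tagged s fst (Suc i) gs) \<union> set (tagged s snd (Suc i) gs)"
      using that list_emb_set[OF c(3)] list_emb_set[OF d(3)] by blast
    moreover have "\<forall>g \<in> set gs. \<forall>p \<in> set g. fst p < s" "\<forall>g \<in> set gs. \<forall>p \<in> set g. snd p < s"
      using gs by (metis lessThan_iff mem_Times_iff subsetD)+
    ultimately have "2 * s * Suc i \<le> t"
      using tagged_bounds(1)[of gs fst s t "Suc i"] tagged_bounds(1)[of gs snd s t "Suc i"] by blast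
    then show ?thesis by (simp only: not_less)
  qed
  have fil: "filter ?P (x @ y) = x" if "\<forall>t\<in>set x. ?P t" "\<forall>t\<in>set y. \<not> ?P t" for x y
    using that by (metis append_Nil2 filter_False filter_True filter_append)
  have "filter ?P c = c0" unfolding c(1) by (rule fil) (use small large in blast)+
  moreover have "filter ?P c = d0" unfolding d(1) by (rule fil) (use small large in blast)+
  ultimately have eq: "c0 = d0" "c1 = d1" using c(1) d(1) by auto
  obtain e where e: "c0 = map ?e e" "subseq e (map fst g)"
    using subseq_map_conv[of c0 ?e "map fst g"] c(2) by auto
  obtain e' where e': "c0 = map ?e e'" "subseq e' (map snd g)"
    using subseq_map_conv[of c0 ?e "map snd g"] d(2) eq by auto
  \<comment> \<open>Undoing the tag shows that the same list of types is a subsequence of both sides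
    of the chain.\<close>
  have "inj ?e" by (auto simp: inj_def)
  with e(1) e'(1) have ee: "e' = e" by (metis inj_map_eq_map)
  have "set e \<subseteq> set (map fst g)" using list_emb_set[OF e(2)] by blast
  moreover have "set (map fst g) \<subseteq> {..<s}" using g by (auto dest: subsetD)
  ultimately have "set e \<subseteq> {..<s}" by (rule subset_trans)
  then have D: "map Open (rev e) @ map Close e \<in> Dyck s" by (rule Dyck_chain_diag)
  from reduces_Cons.IH[OF gs c(3) d(3)[folded eq(2)]] obtain x where
    x: "x \<in> Dyck s" "subseq x (u @ v)" "length x = 2 * length c1"
    by (elim bexE conjE) (rule that)
  from x(2) obtain x1 x2 where x12: "x = x1 @ x2" "subseq x1 u" "subseq x2 v"
    by (rule subseq_appendE)
  have "subseq (map Open (rev e) @ map Close e) (chain g)"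
    unfolding chain_def using e(2) e'(2) ee
    by (intro list_emb_append_mono subseq_map subseq_rev) auto
  then have "subseq (x1 @ (map Open (rev e) @ map Close e) @ x2) (u @ chain g @ v)"
    using x12 by (intro list_emb_append_mono)
  moreover have "x1 @ (map Open (rev e) @ map Close e) @ x2 \<in> Dyck s"
    using Dyck_insert x x12 D by blast
  moreover have "length (x1 @ (map Open (rev e) @ map Close e) @ x2) = 2 * length c"
    using x(3) x12(1) c(1) e(1) by simp
  ultimately show ?case by blast
qed

subsection \<open>Removing balanced pairs\<close>

text \<open>\<open>push\<close> with a record of the cancelled pairs. Each pair forms a chain of its
  own with equal components, which gives equal symbols in both strings: no edit distance, but the
  right total length.\<close>

fun reduce :: "nat \<Rightarrow> paren list \<Rightarrow> paren list \<Rightarrow> paren list \<times> (nat \<times> nat) list list" where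
  "reduce s [] S = (S, [])"
| "reduce s (Close a # r) (Open b # S) =
    (if a = b \<and> a < s then (let (T, gs) = reduce s r S in (T, [(a, a)] # gs))
     else reduce s r (Close a # Open b # S))"
| "reduce s (p # r) S = reduce s r (p # S)"

lemma reduce_props:
  "reduce s r S = (T, gs) \<Longrightarrow>
    T = fold (push s) r S \<and> reduces (rev S @ r) gs (rev T) \<and> (\<forall>g \<in> set gs. \<exists>a. g = [(a, a)]) \<and>
    length gs \<le> length r"
proof (induction s r S arbitrary: T gs rule: reduce.induct)
  case (2 s a r b S)
  show ?case
  proof (cases "a = b \<and> a < s")
    case True
    with "2.prems" obtain hs where h: "reduce s r S = (T, hs)" "gs = [(a, a)] # hs"
      by (auto split: prod.splits)
    from "2.IH"(1)[OF True h(1)] h(2) True reduces_Cons[of "rev S" r hs "rev T" "[(a, a)]"]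
    show ?thesis by (auto simp: chain_def)
  next
    case False
    with 2 show ?thesis by auto
  qed
qed (auto intro: reduces_Nil)

lemma edit_dist_self: "edit_dist x x = 0"
  using edit_dist_common_subseq[of x x x] by simp

lemma tagged_diag:
  "\<forall>g \<in> set gs. \<exists>a. g = [(a, a)] \<Longrightarrow> tagged s fst i gs = tagged s snd i gs"
  by (induction gs arbitrary: i) auto

subsection \<open>One pass of type-blind matching\<close>

text \<open>\<open>F\<close> is the frozen part of the stack, \<open>A\<close> the run of open parentheses on top of it that the next
  close parentheses may match, \<open>m\<close> says that the previous symbol was a close parenthesis (or that
  there was none), and \<open>g\<close> is the chain that is being removed, innermost pair first.\<close>

fun pass :: "paren list \<Rightarrow> paren list \<Rightarrow> nat list \<Rightarrow> bool \<Rightarrow> (nat \<times> nat) list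
    \<Rightarrow> paren list \<times> (nat \<times> nat) list list" where
  "pass [] F A m g = (map Open A @ F, [g])"
| "pass (Open a # r) F A m g =
    (if m then (let (S, gs) = pass r (map Open A @ F) [a] False [] in (S, g # gs))
     else pass r F (a # A) False g)"
| "pass (Close b # r) F (a # A) m g = pass r F A True (g @ [(a, b)])"
| "pass (Close b # r) F [] m g = pass r (Close b # F) [] True g"

lemma pass_reduces:
  "pass r (rev (map Close Q) @ F) A m g = (S, gs) \<Longrightarrow> Q = [] \<or> A = [] \<Longrightarrow> m \<or> Q = [] \<and> g = [] \<Longrightarrow>
    reduces (rev F @ map Open (rev A) @ chain g @ map Close Q @ r) gs (rev S) \<and>
    (\<Sum>g\<leftarrow>gs. factor_del s (chain g)) \<le> factor_del s (map Open (rev A) @ chain g @ map Close Q @ r)"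
proof (induction r "rev (map Close Q) @ F" A m g arbitrary: Q F S gs rule: pass.induct)
  case (1 A m g)
  then have S: "S = map Open A @ rev (map Close Q) @ F" and gs: "gs = [g]" by auto
  have "rev S = rev F @ map Open (rev A) @ map Close Q"
    using S "1.prems"(2) by (auto simp: rev_map)
  with gs show ?case
    using reduces_Cons[OF reduces_Nil, of "rev F @ map Open (rev A)" g "map Close Q"]
      factor_del_factor[of s "chain g" "map Open (rev A)" "map Close Q"] by simp
next
  case (2 a r A m g)
  show ?case
  proof (cases m)
    case True
    with "2.prems" obtain hs where
      h: "pass r (map Open A @ rev (map Close Q) @ F) [a] False [] = (S, hs)" "gs = g # hs"
      by (auto split: prod.splits)
    let ?F = "map Open A @ rev (map Close Q) @ F"
    from "2.hyps"(1)[OF True, of "[]" ?F S hs] h have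
      IH: "reduces (rev ?F @ [Open a] @ r) hs (rev S)"
        "(\<Sum>g\<leftarrow>hs. factor_del s (chain g)) \<le> factor_del s ([Open a] @ r)" by auto
    have "rev ?F = (rev F @ map Open (rev A)) @ map Close Q"
      using "2.prems"(2) by (auto simp: rev_map)
    with IH(1) have "reduces ((rev F @ map Open (rev A)) @ map Close Q @ Open a # r) hs (rev S)"
      by (simp only: append.assoc append.simps)
    from reduces_Cons[OF this, of g] h(2)
    have R: "reduces (rev F @ map Open (rev A) @ chain g @ map Close Q @ Open a # r) gs (rev S)" by simp
    have "factor_del s (chain g) + factor_del s (Open a # r)
      \<le> factor_del s ((map Open (rev A) @ chain g @ map Close Q) @ Open a # r)"
      using factor_del_append[of s "map Open (rev A) @ chain g @ map Close Q" "Open a # r"]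
        factor_del_factor[of s "chain g" "map Open (rev A)" "map Close Q"] by linarith
    with IH(2) h(2) R show ?thesis by simp
  next
    case False
    with "2.prems" have Q: "Q = []" "g = []" by auto
    from "2.hyps"(2)[OF False, of Q F S gs] "2.prems" False Q show ?thesis by simp
  qed
next
  case (3 b r a A m g)
  then have Q: "Q = []" by simp
  from "3.hyps"[of Q F S gs] "3.prems" Q show ?case by (simp add: chain_snoc)
next
  case (4 b r m g)
  show ?case
  proof (cases m)
    case True
    from "4.hyps"[of "Q @ [b]" F S gs] "4.prems" True show ?thesis by simp
  next
    case False
    with "4.prems" have Q: "Q = []" "g = []" by auto
    from "4.hyps"[of "[b]" F S gs] "4.prems" Q show ?thesis by simp
  qed
qed

text \<open>Counts the close parentheses that directly follow an open one; the flag tells whether the string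
  is preceded by an open parenthesis.\<close>

fun oc :: "bool \<Rightarrow> paren list \<Rightarrow> nat" where
  "oc b [] = 0"
| "oc b (Open a # r) = oc True r"
| "oc b (Close a # r) = of_bool b + oc False r"

definition top_open :: "paren list \<Rightarrow> bool" where
  "top_open S \<longleftrightarrow> S \<noteq> [] \<and> is_open (hd S)"

lemma oc_append: "oc b (u @ v) = oc b u + oc (if u = [] then b else is_open (last u)) v"
  by (induction b u rule: oc.induct) (auto simp: is_open_def)

lemma oc_rev_Cons:
  "oc False (rev (Open a # S)) = oc False (rev S)"
  "oc False (rev (Close a # S)) = oc False (rev S) + of_bool (top_open S)"
  by (auto simp: oc_append top_open_def last_rev)

lemma oc_rev_Opens: "oc False (rev (map Open A @ F)) = oc False (rev F)"
  by (induction A) (simp_all only: list.map append.simps oc_rev_Cons)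

lemma pass_oc_aux:
  "pass r F A m g = (S, gs) \<Longrightarrow>
    (if m then 2 * oc False (rev F) + of_bool (top_open F) + 1 \<le> z \<or>
        (A = [] \<and> \<not> top_open F \<and> 2 * oc False (rev F) \<le> z)
     else A \<noteq> [] \<and> 2 * oc False (rev F) + of_bool (top_open F) \<le> z) \<Longrightarrow>
    2 * oc False (rev S) \<le> z + oc (\<not> m) r"
proof (induction r F A m g arbitrary: z S gs rule: pass.induct)
  case (1 F A m g)
  then show ?case by (auto simp: oc_rev_Opens[simplified] split: if_splits)
next
  case (2 a r F A m g)
  show ?case
  proof (cases m)
    case True
    with "2.prems" obtain hs where h: "pass r (map Open A @ F) [a] False [] = (S, hs)"
      by (auto split: prod.splits)
    have "2 * oc False (rev (map Open A @ F)) + of_bool (top_open (map Open A @ F)) \<le> z"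
      using "2.prems"(2) True unfolding oc_rev_Opens by (cases A) (auto split: if_splits)
    with "2.IH"(1)[OF True h, of z] True show ?thesis by simp
  next
    case False
    from "2.IH"(2)[OF False, of S gs z] "2.prems" False show ?thesis by auto
  qed
next
  case (3 b r F a A m g)
  show ?case
  proof (cases m)
    case True
    with "3.IH"[of S gs z] "3.prems" show ?thesis by auto
  next
    case False
    with "3.IH"[of S gs "Suc z"] "3.prems" show ?thesis by auto
  qed
next
  case (4 b r F m g)
  then have m: m by (cases m) auto
  have t: "\<not> top_open (Close b # F)" by (simp add: top_open_def is_open_def)
  have "2 * oc False (rev (Close b # F)) \<le> z"
    using "4.prems"(2) m by (auto simp: oc_rev_Cons simp del: rev.simps)
  with "4.IH"[of S gs z] "4.prems" t m show ?case by auto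
qed

lemma pass_oc: "pass w [] [] True [] = (S, gs) \<Longrightarrow> 2 * oc False (rev S) \<le> oc False w"
  using pass_oc_aux[of w "[]" "[]" True "[]" S gs 0] by (simp add: top_open_def)

lemma pass_length_aux:
  "pass r F A m g = (S, gs) \<Longrightarrow> m \<or> A \<noteq> [] \<Longrightarrow>
    length S \<le> length F + length A + length r \<and>
    (0 < oc (\<not> m) r \<longrightarrow> length S < length F + length A + length r) \<and>
    length gs \<le> Suc (length r)"
proof (induction r F A m g arbitrary: S gs rule: pass.induct)
  case (2 a r F A m g)
  show ?case
  proof (cases m)
    case True
    with "2.prems" obtain hs where h: "pass r (map Open A @ F) [a] False [] = (S, hs)" "gs = g # hs"
      by (auto split: prod.splits)
    with "2.IH"(1)[OF True h(1)] True show ?thesis by auto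
  next
    case False
    from "2.IH"(2)[OF False, of S gs] "2.prems" False show ?thesis by auto
  qed
next
  case (3 b r F a A m g)
  then show ?case by fastforce
next
  case (4 b r F m g)
  then show ?case by fastforce
qed auto

lemma pass_length_eq:
  "pass r F A m g = (S, gs) \<Longrightarrow> oc (\<not> m) r = 0 \<Longrightarrow> m \<longrightarrow> A = [] \<Longrightarrow>
    length S = length F + length A + length r"
proof (induction r F A m g arbitrary: S gs rule: pass.induct)
  case (2 a r F A m g)
  then show ?case by (cases m) (auto split: prod.splits)
qed (auto split: if_splits)

lemma pass_length:
  assumes "pass w [] [] True [] = (S, gs)"
  shows "length S \<le> length w" "0 < oc False w \<Longrightarrow> length S < length w" "length gs \<le> Suc (length w)"
  using pass_length_aux[OF assms] by auto

section \<open>Iterating the passes\<close>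

inductive passes :: "paren list \<Rightarrow> (nat \<times> nat) list list \<Rightarrow> paren list \<Rightarrow> nat \<Rightarrow> bool" where
  last: "pass w [] [] True [] = (S, gs) \<Longrightarrow> length S = length w \<Longrightarrow> passes w gs (rev S) 1"
| more: "pass w [] [] True [] = (S, gs) \<Longrightarrow> length S < length w \<Longrightarrow> passes (rev S) hs r p \<Longrightarrow>
    passes w (gs @ hs) r (Suc p)"

text \<open>The last pass is idle and only detects that nothing was matched. The pass before it, if
  any, still saw a boundary, and every earlier one at least twice as many as its successor: hence
  the exponent \<open>p - 2\<close>. Every pass but the last shortens the string, which bounds
  \<open>p\<close> by the length.\<close>

lemma passes_props:
  "passes w gs r p \<Longrightarrow> reduces w gs r \<and> oc False r = 0 \<and>
    (\<Sum>g\<leftarrow>gs. factor_del s (chain g)) \<le> p * dyck_del s w \<and>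
    length gs \<le> p * Suc (length w) \<and> p \<le> Suc (length w) \<and>
    (p = 1 \<or> 2 \<le> p \<and> 2 ^ (p - 2) \<le> oc False w)"
proof (induction rule: passes.induct)
  case (last w S gs)
  then have z: "oc False w = 0" using pass_length(2) by fastforce
  with pass_oc[OF last(1)] have "oc False (rev S) = 0" by simp
  moreover have "(\<Sum>g\<leftarrow>gs. factor_del s (chain g)) \<le> dyck_del s w" "reduces w gs (rev S)"
    using pass_reduces[of w "[]" "[]" "[]" True "[]" S gs s] last(1)
      factor_del_le_dyck_del[of s w] by auto
  ultimately show ?case using pass_length(3)[OF last(1)] by simp
next
  case (more w S gs hs r p)
  have R: "reduces w gs (rev S)"
    and c: "(\<Sum>g\<leftarrow>gs. factor_del s (chain g)) \<le> dyck_del s w"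
    using pass_reduces[of w "[]" "[]" "[]" True "[]" S gs s] more(1)
      factor_del_le_dyck_del[of s w] by auto
  have "(\<Sum>g\<leftarrow>hs. factor_del s (chain g)) \<le> p * dyck_del s (rev S)" using more.IH by simp
  also have "\<dots> \<le> p * dyck_del s w" using dyck_del_reduces[OF R] by simp
  finally have c': "(\<Sum>g\<leftarrow>gs @ hs. factor_del s (chain g)) \<le> Suc p * dyck_del s w" using c by simp
  have "length hs \<le> p * Suc (length S)" using more.IH by simp
  also have "\<dots> \<le> p * Suc (length w)" using more(2) by (intro mult_le_mono) auto
  finally have l: "length (gs @ hs) \<le> Suc p * Suc (length w)" using pass_length(3)[OF more(1)] by simp
  have z: "0 < oc False w" using pass_length_eq[OF more(1)] more(2) by fastforce
  have "2 ^ (Suc p - 2) \<le> oc False w"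
  proof (cases "p = 1")
    case False
    then have p: "2 \<le> p" "2 ^ (p - 2) \<le> oc False (rev S)" using more.IH by auto
    then have "(2::nat) ^ (Suc p - 2) = 2 * 2 ^ (p - 2)" by (simp add: Suc_diff_le flip: power_Suc)
    with p pass_oc[OF more(1)] show ?thesis by linarith
  qed (use z in simp)
  moreover have "2 \<le> Suc p" using more.IH by auto
  moreover have "Suc p \<le> Suc (length w)" using more.IH more(2) by simp
  ultimately show ?case using R c' l more.IH reduces_append by blast
qed

subsection \<open>The number of blocks and the residual string\<close>

lemma oc_mono_flag: "oc False w \<le> oc True w" "oc True w \<le> Suc (oc False w)"
proof -
  have "oc False w \<le> oc True w \<and> oc True w \<le> Suc (oc False w)"
  proof (cases w)
    case (Cons p v)
    then show ?thesis by (cases p) auto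
  qed simp
  then show "oc False w \<le> oc True w" "oc True w \<le> Suc (oc False w)" by auto
qed

lemma oc_subseq: "subseq u w \<Longrightarrow> oc b u \<le> oc b w"
proof (induction arbitrary: b rule: list_emb.induct)
  case (list_emb_Cons u w p)
  show ?case
  proof (cases p)
    case (Open a)
    then show ?thesis using list_emb_Cons.IH[of True] oc_mono_flag(1)[of u] by (cases b) auto
  next
    case (Close a)
    then show ?thesis using list_emb_Cons.IH[of False] oc_mono_flag(2)[of u] by (cases b) auto
  qed
next
  case (list_emb_Cons2 p q u w)
  then show ?case by (cases q) auto
qed simp

lemma oc_Dyck_pos: "w \<in> Dyck s \<Longrightarrow> w = [] \<or> 0 < oc False w"
proof (induction rule: Dyck.induct)
  case (concat u v)
  have "oc False v \<le> oc b v" for b using oc_mono_flag(1)[of v] by (cases b) auto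
  with concat show ?case by (auto simp: oc_append intro: less_le_trans)
next
  case (wrap a u)
  then show ?case using oc_mono_flag(1)[of u] by (auto simp: oc_append)
qed simp

text \<open>Such a string consists of close parentheses followed by open ones. Its only Dyck
  subsequence is \<open>[]\<close>, so all symbols have to be deleted; hence the padding costs no
  more than the deletions needed anyway.\<close>

lemma dyck_del_residual:
  assumes "oc False r = 0"
  shows "length r \<le> dyck_del s r"
proof -
  obtain w where w: "w \<in> Dyck s" "subseq w r" "length r \<le> length w + dyck_del s r"
    using dyck_near_dyck_del unfolding dyck_near_def by blast
  with oc_Dyck_pos[OF w(1)] oc_subseq[OF w(2), of False] assms have "w = []" by simp
  with w(3) show ?thesis by simp
qed

lemma oc_block_string:
  "\<forall>(Y, X) \<in> set bs. Y \<noteq> [] \<and> X \<noteq> [] \<Longrightarrow> oc False (block_string bs) = length bs"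
proof (induction bs)
  case (Cons p bs)
  obtain Y X where p: "p = (Y, X)" by fastforce
  have Y: "oc b (map Open Y @ u) = (if Y = [] then oc b u else oc True u)" for b u Y
    by (induction Y arbitrary: b) auto
  have X: "oc b (map Close X @ u) = (if X = [] then oc b u else of_bool b + oc False u)" for b u X
    by (induction X arbitrary: b) auto
  from Cons p show ?case by (simp add: Y X)
qed simp

lemma oc_strip: "oc False (strip S) = oc False (rev S)"
proof -
  have o: "oc b w = 0" if "\<forall>p \<in> set w. is_open p" for b w
    using that by (induction b w rule: oc.induct) (auto simp: is_open_def)
  have c: "oc False (dropWhile (Not \<circ> is_open) w) = oc False w" for w
  proof (induction w)
    case (Cons p w)
    then show ?case by (cases p) (auto simp: is_open_def)
  qed simp
  have "rev S = rev (dropWhile is_open S) @ rev (takeWhile is_open S)"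
    by (metis rev_append takeWhile_dropWhile_id)
  then have "oc False (rev S) = oc False (rev (dropWhile is_open S))"
    using o[of "rev (takeWhile is_open S)"] by (auto simp: oc_append dest: set_takeWhileD)
  then show ?thesis unfolding strip_def c by simp
qed

text \<open>Ties the number of blocks to the string that is handed to the passes.
  \<open>strip\<close> leaves the number of boundaries unchanged, so the passes may start from the
  unstripped stack.\<close>

lemma num_blocks_eq_oc: "num_blocks s \<sigma> = oc False (rev (fold (push s) \<sigma> []))"
proof -
  obtain \<tau> where \<tau>: "simplified_form s \<sigma> \<tau>" "has_blocks \<tau> (num_blocks s \<sigma>)"
    unfolding num_blocks_def using theI'[OF num_blocks_ex1] by blast
  then have "oc False \<tau> = num_blocks s \<sigma>" unfolding has_blocks_def using oc_block_string by auto
  with simplified_form_unique[OF \<tau>(1)] show ?thesis by (simp add: oc_strip)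
qed

subsection \<open>A single string edit distance instance\<close>

text \<open>Padding with the symbols that no pass could match brings the total length of both
  strings to exactly that of \<open>\<sigma>\<close>. The paddings 1 and 3 are odd and different,
  hence match neither the tags nor each other.\<close>

definition left_string :: "nat \<Rightarrow> (nat \<times> nat) list list \<Rightarrow> paren list \<Rightarrow> nat list" where
  "left_string s gs r = tagged s fst 0 gs @ replicate (length (filter is_open r)) 1"

definition right_string :: "nat \<Rightarrow> (nat \<times> nat) list list \<Rightarrow> paren list \<Rightarrow> nat list" where
  "right_string s gs r = tagged s snd 0 gs @ replicate (length (filter (Not \<circ> is_open) r)) 3"

context
  fixes s \<sigma> S gs hs r p
  assumes \<sigma>: "\<sigma> \<in> lists (parens s)"
    and reduce: "reduce s \<sigma> [] = (S, gs)"
    and passes: "passes (rev S) hs r p"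
begin

lemma reduces_all: "reduces \<sigma> (gs @ hs) r"
  using reduce_props[OF reduce] passes_props[OF passes, of s] by (auto intro: reduces_append)

lemma groups_bounded: "\<forall>g \<in> set (gs @ hs). set g \<subseteq> {..<s} \<times> {..<s}"
  using reduces_lists[OF reduces_all \<sigma>] by blast

lemma groups_bounded':
  "\<forall>g \<in> set (gs @ hs). \<forall>p \<in> set g. fst p < s" "\<forall>g \<in> set (gs @ hs). \<forall>p \<in> set g. snd p < s"
  using groups_bounded by (metis lessThan_iff mem_Times_iff subsetD)+

lemma length_left_string: "length (left_string s (gs @ hs) r) = length (filter is_open \<sigma>)"
  using reduces_filter_length(1)[OF reduces_all] by (simp add: left_string_def length_tagged)

lemma length_right_string:
  "length (right_string s (gs @ hs) r) = length (filter (Not \<circ> is_open) \<sigma>)"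
  using reduces_filter_length(2)[OF reduces_all] by (simp add: right_string_def length_tagged)

lemma length_strings:
  "length (left_string s (gs @ hs) r) + length (right_string s (gs @ hs) r) = length \<sigma>"
  unfolding length_left_string length_right_string
  using sum_length_filter_compl[of is_open \<sigma>] by (simp add: comp_def)

lemma set_strings:
  "set (left_string s (gs @ hs) r) \<union> set (right_string s (gs @ hs) r)
    \<subseteq> {..<2 * s * length (gs @ hs) + 4}"
proof -
  have "t < 2 * s * length (gs @ hs)"
    if "t \<in> set (tagged s fst 0 (gs @ hs)) \<union> set (tagged s snd 0 (gs @ hs))" for t
    using that tagged_bounds(2)[OF groups_bounded'(1), of t 0] tagged_bounds(2)[OF groups_bounded'(2), of t 0]
    by auto
  then show ?thesis unfolding left_string_def right_string_def by (fastforce simp: less_Suc_eq)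
qed

text \<open>A common subsequence of length \<open>l\<close> gives a Dyck subsequence of length
  \<open>2 * l\<close>. Each string exceeds \<open>l\<close> by at most the edit distance for a
  suitable choice, and their lengths add up to that of \<open>\<sigma>\<close>, so twice the edit
  distance covers the deletions.\<close>

lemma dyck_dist_le_edit_dist:
  "dyck_dist s \<sigma> \<le> 2 * edit_dist (left_string s (gs @ hs) r) (right_string s (gs @ hs) r)"
    (is "_ \<le> 2 * edit_dist ?x ?y")
proof -
  obtain c where c: "subseq c ?x" "subseq c ?y"
    "length ?x \<le> length c + edit_dist ?x ?y" "length ?y \<le> length c + edit_dist ?x ?y"
    by (rule common_subseq_of_edit_dist)
  have "\<forall>t \<in> set (tagged s fst 0 (gs @ hs)) \<union> set (tagged s snd 0 (gs @ hs)). even t"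
    using tagged_bounds(3)[OF groups_bounded'(1)] tagged_bounds(3)[OF groups_bounded'(2)] by blast
  then have ev: "filter even (tagged s fst 0 (gs @ hs)) = tagged s fst 0 (gs @ hs)"
    "filter even (tagged s snd 0 (gs @ hs)) = tagged s snd 0 (gs @ hs)"
    by (simp_all add: filter_id_conv)
  have "set c \<subseteq> set ?x \<inter> set ?y" using list_emb_set[OF c(1)] list_emb_set[OF c(2)] by blast
  moreover have "even t" if "t \<in> set ?x" "t \<in> set ?y" for t
  proof (rule ccontr)
    assume "odd t"
    with that \<open>\<forall>t \<in> _. even t\<close> show False by (auto simp: left_string_def right_string_def)
  qed
  ultimately have "\<forall>t \<in> set c. even t" by blast
  then have "filter even c = c" by (simp add: filter_id_conv)
  then have "subseq c (tagged s fst 0 (gs @ hs))" "subseq c (tagged s snd 0 (gs @ hs))"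
    using subseq_filter[OF c(1), of even] subseq_filter[OF c(2), of even]
    by (simp_all add: left_string_def right_string_def ev)
  from Dyck_subseq_of_common_tagged[OF reduces_all groups_bounded this]
  have "\<exists>v \<in> Dyck s. subseq v \<sigma> \<and> length v = 2 * length c" .
  then have "dyck_near s \<sigma> (length \<sigma> - 2 * length c)" unfolding dyck_near_def by fastforce
  then have "dyck_dist s \<sigma> \<le> length \<sigma> - 2 * length c"
    using dyck_dist_le_dyck_del[of s \<sigma>] dyck_del_le by (meson le_trans)
  with c(3,4) length_strings show ?thesis by linarith
qed

text \<open>The cancelled pairs cost nothing, the chains \<open>2 * p\<close> times and the padding
  once the number of deletions needed, which is at most twice the distance:
  \<open>2 * (2 * p + 1)\<close>.\<close>

lemma edit_dist_le_dyck_dist: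
  "edit_dist (left_string s (gs @ hs) r) (right_string s (gs @ hs) r) \<le> (4 * p + 2) * dyck_dist s \<sigma>"
proof -
  let ?D = "dyck_del s \<sigma>"
  have R: "reduces \<sigma> gs (rev S)" "\<forall>g \<in> set gs. \<exists>a. g = [(a, a)]"
    using reduce_props[OF reduce] by auto
  have "dyck_del s (rev S) \<le> ?D" using dyck_del_reduces[OF R(1)] .
  moreover have "(\<Sum>g\<leftarrow>hs. factor_del s (chain g)) \<le> p * dyck_del s (rev S)"
    using passes_props[OF passes, of s] by blast
  ultimately have cost: "(\<Sum>g\<leftarrow>hs. factor_del s (chain g)) \<le> p * ?D"
    by (meson le_trans mult_le_mono2)
  have "edit_dist (tagged s fst 0 gs) (tagged s snd 0 gs) = 0"
    using tagged_diag[OF R(2)] edit_dist_self by metis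
  then have "edit_dist (tagged s fst 0 (gs @ hs)) (tagged s snd 0 (gs @ hs)) \<le> 2 * (p * ?D)"
    using edit_dist_append[of "tagged s fst 0 gs" "tagged s fst (length gs) hs"
        "tagged s snd 0 gs" "tagged s snd (length gs) hs"]
      edit_dist_tagged[of s "length gs" hs] cost
    unfolding tagged_append by simp
  moreover have "edit_dist (replicate (length (filter is_open r)) (1::nat))
      (replicate (length (filter (Not \<circ> is_open) r)) 3) \<le> length r"
    using edit_dist_common_subseq[of "[]" "replicate (length (filter is_open r)) (1::nat)"
        "replicate (length (filter (Not \<circ> is_open) r)) 3"]
      sum_length_filter_compl[of is_open r] by (simp add: comp_def)
  moreover have "length r \<le> ?D"
    using dyck_del_residual[of r s] passes_props[OF passes, of s] dyck_del_reduces[OF reduces_all, of s]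
    by (meson le_trans)
  ultimately have "edit_dist (left_string s (gs @ hs) r) (right_string s (gs @ hs) r)
    \<le> 2 * (p * ?D) + ?D"
    unfolding left_string_def right_string_def
    using edit_dist_append[of "tagged s fst 0 (gs @ hs)" "replicate (length (filter is_open r)) 1"
        "tagged s snd 0 (gs @ hs)" "replicate (length (filter (Not \<circ> is_open) r)) 3"]
    by linarith
  also have "\<dots> = (2 * p + 1) * ?D" by (simp add: algebra_simps)
  also have "\<dots> \<le> (2 * p + 1) * (2 * dyck_dist s \<sigma>)"
    by (intro mult_le_mono2 dyck_del_le_dyck_dist)
  also have "\<dots> = (4 * p + 2) * dyck_dist s \<sigma>" by (simp add: algebra_simps)
  finally show ?thesis .
qed

lemma passes_num_blocks: "p = 1 \<or> 2 \<le> p \<and> 2 ^ (p - 2) \<le> num_blocks s \<sigma>"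
  using passes_props[OF passes, of s] reduce_props[OF reduce] by (auto simp: num_blocks_eq_oc)

text \<open>Only the size of the tags depends on the number of groups, so a quadratic bound is good
  enough for the word length.\<close>

lemma passes_le_length: "p \<le> Suc (length \<sigma>)" "length (gs @ hs) \<le> Suc (length \<sigma>) * Suc (Suc (length \<sigma>))"
proof -
  have R: "reduces \<sigma> gs (rev S)" "length gs \<le> length \<sigma>" using reduce_props[OF reduce] by auto
  have "length (rev S) \<le> length \<sigma>"
    using reduces_filter_length[OF R(1)] sum_length_filter_compl[of is_open \<sigma>]
      sum_length_filter_compl[of is_open "rev S"] by (simp add: comp_def)
  then show p: "p \<le> Suc (length \<sigma>)" using passes_props[OF passes, of s] by linarith
  have "length hs \<le> p * Suc (length (rev S))" using passes_props[OF passes, of s] by blast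
  also have "\<dots> \<le> Suc (length \<sigma>) * Suc (length \<sigma>)"
    using p \<open>length (rev S) \<le> length \<sigma>\<close> by (intro mult_le_mono) auto
  finally show "length (gs @ hs) \<le> Suc (length \<sigma>) * Suc (Suc (length \<sigma>))" using R(2) by simp
qed

end

subsection \<open>Structured programs for the word RAM\<close>

type_synonym store = "(nat \<Rightarrow> nat) \<times> (nat \<Rightarrow> nat)"

datatype com = Ins instr | Seq com com | Cond nat com com | Loop nat com

fun straight :: "instr \<Rightarrow> bool" where
  "straight (Jump l) = False"
| "straight (JumpZero r l) = False"
| "straight (Coin r) = False"
| "straight i = True"

fun effect :: "instr \<Rightarrow> store \<Rightarrow> store" where
  "effect (Const r v) (R, M) = (R(r := v), M)"
| "effect (Add r i j) (R, M) = (R(r := R i + R j), M)"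
| "effect (Sub r i j) (R, M) = (R(r := R i - R j), M)"
| "effect (Mul r i j) (R, M) = (R(r := R i * R j), M)"
| "effect (Div r i j) (R, M) = (R(r := R i div R j), M)"
| "effect (Load r i) (R, M) = (R(r := M (R i)), M)"
| "effect (Store i r) (R, M) = (R, M(R i := R r))"
| "effect i (R, M) = (R, M)"

text \<open>Truncated subtraction, division, loads and stores never exceed the values already
  present; only constants, sums and products can.\<close>

fun no_overflow :: "nat \<Rightarrow> instr \<Rightarrow> store \<Rightarrow> bool" where
  "no_overflow B (Const r v) (R, M) \<longleftrightarrow> v \<le> B"
| "no_overflow B (Add r i j) (R, M) \<longleftrightarrow> R i + R j \<le> B"
| "no_overflow B (Mul r i j) (R, M) \<longleftrightarrow> R i * R j \<le> B"
| "no_overflow B i (R, M) \<longleftrightarrow> True"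

inductive big_step :: "nat \<Rightarrow> com \<Rightarrow> store \<Rightarrow> nat \<Rightarrow> store \<Rightarrow> bool" for B where
  Ins: "straight i \<Longrightarrow> no_overflow B i st \<Longrightarrow> big_step B (Ins i) st 1 (effect i st)"
| Seq: "big_step B a st t st1 \<Longrightarrow> big_step B b st1 t' st2 \<Longrightarrow> big_step B (Seq a b) st (t + t') st2"
| Cond_True: "fst st r \<noteq> 0 \<Longrightarrow> big_step B a st t st' \<Longrightarrow> big_step B (Cond r a b) st (t + 2) st'"
| Cond_False: "fst st r = 0 \<Longrightarrow> big_step B b st t st' \<Longrightarrow> big_step B (Cond r a b) st (t + 1) st'"
| Loop_False: "fst st r = 0 \<Longrightarrow> big_step B (Loop r c) st 1 st"
| Loop_True: "fst st r \<noteq> 0 \<Longrightarrow> big_step B c st t st1 \<Longrightarrow> big_step B (Loop r c) st1 t' st2 \<Longrightarrow>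
    big_step B (Loop r c) st (t + t' + 2) st2"

fun code_size :: "com \<Rightarrow> nat" where
  "code_size (Ins i) = 1"
| "code_size (Seq a b) = code_size a + code_size b"
| "code_size (Cond r a b) = code_size a + code_size b + 2"
| "code_size (Loop r c) = code_size c + 2"

fun compile :: "nat \<Rightarrow> com \<Rightarrow> program" where
  "compile p (Ins i) = [i]"
| "compile p (Seq a b) = compile p a @ compile (p + code_size a) b"
| "compile p (Cond r a b) = [JumpZero r (p + code_size a + 2)] @ compile (p + 1) a @
    [Jump (p + code_size a + code_size b + 2)] @ compile (p + code_size a + 2) b"
| "compile p (Loop r c) = [JumpZero r (p + code_size c + 2)] @ compile (p + 1) c @ [Jump p]"

lemma length_compile [simp]: "length (compile p c) = code_size c"
  by (induction p c rule: compile.induct) auto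

definition at_store :: "nat \<Rightarrow> store \<Rightarrow> config" where
  "at_store p st = \<lparr>pc = p, regs = fst st, mem = snd st\<rparr>"

definition bounded_by :: "nat \<Rightarrow> config \<Rightarrow> bool" where
  "bounded_by B c \<longleftrightarrow> (\<forall>r. regs c r \<le> B) \<and> (\<forall>i. mem c i \<le> B)"

definition code_at :: "program \<Rightarrow> nat \<Rightarrow> program \<Rightarrow> bool" where
  "code_at P p Q \<longleftrightarrow> (\<exists>u v. P = u @ Q @ v \<and> length u = p)"

lemma code_at_append: "code_at P p (Q @ R) \<longleftrightarrow> code_at P p Q \<and> code_at P (p + length Q) R"
proof
  assume "code_at P p (Q @ R)"
  then obtain u v where "P = u @ (Q @ R) @ v" "length u = p" unfolding code_at_def by blast
  then show "code_at P p Q \<and> code_at P (p + length Q) R" unfolding code_at_def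
    by (intro conjI exI[of _ u] exI[of _ "R @ v"] exI[of _ "u @ Q"] exI[of _ v]) auto
next
  assume "code_at P p Q \<and> code_at P (p + length Q) R"
  then obtain u v u' v' where P: "P = u @ Q @ v" "length u = p" "P = u' @ R @ v'" "length u' = p + length Q"
    unfolding code_at_def by blast
  then have "u' = u @ Q" "v = R @ v'"
    by (metis append_assoc append_eq_append_conv length_append)+
  with P show "code_at P p (Q @ R)" unfolding code_at_def by (intro exI[of _ u] exI[of _ v']) auto
qed

lemma code_at_nth: "code_at P p [i] \<Longrightarrow> p < length P \<and> P ! p = i"
  unfolding code_at_def by auto

lemma run_add: "run P (s + t) c = bind_pmf (run P s c) (run P t)"
proof (induction t)
  case (Suc t)
  then show ?case by (simp add: bind_assoc_pmf)
qed (simp add: bind_return_pmf')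

definition runs_to :: "program \<Rightarrow> nat \<Rightarrow> config \<Rightarrow> nat \<Rightarrow> config \<Rightarrow> bool" where
  "runs_to P B c t c' \<longleftrightarrow>
    run P t c = return_pmf c' \<and> (\<forall>t' \<le> t. \<forall>x \<in> set_pmf (run P t' c). bounded_by B x)"

lemma runs_to_trans:
  assumes "runs_to P B a s b" "runs_to P B b t c"
  shows "runs_to P B a (s + t) c"
proof -
  have eq: "run P (s + k) a = run P k b" for k
    using assms(1) unfolding runs_to_def run_add by (simp add: bind_return_pmf)
  have "bounded_by B x" if "t' \<le> s + t" "x \<in> set_pmf (run P t' a)" for t' x
  proof (cases "t' \<le> s")
    case False
    then obtain k where "t' = s + k" by (metis le_add_diff_inverse nat_le_linear)
    with that eq assms(2) show ?thesis unfolding runs_to_def by auto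
  qed (use that assms(1) in \<open>auto simp: runs_to_def\<close>)
  with eq assms(2) show ?thesis unfolding runs_to_def by auto
qed

lemma runs_to_step:
  assumes "code_at P (pc c) [i]" "exec i c = return_pmf c'" "bounded_by B c" "bounded_by B c'"
  shows "runs_to P B c 1 c'"
proof -
  have "run P 1 c = return_pmf c'"
    using code_at_nth[OF assms(1)] assms(2) by (simp add: step_def halted_def bind_return_pmf)
  then show ?thesis using assms(3,4) unfolding runs_to_def by (auto simp: le_Suc_eq)
qed

lemma exec_straight:
  "straight i \<Longrightarrow> exec i (at_store p st) = return_pmf (at_store (Suc p) (effect i st))"
  by (cases st; cases i) (auto simp: at_store_def set_reg_def)

lemma bounded_by_effect:
  assumes "no_overflow B i st" "bounded_by B (at_store p st)"
  shows "bounded_by B (at_store q (effect i st))"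
proof -
  have "m div k \<le> B" "m - k \<le> B" if "m \<le> B" for m k :: nat
    using that div_le_dividend[of m k] by linarith+
  then show ?thesis using assms by (cases st; cases i) (auto simp: bounded_by_def at_store_def)
qed

lemma bounded_by_at_store: "bounded_by B (at_store p st) \<Longrightarrow> bounded_by B (at_store q st)"
  by (simp add: bounded_by_def at_store_def)

lemma runs_to_compile:
  "big_step B c st t st' \<Longrightarrow> bounded_by B (at_store p st) \<Longrightarrow> code_at P p (compile p c) \<Longrightarrow>
    runs_to P B (at_store p st) t (at_store (p + code_size c) st') \<and>
    bounded_by B (at_store (p + code_size c) st')"
proof (induction arbitrary: p rule: big_step.induct)
  case (Ins i st)
  have "runs_to P B (at_store p st) 1 (at_store (Suc p) (effect i st))"
    using Ins by (intro runs_to_step[of _ _ i] exec_straight bounded_by_effect[of _ _ _ p])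
      (auto simp: at_store_def)
  with bounded_by_effect[OF Ins(2) Ins.prems(1)] show ?case by simp
next
  case (Seq a st t st1 b t' st2)
  then have c: "code_at P p (compile p a)" "code_at P (p + code_size a) (compile (p + code_size a) b)"
    by (simp_all add: code_at_append)
  from Seq.IH(1)[OF Seq.prems(1) c(1)] Seq.IH(2)[OF _ c(2)] show ?case
    by (auto intro: runs_to_trans simp: add.assoc)
next
  case (Cond_True st r a t st' b)
  then have c: "code_at P p [JumpZero r (p + code_size a + 2)]" "code_at P (p + 1) (compile (p + 1) a)"
    "code_at P (p + 1 + code_size a) [Jump (p + code_size a + code_size b + 2)]"
    unfolding compile.simps code_at_append by auto
  have 1: "runs_to P B (at_store p st) 1 (at_store (p + 1) st)"
    using Cond_True c(1) by (intro runs_to_step[of _ _ "JumpZero r (p + code_size a + 2)"]) (auto simp: at_store_def bounded_by_def)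
  note 2 = Cond_True.IH[OF bounded_by_at_store[OF Cond_True.prems(1)] c(2)]
  have 3: "runs_to P B (at_store (p + 1 + code_size a) st') 1 (at_store (p + code_size (Cond r a b)) st')"
    using 2 c(3) by (intro runs_to_step[of _ _ "Jump (p + code_size a + code_size b + 2)"])
      (auto simp: at_store_def bounded_by_def)
  from runs_to_trans[OF runs_to_trans[OF 1 conjunct1[OF 2]] 3] bounded_by_at_store[OF conjunct2[OF 2]]
  show ?case by simp
next
  case (Cond_False st r b t st' a)
  then have c: "code_at P p [JumpZero r (p + code_size a + 2)]"
    "code_at P (p + code_size a + 2) (compile (p + code_size a + 2) b)"
    unfolding compile.simps code_at_append by auto
  have 1: "runs_to P B (at_store p st) 1 (at_store (p + code_size a + 2) st)"
    using Cond_False c(1) by (intro runs_to_step[of _ _ "JumpZero r (p + code_size a + 2)"]) (auto simp: at_store_def bounded_by_def)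
  note 2 = Cond_False.IH[OF bounded_by_at_store[OF Cond_False.prems(1)] c(2)]
  from runs_to_trans[OF 1 conjunct1[OF 2]] 2 show ?case by (simp add: ac_simps)
next
  case (Loop_False st r c)
  then have "code_at P p [JumpZero r (p + code_size c + 2)]"
    unfolding compile.simps code_at_append by auto
  then have "runs_to P B (at_store p st) 1 (at_store (p + code_size c + 2) st)"
    using Loop_False by (intro runs_to_step[of _ _ "JumpZero r (p + code_size c + 2)"]) (auto simp: at_store_def bounded_by_def)
  with bounded_by_at_store[OF Loop_False.prems(1)] show ?case by simp
next
  case (Loop_True st r c t st1 t' st2)
  then have c: "code_at P p [JumpZero r (p + code_size c + 2)]" "code_at P (p + 1) (compile (p + 1) c)"
    "code_at P (p + 1 + code_size c) [Jump p]"
    unfolding compile.simps code_at_append by auto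
  have 1: "runs_to P B (at_store p st) 1 (at_store (p + 1) st)"
    using Loop_True c(1) by (intro runs_to_step[of _ _ "JumpZero r (p + code_size c + 2)"]) (auto simp: at_store_def bounded_by_def)
  note 2 = Loop_True.IH(1)[OF bounded_by_at_store[OF Loop_True.prems(1)] c(2)]
  have 3: "runs_to P B (at_store (p + 1 + code_size c) st1) 1 (at_store p st1)"
    using 2 c(3) by (intro runs_to_step[of _ _ "Jump p"]) (auto simp: at_store_def bounded_by_def)
  note 4 = Loop_True.IH(2)[OF bounded_by_at_store[OF conjunct2[OF 2]] Loop_True.prems(2)]
  from runs_to_trans[OF runs_to_trans[OF runs_to_trans[OF 1 conjunct1[OF 2]] 3] conjunct1[OF 4]] 4
  show ?case by (simp add: ac_simps)
qed

text \<open>A weakest precondition for total correctness whose postcondition also sees the running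
  time. The equivalences below let rewriting execute straight-line code symbolically; loops are
  unrolled by induction over the input.\<close>

definition ends :: "nat \<Rightarrow> com \<Rightarrow> store \<Rightarrow> (nat \<Rightarrow> store \<Rightarrow> bool) \<Rightarrow> bool" where
  "ends B c st Q \<longleftrightarrow> (\<exists>t st'. big_step B c st t st' \<and> Q t st')"

lemma ends_mono: "ends B c st Q \<Longrightarrow> (\<And>t st'. Q t st' \<Longrightarrow> Q' t st') \<Longrightarrow> ends B c st Q'"
  unfolding ends_def by blast

lemma endsI: "big_step B c st t st' \<Longrightarrow> Q t st' \<Longrightarrow> ends B c st Q"
  unfolding ends_def by (intro exI conjI)

lemma endsE:
  assumes "ends B c st Q"
  obtains t st' where "big_step B c st t st'" "Q t st'"
  using assms unfolding ends_def by (elim exE conjE) (rule that)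

lemma ends_Ins: "ends B (Ins i) st Q \<longleftrightarrow> straight i \<and> no_overflow B i st \<and> Q 1 (effect i st)"
proof
  assume "ends B (Ins i) st Q"
  then obtain t st' where *: "big_step B (Ins i) st t st'" "Q t st'" by (rule endsE)
  from *(1) show "straight i \<and> no_overflow B i st \<and> Q 1 (effect i st)"
    by cases (use *(2) in simp)
next
  assume "straight i \<and> no_overflow B i st \<and> Q 1 (effect i st)"
  then show "ends B (Ins i) st Q" by (elim conjE) (rule endsI[OF big_step.Ins])
qed

lemma ends_Seq: "ends B (Seq a b) st Q \<longleftrightarrow> ends B a st (\<lambda>t st'. ends B b st' (\<lambda>t'. Q (t + t')))"
proof
  assume "ends B (Seq a b) st Q"
  then obtain t st' where *: "big_step B (Seq a b) st t st'" "Q t st'" by (rule endsE)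
  from *(1) show "ends B a st (\<lambda>t st'. ends B b st' (\<lambda>t'. Q (t + t')))"
    by cases (use *(2) in \<open>simp add: endsI\<close>)
next
  assume "ends B a st (\<lambda>t st'. ends B b st' (\<lambda>t'. Q (t + t')))"
  then obtain t st1 where 1: "big_step B a st t st1" "ends B b st1 (\<lambda>t'. Q (t + t'))" by (rule endsE)
  from 1(2) obtain t' st2 where "big_step B b st1 t' st2" "Q (t + t') st2" by (rule endsE)
  with 1(1) show "ends B (Seq a b) st Q" by (intro endsI[OF big_step.Seq])
qed

lemma ends_Cond:
  "ends B (Cond r a b) st Q \<longleftrightarrow>
    (if fst st r \<noteq> 0 then ends B a st (\<lambda>t. Q (t + 2)) else ends B b st (\<lambda>t. Q (t + 1)))"
    (is "_ \<longleftrightarrow> ?R")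
proof
  assume "ends B (Cond r a b) st Q"
  then obtain t st' where *: "big_step B (Cond r a b) st t st'" "Q t st'" by (rule endsE)
  from *(1) show ?R by cases (use *(2) in \<open>simp_all add: endsI\<close>)
next
  assume R: ?R
  show "ends B (Cond r a b) st Q"
  proof (cases "fst st r = 0")
    case True
    with R have "ends B b st (\<lambda>t. Q (t + 1))" by simp
    then show ?thesis by (rule endsE) (rule endsI[OF big_step.Cond_False[OF True]])
  next
    case False
    with R have "ends B a st (\<lambda>t. Q (t + 2))" by simp
    then show ?thesis by (rule endsE) (rule endsI[OF big_step.Cond_True[OF False]])
  qed
qed

lemma ends_Loop_False: "fst st r = 0 \<Longrightarrow> Q 1 st \<Longrightarrow> ends B (Loop r c) st Q"
  by (rule endsI[OF big_step.Loop_False])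

lemma ends_Loop_True:
  assumes "fst st r \<noteq> 0" "ends B c st (\<lambda>t st'. ends B (Loop r c) st' (\<lambda>t'. Q (t + t' + 2)))"
  shows "ends B (Loop r c) st Q"
proof -
  from assms(2) obtain t st1 where 1: "big_step B c st t st1"
    "ends B (Loop r c) st1 (\<lambda>t'. Q (t + t' + 2))" by (rule endsE)
  from 1(2) obtain t' st2 where "big_step B (Loop r c) st1 t' st2" "Q (t + t' + 2) st2" by (rule endsE)
  with 1(1) assms(1) show ?thesis by (intro endsI[OF big_step.Loop_True])
qed

subsection \<open>The reduction program\<close>

definition seg :: "(nat \<Rightarrow> nat) \<Rightarrow> nat \<Rightarrow> nat list \<Rightarrow> bool" where
  "seg M p xs \<longleftrightarrow> (\<forall>j < length xs. M (p + j) = xs ! j)"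

lemma seg_Nil [simp]: "seg M p []"
  by (simp add: seg_def)

lemma seg_Cons [simp]: "seg M p (x # xs) \<longleftrightarrow> M p = x \<and> seg M (Suc p) xs"
  by (auto simp: seg_def nth_Cons less_Suc_eq_0_disj split: nat.splits)

lemma seg_append [simp]: "seg M p (xs @ ys) \<longleftrightarrow> seg M p xs \<and> seg M (p + length xs) ys"
  by (induction xs arbitrary: p) auto

lemma seg_update [simp]:
  assumes "q < p \<or> p + length xs \<le> q"
  shows "seg (M(q := v)) p xs \<longleftrightarrow> seg M p xs"
proof -
  have "(M(q := v)) (p + j) = M (p + j)" if "j < length xs" for j
    using assms that by (intro fun_upd_other) linarith
  then show ?thesis by (simp add: seg_def del: fun_upd_apply)
qed

fun prog :: "com list \<Rightarrow> com" where
  "prog [c] = c"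
| "prog (c # cs) = Seq c (prog cs)"
| "prog [] = Ins (Const 13 0)"

definition opens :: "paren list \<Rightarrow> nat" where
  "opens w = length (filter is_open w)"

definition closes :: "paren list \<Rightarrow> nat" where
  "closes w = length (filter (Not \<circ> is_open) w)"

lemma opens_closes_simps [simp]:
  "opens [] = 0" "opens (Open a # w) = Suc (opens w)" "opens (Close a # w) = opens w"
  "opens (v @ w) = opens v + opens w"
  "closes [] = 0" "closes (Open a # w) = closes w" "closes (Close a # w) = Suc (closes w)"
  "closes (v @ w) = closes v + closes w"
  by (simp_all add: opens_def closes_def is_open_def)

text \<open>The registers from 20 on belong to the simulated algorithm, which expects them to be
  zero at its start.\<close>

definition consts_ok :: "nat \<Rightarrow> nat \<Rightarrow> (nat \<Rightarrow> nat) \<Rightarrow> bool" where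
  "consts_ok s n R \<longleftrightarrow> R 0 = 0 \<and> R 1 = 1 \<and> R 2 = 2 \<and> R 3 = 2 * s \<and> R 5 = Suc n \<and> R 18 = 3 \<and>
    (\<forall>r \<ge> 20. R r = 0)"

lemma consts_ok_update [simp]:
  "r \<notin> {0, 1, 2, 3, 5, 18} \<Longrightarrow> r < 20 \<Longrightarrow> consts_ok s n (R(r := v)) \<longleftrightarrow> consts_ok s n R"
  by (auto simp: consts_ok_def)

lemma consts_okD:
  "consts_ok s n R \<Longrightarrow> R 0 = 0" "consts_ok s n R \<Longrightarrow> R 1 = 1" "consts_ok s n R \<Longrightarrow> R (Suc 0) = 1"
  "consts_ok s n R \<Longrightarrow> R 2 = 2"
  "consts_ok s n R \<Longrightarrow> R 3 = 2 * s" "consts_ok s n R \<Longrightarrow> R 5 = Suc n" "consts_ok s n R \<Longrightarrow> R 18 = 3"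
  by (simp_all add: consts_ok_def)

text \<open>\<open>length S < i\<close> keeps the stack from overwriting unread symbols. The zeros
  from \<open>2 * n + 3\<close> on are what the simulated algorithm finds behind its input, which
  fills the cells \<open>n + 1\<close> to \<open>2 * n + 2\<close>.\<close>

definition mem_ok :: "nat \<Rightarrow> nat \<Rightarrow> (nat \<Rightarrow> nat) \<Rightarrow> nat \<Rightarrow>
    paren list \<Rightarrow> paren list \<Rightarrow> nat list \<Rightarrow> nat list \<Rightarrow> bool" where
  "mem_ok n nx M i S rest X Y \<longleftrightarrow>
    M 0 = 1 \<and> seg M 1 (map paren_code (rev S)) \<and> seg M i (map paren_code rest) \<and>
    seg M (n + 3) X \<and> seg M (n + 3 + nx) Y \<and>
    M (n + 1) = nx \<and> M (n + 2) = n - nx \<and> (\<forall>a \<ge> 2 * n + 3. M a = 0) \<and>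
    length S < i \<and> i + length rest \<le> Suc n \<and> nx \<le> n \<and> length X \<le> nx \<and> length Y \<le> n - nx"

lemma mem_ok_read: "mem_ok n nx M i S (p # r) X Y \<Longrightarrow> mem_ok n nx M (Suc i) S r X Y \<and> M i = paren_code p"
  by (simp add: mem_ok_def)

lemma mem_ok_push:
  "mem_ok n nx M i S r X Y \<Longrightarrow> Suc (length S) < i \<Longrightarrow>
    mem_ok n nx (M(Suc (length S) := paren_code p)) i (p # S) r X Y"
  by (simp add: mem_ok_def)

lemma mem_ok_pop:
  "mem_ok n nx M i (p # S) r X Y \<Longrightarrow> mem_ok n nx M i S r X Y \<and> M (Suc (length S)) = paren_code p"
  by (simp add: mem_ok_def)

lemma mem_ok_left:
  assumes "mem_ok n nx M i S r X Y" "length X < nx"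
  shows "mem_ok n nx (M(n + 3 + length X := v)) i S r (X @ [v]) Y"
  using assms unfolding mem_ok_def by simp

lemma mem_ok_right:
  assumes "mem_ok n nx M i S r X Y" "length Y < n - nx"
  shows "mem_ok n nx (M(n + 3 + nx + length Y := v)) i S r X (Y @ [v])"
  using assms unfolding mem_ok_def by simp

text \<open>Registers 0, 1, 2, 3 and 18 hold the constants 0, 1, 2, \<open>2 * s\<close> and 3, and register 5 holds
  \<open>n + 1\<close>. Cells 1 to \<open>n\<close> hold the current string \<open>rev S @ H @ rest\<close>: the stack \<open>S\<close> grows in place over
  the part that has been read, up to register 7, and \<open>rest\<close> starts at register 6; \<open>H\<close> is the symbol in
  register 13. Cell 0 is the sentinel 1, which is odd and hence not the code of an open parenthesis.
  From cell \<open>n + 1\<close> on, the input \<open>length x # length y # x @ y\<close> of the string edit distance algorithm is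
  built up; \<open>nx\<close> is the final length of \<open>x\<close>.\<close>

definition layout :: "nat \<Rightarrow> nat \<Rightarrow> nat \<Rightarrow> (nat \<Rightarrow> nat) \<Rightarrow> (nat \<Rightarrow> nat) \<Rightarrow>
    paren list \<Rightarrow> paren list \<Rightarrow> paren list \<Rightarrow> nat list \<Rightarrow> nat list \<Rightarrow> bool" where
  "layout s n nx R M S H rest X Y \<longleftrightarrow>
    consts_ok s n R \<and> mem_ok n nx M (R 6) S rest X Y \<and>
    R 7 = Suc (length S) \<and> length S + length H < R 6 \<and> R 17 = length rest \<and>
    R 11 = n + 3 + length X \<and> R 12 = n + 3 + nx + length Y \<and>
    length X + opens (S @ H @ rest) = nx \<and> length Y + closes (S @ H @ rest) = n - nx \<and>
    set (S @ H @ rest) \<subseteq> parens s"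

lemma layout_bounds:
  "layout s n nx R M S H rest X Y \<Longrightarrow>
    R 6 + length rest \<le> Suc n \<and> length S + length rest \<le> n \<and> nx \<le> n \<and> length X \<le> nx \<and> length Y \<le> n - nx"
  by (auto simp: layout_def mem_ok_def)

lemma paren_code_less: "p \<in> parens s \<Longrightarrow> paren_code p < 2 * s"
  by (auto simp: parens_def)

text \<open>The instruction set has no remainder: register 15 receives the parity as the code minus
  twice its half, which is 1 exactly for a close parenthesis.\<close>

definition read_com :: com where
  "read_com = prog [Ins (Load 13 6), Ins (Add 6 6 1), Ins (Sub 17 17 1), Ins (Div 14 13 2),
    Ins (Add 14 14 14), Ins (Sub 15 13 14)]"

definition push_com :: com where
  "push_com = prog [Ins (Store 7 13), Ins (Add 7 7 1)]"

text \<open>Register 10 holds the tag offset of the current group. The code \<open>2 * a\<close> of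
  the open parenthesis is shifted directly; for the code \<open>2 * b + 1\<close> of the close one,
  1 is subtracted as well.\<close>

definition pop_com :: com where
  "pop_com = prog [Ins (Sub 7 7 1), Ins (Load 16 7), Ins (Add 16 16 10), Ins (Store 11 16),
    Ins (Add 11 11 1), Ins (Add 16 13 10), Ins (Sub 16 16 1), Ins (Store 12 16), Ins (Add 12 12 1)]"

lemmas ends_simps = ends_Ins ends_Seq ends_Cond

definition keeps :: "(nat \<Rightarrow> nat) \<Rightarrow> (nat \<Rightarrow> nat) \<Rightarrow> bool" where
  "keeps R R' \<longleftrightarrow> R' 4 = R 4 \<and> R' 8 = R 8 \<and> R' 9 = R 9 \<and> R' 10 = R 10 \<and> R' 19 = R 19"

lemma read_com_ends:
  assumes L: "layout s n nx R M S [] (p # r) X Y" and B: "2 * s + 2 * n + 5 \<le> B"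
  shows "ends B read_com (R, M) (\<lambda>t st. t = 6 \<and> (\<exists>R'. st = (R', M) \<and> layout s n nx R' M S [p] r X Y \<and>
    keeps R R' \<and> R' 13 = paren_code p \<and> R' 15 = of_bool (\<not> is_open p)))"
proof -
  have p: "paren_code p < 2 * s" using L paren_code_less by (simp add: layout_def)
  have par: "paren_code p - (paren_code p div 2 + paren_code p div 2) = of_bool (\<not> is_open p)"
    by (cases p) (auto simp: is_open_def)
  have C: "consts_ok s n R" and M: "mem_ok n nx M (R 6) S (p # r) X Y" using L by (auto simp: layout_def)
  note bounds = layout_bounds[OF L]
  have "paren_code p div 2 + paren_code p div 2 \<le> B" using p B by linarith
  then show ?thesis
    using L C consts_okD[OF C] mem_ok_read[OF M] bounds B par unfolding read_com_def layout_def keeps_def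
    by (simp add: ends_simps)
qed

lemma push_com_ends:
  assumes L: "layout s n nx R M S [p] r X Y" and B: "2 * s + 2 * n + 5 \<le> B" and "R 13 = paren_code p"
  shows "ends B push_com (R, M) (\<lambda>t st. t = 2 \<and> (\<exists>R' M'. st = (R', M') \<and>
    layout s n nx R' M' (p # S) [] r X Y \<and> keeps R R'))"
proof -
  have C: "consts_ok s n R" and M: "mem_ok n nx M (R 6) S r X Y" "Suc (length S) < R 6"
    using L by (auto simp: layout_def)
  note bounds = layout_bounds[OF L]
  show ?thesis
    using L C consts_okD[OF C] mem_ok_push[OF M, of p] bounds assms(2,3) unfolding push_com_def layout_def keeps_def
    by (cases p) (simp_all add: ends_simps)
qed

lemma pop_com_ends:
  assumes L: "layout s n nx R M (Open a # S) [Close b] r X Y" and B: "R 10 + 2 * s + 2 * n + 5 \<le> B"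
    and "R 13 = paren_code (Close b)"
  shows "ends B pop_com (R, M) (\<lambda>t st. t = 9 \<and> (\<exists>R' M'. st = (R', M') \<and>
    layout s n nx R' M' S [] r (X @ [2 * a + R 10]) (Y @ [2 * b + R 10]) \<and> keeps R R'))"
proof -
  have ab: "a < s" "b < s" using L by (auto simp: layout_def parens_def)
  have C: "consts_ok s n R" and M: "mem_ok n nx M (R 6) (Open a # S) r X Y"
    using L by (auto simp: layout_def)
  have XY: "length X < nx" "length Y < n - nx" using L by (auto simp: layout_def)
  note bounds = layout_bounds[OF L]
  have "4 + (n + (nx + length Y)) \<le> B" using bounds XY B by linarith
  note bounds = bounds this
  note M1 = mem_ok_pop[OF M]
  note M2 = mem_ok_right[OF mem_ok_left[OF conjunct1[OF M1] XY(1), of "2 * a + R 10"] XY(2), of "2 * b + R 10"]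
  show ?thesis
    using L C consts_okD[OF C] M1 M2 bounds B assms(3) ab unfolding pop_com_def layout_def keeps_def
    by (simp add: ends_simps)
qed

text \<open>Register 8 becomes the absolute difference of the top plus 1 and the code read, obtained
  from two truncated subtractions, plus 1 if the symbol read is open. It vanishes exactly if a close
  parenthesis meets its open partner; the sentinel 1 of an empty stack gives 2, which is not the
  code of a close parenthesis.\<close>

definition reduce_body :: com where
  "reduce_body = Seq read_com (Seq (prog [Ins (Sub 14 7 1), Ins (Load 16 14), Ins (Add 16 16 1),
    Ins (Sub 8 16 13), Ins (Sub 16 13 16), Ins (Add 8 8 16), Ins (Sub 16 1 15), Ins (Add 8 8 16)])
    (Cond 8 push_com (Seq pop_com (Ins (Add 10 10 3)))))"

definition pass_body :: com where
  "pass_body = Seq read_com (Cond 15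
    (Seq (prog [Ins (Const 9 1), Ins (Sub 14 7 8)]) (Cond 14 pop_com (Seq push_com (Ins (Add 8 7 0)))))
    (Seq (Cond 9 (prog [Ins (Add 8 7 0), Ins (Add 10 10 3), Ins (Const 9 0)]) (Ins (Const 9 0))) push_com))"

lemma layout_update:
  assumes "r \<in> {4, 8, 9, 10, 13, 14, 15, 16, 19}"
  shows "layout s n nx (R(r := v)) M S H rest X Y \<longleftrightarrow> layout s n nx R M S H rest X Y"
proof -
  have "r \<notin> {0, 1, 2, 3, 5, 18}" "r < 20" "r \<noteq> 6" "r \<noteq> 7" "r \<noteq> 17" "r \<noteq> 11" "r \<noteq> 12"
    using assms by auto
  then show ?thesis unfolding layout_def by simp
qed

lemmas layout_updates [simp] =
  layout_update[of 4] layout_update[of 8] layout_update[of 9] layout_update[of 10]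
  layout_update[of 13] layout_update[of 14] layout_update[of 15] layout_update[of 16] layout_update[of 19]

lemma layoutD:
  assumes "layout s n nx R M S H rest X Y"
  shows "R 0 = 0" "R (Suc 0) = 1" "R 3 = 2 * s" "R 7 = Suc (length S)" "R 17 = length rest"
    "set S \<subseteq> parens s" "set H \<subseteq> parens s" "length S \<le> n"
  using assms layout_bounds[OF assms] by (auto simp: layout_def consts_ok_def)

lemma layout_top:
  assumes "layout s n nx R M S H rest X Y"
  shows "M (length S) = (case S of [] \<Rightarrow> 1 | q # _ \<Rightarrow> paren_code q)"
proof -
  have "mem_ok n nx M (R 6) S rest X Y" using assms by (simp add: layout_def)
  then show ?thesis by (cases S) (simp_all add: mem_ok_def)
qed

lemma paren_code_even: "paren_code q = 2 * a \<Longrightarrow> q = Open a"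
  by (cases q) (auto, presburger)

lemma reduce_body_ends:
  assumes L: "layout s n nx R M S [] (p # rest) X Y" and B: "R 10 + 2 * s + 2 * n + 5 \<le> B"
  shows "ends B reduce_body (R, M) (\<lambda>t st. t \<le> 27 \<and> (\<exists>R' M'. st = (R', M') \<and> R' 4 = R 4 \<and>
    (case (p, S) of (Close a, Open b # S') \<Rightarrow>
      if a = b then layout s n nx R' M' S' [] rest (X @ [2 * a + R 10]) (Y @ [2 * a + R 10]) \<and> R' 10 = R 10 + 2 * s
      else layout s n nx R' M' (p # S) [] rest X Y \<and> R' 10 = R 10
    | _ \<Rightarrow> layout s n nx R' M' (p # S) [] rest X Y \<and> R' 10 = R 10)))"
    (is "ends B _ _ ?P")
proof -
  have B': "2 * s + 2 * n + 5 \<le> B" using B by simp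
  let ?top = "case S of [] \<Rightarrow> 1 | q # _ \<Rightarrow> paren_code q"
  show ?thesis unfolding reduce_body_def ends_Seq[of B read_com]
  proof (rule ends_mono[OF read_com_ends[OF L B']], elim conjE exE)
    fix t :: nat and st R1
    assume t: "t = 6" and st: "st = (R1, M)" and L1: "layout s n nx R1 M S [p] rest X Y"
      and k1: "keeps R R1" and r13: "R1 13 = paren_code p" and r15: "R1 15 = of_bool (\<not> is_open p)"
    have r: "R1 10 = R 10" "R1 4 = R 4" using k1 by (auto simp: keeps_def)
    note d = layoutD[OF L1]
    have pc: "paren_code p < 2 * s" using d(7) paren_code_less by simp
    have top: "M (length S) = ?top" using layout_top[OF L1] .
    have "?top < 2 * s + 2" using d(6) by (cases S) (use paren_code_less in fastforce)+
    then have b: "Suc ?top \<le> B" "Suc ?top - paren_code p + (paren_code p - Suc ?top) + 1 \<le> B"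
      using B' pc by linarith+
    let ?R = "R1(14 := length S, 16 := 1 - R1 15, 8 := (Suc ?top - paren_code p + (paren_code p - Suc ?top)) + (1 - R1 15))"
    have straight: "ends B (prog [Ins (Sub 14 7 1), Ins (Load 16 14), Ins (Add 16 16 1),
      Ins (Sub 8 16 13), Ins (Sub 16 13 16), Ins (Add 8 8 16), Ins (Sub 16 1 15), Ins (Add 8 8 16)])
      st (\<lambda>t st. t = 8 \<and> st = (?R, M))"
      using b d top r13 r15 unfolding st by (simp add: ends_simps fun_eq_iff)
    have L2: "layout s n nx ?R M S [p] rest X Y" using L1 by simp
    show "ends B (Seq (prog [Ins (Sub 14 7 1), Ins (Load 16 14), Ins (Add 16 16 1),
      Ins (Sub 8 16 13), Ins (Sub 16 13 16), Ins (Add 8 8 16), Ins (Sub 16 1 15), Ins (Add 8 8 16)])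
      (Cond 8 push_com (Seq pop_com (Ins (Add 10 10 3))))) st (\<lambda>t'. ?P (t + t'))"
      unfolding ends_Seq[of B "prog _"]
    proof (rule ends_mono[OF straight], elim conjE)
      fix t1 :: nat and st1 assume t1: "t1 = 8" and st1: "st1 = (?R, M)"
      show "ends B (Cond 8 push_com (Seq pop_com (Ins (Add 10 10 3)))) st1 (\<lambda>t'. ?P (t + (t1 + t')))"
      proof (cases "\<exists>a S'. p = Close a \<and> S = Open a # S'")
        case True
        then obtain a S' where p: "p = Close a" "S = Open a # S'" by blast
        have 0: "?R 8 = 0" using p r15 by (simp add: is_open_def)
        have "ends B pop_com (?R, M) (\<lambda>t st. t = 9 \<and> (\<exists>R' M'. st = (R', M') \<and>
          layout s n nx R' M' S' [] rest (X @ [2 * a + ?R 10]) (Y @ [2 * a + ?R 10]) \<and> keeps ?R R'))"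
          using L2 p r B r13 by (intro pop_com_ends) auto
        then have "ends B (Seq pop_com (Ins (Add 10 10 3))) (?R, M) (\<lambda>t'. ?P (t + (t1 + (t' + 1))))"
          unfolding ends_Seq
        proof (rule ends_mono, elim conjE exE)
          fix t2 :: nat and st2 R' M'
          assume 2: "t2 = 9" "st2 = (R', M')" "keeps ?R R'"
            "layout s n nx R' M' S' [] rest (X @ [2 * a + ?R 10]) (Y @ [2 * a + ?R 10])"
          show "ends B (Ins (Add 10 10 3)) st2 (\<lambda>t'. ?P (t + (t1 + (t2 + t' + 1))))"
            using 2 layoutD(3)[OF 2(4)] p r t t1 B by (auto simp: ends_simps keeps_def)
        qed
        then show ?thesis using 0 st1 by (simp add: ends_Cond)
      next
        case False
        have 1: "?R 8 \<noteq> 0"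
        proof (cases p)
          case (Close a)
          with False have "?top \<noteq> 2 * a" by (auto split: list.splits dest: paren_code_even)
          with Close r15 show ?thesis by (auto simp: is_open_def)
        qed (use r15 in \<open>auto simp: is_open_def\<close>)
        have C: "(case (p, S) of (Close a, Open b # S') \<Rightarrow> if a = b then x a b S' else y | _ \<Rightarrow> y) = y" for x y
          using False by (auto split: paren.splits list.splits)
        have "ends B push_com (?R, M) (\<lambda>t st. t = 2 \<and> (\<exists>R' M'. st = (R', M') \<and>
          layout s n nx R' M' (p # S) [] rest X Y \<and> keeps ?R R'))"
          using L2 r13 B' by (intro push_com_ends) auto
        then have "ends B push_com (?R, M) (\<lambda>t'. ?P (t + (t1 + (t' + 2))))"
          unfolding C by (rule ends_mono) (use r t t1 in \<open>auto simp: keeps_def\<close>)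
        then show ?thesis using 1 st1 by (simp add: ends_Cond)
      qed
    qed
  qed
qed

text \<open>Every unread symbol may yield a group, so the bound on \<open>B\<close> reserves
  \<open>2 * s\<close> per symbol; it survives each step since \<open>i\<close> grows by at most one
  while \<open>rest\<close> shrinks.\<close>

lemma reduce_loop_ends:
  assumes "layout s n nx R M S [] rest X Y" "R 10 = 2 * s * i"
    "2 * s * (i + length rest + 2) + 2 * n + 5 \<le> B" "reduce s rest S = (T, gs)"
  shows "ends B (Loop 17 reduce_body) (R, M) (\<lambda>t st. t \<le> 29 * length rest + 1 \<and>
    (\<exists>R' M'. st = (R', M') \<and> R' 4 = R 4 \<and> R' 10 = 2 * s * (i + length gs) \<and>
      layout s n nx R' M' T [] [] (X @ tagged s fst i gs) (Y @ tagged s snd i gs)))"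
  using assms
proof (induction rest arbitrary: R M S X Y i gs)
  case Nil
  then show ?case using layoutD(5)[OF Nil.prems(1)] by (intro ends_Loop_False) auto
next
  case (Cons p rest)
  note L = Cons.prems(1)
  have B: "R 10 + 2 * s + 2 * n + 5 \<le> B" using Cons.prems(2,3) by (simp add: algebra_simps)
  show ?case (is "ends _ _ _ ?P")
  proof (rule ends_Loop_True)
    show "fst (R, M) 17 \<noteq> 0" using layoutD(5)[OF L] by simp
    show "ends B reduce_body (R, M) (\<lambda>t st. ends B (Loop 17 reduce_body) st (\<lambda>t'. ?P (t + t' + 2)))"
    proof (rule ends_mono[OF reduce_body_ends[OF L B]], elim conjE exE)
      fix t :: nat and st R1 M1
      assume t: "t \<le> 27" and st: "st = (R1, M1)" and r4: "R1 4 = R 4"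
        and C: "case (p, S) of (Close a, Open b # S') \<Rightarrow>
          if a = b then layout s n nx R1 M1 S' [] rest (X @ [2 * a + R 10]) (Y @ [2 * a + R 10]) \<and> R1 10 = R 10 + 2 * s
          else layout s n nx R1 M1 (p # S) [] rest X Y \<and> R1 10 = R 10
        | _ \<Rightarrow> layout s n nx R1 M1 (p # S) [] rest X Y \<and> R1 10 = R 10"
      show "ends B (Loop 17 reduce_body) st (\<lambda>t'. ?P (t + t' + 2))"
      proof (cases "\<exists>a S'. p = Close a \<and> S = Open a # S'")
        case True
        then obtain a S' where p: "p = Close a" "S = Open a # S'" by blast
        have "a < s" using layoutD(6)[OF L] p by (auto simp: parens_def)
        with Cons.prems(4) p obtain hs where h: "reduce s rest S' = (T, hs)" "gs = [(a, a)] # hs"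
          by (auto split: prod.splits)
        have L1: "layout s n nx R1 M1 S' [] rest (X @ [2 * a + R 10]) (Y @ [2 * a + R 10])"
          and r10: "R1 10 = 2 * s * Suc i" using C p Cons.prems(2) by auto
        have B1: "2 * s * (Suc i + length rest + 2) + 2 * n + 5 \<le> B" using Cons.prems(3) by simp
        show ?thesis unfolding st
          by (rule ends_mono[OF Cons.IH[OF L1 r10 B1 h(1)]])
            (use t r4 h(2) Cons.prems(2) in \<open>auto simp: add.commute\<close>)
      next
        case False
        then have C': "layout s n nx R1 M1 (p # S) [] rest X Y" "R1 10 = 2 * s * i"
          using C Cons.prems(2) by (cases p; cases S; cases "hd S"; auto split: if_splits)+
        have h: "reduce s rest (p # S) = (T, gs)"
          using Cons.prems(4) False by (cases "(s, p # rest, S)" rule: reduce.cases) auto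
        have B1: "2 * s * (i + length rest + 2) + 2 * n + 5 \<le> B"
          using Cons.prems(3) by (simp add: algebra_simps)
        show ?thesis unfolding st
          by (rule ends_mono[OF Cons.IH[OF C' B1 h]]) (use t r4 in auto)
      qed
    qed
  qed
qed

lemma pass_body_open:
  assumes L: "layout s n nx R M S [] (Open a # rest) X Y" and B: "R 10 + 2 * s + 2 * n + 5 \<le> B"
  shows "ends B pass_body (R, M) (\<lambda>t st. t \<le> 21 \<and> (\<exists>R' M'. st = (R', M') \<and> R' 4 = R 4 \<and> R' 9 = 0 \<and>
    layout s n nx R' M' (Open a # S) [] rest X Y \<and>
    (if R 9 = 0 then R' 8 = R 8 \<and> R' 10 = R 10 else R' 8 = Suc (length S) \<and> R' 10 = R 10 + 2 * s)))"
    (is "ends B _ _ ?P")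
proof -
  have B': "2 * s + 2 * n + 5 \<le> B" using B by simp
  show ?thesis unfolding pass_body_def ends_Seq[of B read_com]
  proof (rule ends_mono[OF read_com_ends[OF L B']], elim conjE exE)
    fix t :: nat and st R1
    assume t: "t = 6" and st: "st = (R1, M)" and L1: "layout s n nx R1 M S [Open a] rest X Y"
      and k1: "keeps R R1" and r13: "R1 13 = paren_code (Open a)"
      and r15: "R1 15 = of_bool (\<not> is_open (Open a))"
    have r15': "R1 15 = 0" using r15 by (simp add: is_open_def)
    note d = layoutD[OF L1]
    let ?R = "if R 9 = 0 then R1(9 := 0) else R1(8 := Suc (length S), 10 := R1 10 + 2 * s, 9 := 0)"
    have s1: "ends B (Cond 9 (prog [Ins (Add 8 7 0), Ins (Add 10 10 3), Ins (Const 9 0)]) (Ins (Const 9 0)))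
      (R1, M) (\<lambda>t st. t \<le> 5 \<and> st = (?R, M))"
      using d k1 B by (simp add: ends_simps keeps_def)
    have L2: "layout s n nx ?R M S [Open a] rest X Y" using L1 by simp
    have s2: "ends B push_com (?R, M) (\<lambda>t st. t = 2 \<and> (\<exists>R' M'. st = (R', M') \<and>
      layout s n nx R' M' (Open a # S) [] rest X Y \<and> keeps ?R R'))"
      by (rule push_com_ends[OF L2 B']) (use r13 in simp)
    have "ends B (Seq (Cond 9 (prog [Ins (Add 8 7 0), Ins (Add 10 10 3), Ins (Const 9 0)]) (Ins (Const 9 0)))
      push_com) (R1, M) (\<lambda>t'. ?P (t + (t' + 1)))"
      unfolding ends_Seq[of B "Cond _ _ _"]
    proof (rule ends_mono[OF s1], elim conjE)
      fix t1 :: nat and st1 assume 1: "t1 \<le> 5" "st1 = (?R, M)"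
      have "ends B push_com (?R, M) (\<lambda>t'. ?P (t + (t1 + t' + 1)))"
        by (rule ends_mono[OF s2]) (use k1 t 1(1) in \<open>auto simp: keeps_def split: if_splits\<close>)
      then show "ends B push_com st1 (\<lambda>t'. ?P (t + (t1 + t' + 1)))" unfolding 1(2) .
    qed
    then show "ends B (Cond 15
      (Seq (prog [Ins (Const 9 1), Ins (Sub 14 7 8)]) (Cond 14 pop_com (Seq push_com (Ins (Add 8 7 0)))))
      (Seq (Cond 9 (prog [Ins (Add 8 7 0), Ins (Add 10 10 3), Ins (Const 9 0)]) (Ins (Const 9 0))) push_com))
      st (\<lambda>t'. ?P (t + t'))"
      unfolding st using r15' by (simp add: ends_Cond[of B 15])
  qed
qed

lemma pass_body_close:
  assumes L: "layout s n nx R M S [] (Close b # rest) X Y" and B: "R 10 + 2 * s + 2 * n + 5 \<le> B"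
  shows "R 8 = Suc (length S) \<Longrightarrow>
      ends B pass_body (R, M) (\<lambda>t st. t \<le> 21 \<and> (\<exists>R' M'. st = (R', M') \<and> R' 4 = R 4 \<and> R' 9 = 1 \<and>
        layout s n nx R' M' (Close b # S) [] rest X Y \<and> R' 8 = Suc (Suc (length S)) \<and> R' 10 = R 10))"
      (is "_ \<Longrightarrow> ends B _ _ ?P")
    and "S = Open a # S' \<Longrightarrow> R 8 \<le> length S \<Longrightarrow>
      ends B pass_body (R, M) (\<lambda>t st. t \<le> 21 \<and> (\<exists>R' M'. st = (R', M') \<and> R' 4 = R 4 \<and> R' 9 = 1 \<and>
        layout s n nx R' M' S' [] rest (X @ [2 * a + R 10]) (Y @ [2 * b + R 10]) \<and> R' 8 = R 8 \<and> R' 10 = R 10))"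
      (is "_ \<Longrightarrow> _ \<Longrightarrow> ends B _ _ ?Q")
proof -
  have B': "2 * s + 2 * n + 5 \<le> B" using B by simp
  let ?rest = "Cond 15
      (Seq (prog [Ins (Const 9 1), Ins (Sub 14 7 8)]) (Cond 14 pop_com (Seq push_com (Ins (Add 8 7 0)))))
      (Seq (Cond 9 (prog [Ins (Add 8 7 0), Ins (Add 10 10 3), Ins (Const 9 0)]) (Ins (Const 9 0))) push_com)"
  have main: "ends B pass_body (R, M) Q"
    if "\<And>R1. layout s n nx R1 M S [Close b] rest X Y \<Longrightarrow> keeps R R1 \<Longrightarrow> R1 13 = paren_code (Close b) \<Longrightarrow>
      ends B (Cond 14 pop_com (Seq push_com (Ins (Add 8 7 0)))) (R1(9 := 1, 14 := Suc (length S) - R 8), M)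
        (\<lambda>t'. Q (t' + 10))" for Q
    unfolding pass_body_def ends_Seq[of B read_com]
  proof (rule ends_mono[OF read_com_ends[OF L B']], elim conjE exE)
    fix t :: nat and st R1
    assume t: "t = 6" and st: "st = (R1, M)" and L1: "layout s n nx R1 M S [Close b] rest X Y"
      and k1: "keeps R R1" and r13: "R1 13 = paren_code (Close b)"
      and r15: "R1 15 = of_bool (\<not> is_open (Close b))"
    have r15': "R1 15 = 1" using r15 by (simp add: is_open_def)
    have r8: "R1 8 = R 8" using k1 by (simp add: keeps_def)
    have "1 \<le> B" using B by simp
    with that[OF L1 k1 r13] show "ends B ?rest st (\<lambda>t'. Q (t + t'))"
      unfolding st t ends_Cond[of B 15] using r15' r8 layoutD(4)[OF L1]
      by (simp add: ends_Seq ends_Ins add.commute)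
  qed
  show "ends B pass_body (R, M) ?P" if r8: "R 8 = Suc (length S)"
  proof (rule main)
    fix R1 assume 1: "layout s n nx R1 M S [Close b] rest X Y" "keeps R R1" "R1 13 = paren_code (Close b)"
    let ?R = "R1(9 := 1, 14 := Suc (length S) - R 8)"
    have "layout s n nx ?R M S [Close b] rest X Y" using 1(1) by simp
    from push_com_ends[OF this B'] 1(3)
    have "ends B push_com (?R, M) (\<lambda>t st. t = 2 \<and> (\<exists>R' M'. st = (R', M') \<and>
      layout s n nx R' M' (Close b # S) [] rest X Y \<and> keeps ?R R'))" by simp
    then have "ends B (Seq push_com (Ins (Add 8 7 0))) (?R, M) (\<lambda>t'. ?P (t' + 1 + 10))"
      unfolding ends_Seq
    proof (rule ends_mono, elim conjE exE)
      fix t2 :: nat and st2 R' M'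
      assume 2: "t2 = 2" "st2 = (R', M')" "keeps ?R R'" "layout s n nx R' M' (Close b # S) [] rest X Y"
      show "ends B (Ins (Add 8 7 0)) st2 (\<lambda>t'. ?P (t2 + t' + 1 + 10))"
        using 2 layoutD[OF 2(4)] B 1(2) by (auto simp: ends_simps keeps_def)
    qed
    with r8 show "ends B (Cond 14 pop_com (Seq push_com (Ins (Add 8 7 0)))) (?R, M) (\<lambda>t'. ?P (t' + 10))"
      by (simp add: ends_Cond)
  qed
  show "ends B pass_body (R, M) ?Q" if S: "S = Open a # S'" and r8: "R 8 \<le> length S"
  proof (rule main)
    fix R1 assume 1: "layout s n nx R1 M S [Close b] rest X Y" "keeps R R1" "R1 13 = paren_code (Close b)"
    let ?R = "R1(9 := 1, 14 := Suc (length S) - R 8)"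
    have L2: "layout s n nx ?R M (Open a # S') [Close b] rest X Y" using 1(1) S by simp
    have "ends B pop_com (?R, M) (\<lambda>t st. t = 9 \<and> (\<exists>R' M'. st = (R', M') \<and>
      layout s n nx R' M' S' [] rest (X @ [2 * a + ?R 10]) (Y @ [2 * b + ?R 10]) \<and> keeps ?R R'))"
      by (rule pop_com_ends[OF L2]) (use 1 B in \<open>auto simp: keeps_def\<close>)
    then have "ends B pop_com (?R, M) (\<lambda>t'. ?Q (t' + 2 + 10))"
      by (rule ends_mono) (use 1(2) in \<open>auto simp: keeps_def\<close>)
    with r8 show "ends B (Cond 14 pop_com (Seq push_com (Ins (Add 8 7 0)))) (?R, M) (\<lambda>t'. ?Q (t' + 10))"
      by (simp add: ends_Cond Suc_diff_le)
  qed
qed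

text \<open>The pairs of the chain \<open>g\<close> under construction are already written with the
  current tag although \<open>pass\<close> releases \<open>g\<close> only later, so the assumption
  splits them off from the output. The last group is not closed within the loop, hence the offset
  lags behind by \<open>2 * s\<close>.\<close>

lemma pass_loop_ends:
  assumes "layout s n nx R M (map Open A @ F) [] rest
      (X @ map (\<lambda>p. 2 * s * i + 2 * fst p) g) (Y @ map (\<lambda>p. 2 * s * i + 2 * snd p) g)"
    "R 8 = Suc (length F)" "R 9 = of_bool m" "R 10 = 2 * s * i"
    "2 * s * (i + length rest + 2) + 2 * n + 5 \<le> B" "pass rest F A m g = (T, gs)"
  shows "ends B (Loop 17 pass_body) (R, M) (\<lambda>t st. t \<le> 23 * length rest + 1 \<and>
    (\<exists>R' M'. st = (R', M') \<and> R' 4 = R 4 \<and> R' 10 + 2 * s = 2 * s * (i + length gs) \<and>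
      layout s n nx R' M' T [] [] (X @ tagged s fst i gs) (Y @ tagged s snd i gs)))"
  using assms
proof (induction rest arbitrary: R M A F X Y i g gs m)
  case Nil
  then show ?case using layoutD(5)[OF Nil.prems(1)] by (intro ends_Loop_False) auto
next
  case (Cons p rest)
  note L = Cons.prems(1)
  have B: "R 10 + 2 * s + 2 * n + 5 \<le> B" using Cons.prems(4,5) by (simp add: algebra_simps)
  have B1: "2 * s * (i + length rest + 2) + 2 * n + 5 \<le> B"
    using Cons.prems(5) by (simp add: algebra_simps)
  have r17: "fst (R, M) 17 \<noteq> 0" using layoutD(5)[OF L] by simp
  show ?case (is "ends _ _ _ ?P")
  proof (cases p)
    case (Open a)
    note L = L[unfolded Open]
    show ?thesis
    proof (rule ends_Loop_True[OF r17], rule ends_mono[OF pass_body_open[OF L B]], elim conjE exE)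
      fix t :: nat and st R1 M1
      assume t: "t \<le> 21" and st: "st = (R1, M1)" and r: "R1 4 = R 4" "R1 9 = 0"
        and L1: "layout s n nx R1 M1 (Open a # map Open A @ F) [] rest
          (X @ map (\<lambda>p. 2 * s * i + 2 * fst p) g) (Y @ map (\<lambda>p. 2 * s * i + 2 * snd p) g)"
        and C: "if R 9 = 0 then R1 8 = R 8 \<and> R1 10 = R 10
          else R1 8 = Suc (length (map Open A @ F)) \<and> R1 10 = R 10 + 2 * s"
      show "ends B (Loop 17 pass_body) st (\<lambda>t'. ?P (t + t' + 2))"
      proof (cases m)
        case True
        with Cons.prems(6) Open obtain hs where
          h: "pass rest (map Open A @ F) [a] False [] = (T, hs)" "gs = g # hs"
          by (auto split: prod.splits)
        have L2: "layout s n nx R1 M1 (map Open [a] @ map Open A @ F) [] rest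
          ((X @ map (\<lambda>p. 2 * s * i + 2 * fst p) g) @ map (\<lambda>p. 2 * s * Suc i + 2 * fst p) [])
          ((Y @ map (\<lambda>p. 2 * s * i + 2 * snd p) g) @ map (\<lambda>p. 2 * s * Suc i + 2 * snd p) [])"
          using L1 by simp
        have q: "R1 8 = Suc (length (map Open A @ F))" "R1 9 = of_bool False" "R1 10 = 2 * s * Suc i"
          using C True Cons.prems(3,4) r by auto
        have B2: "2 * s * (Suc i + length rest + 2) + 2 * n + 5 \<le> B" using Cons.prems(5) by simp
        show ?thesis unfolding st
          by (rule ends_mono[OF Cons.IH[OF L2 q B2 h(1)]]) (use t r h(2) in auto)
      next
        case False
        have L2: "layout s n nx R1 M1 (map Open (a # A) @ F) [] rest
          (X @ map (\<lambda>p. 2 * s * i + 2 * fst p) g) (Y @ map (\<lambda>p. 2 * s * i + 2 * snd p) g)"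
          using L1 by simp
        have q: "R1 8 = Suc (length F)" "R1 9 = of_bool False" "R1 10 = 2 * s * i"
          using C False Cons.prems(2,3,4) r by auto
        have h: "pass rest F (a # A) False g = (T, gs)" using Cons.prems(6) Open False by simp
        show ?thesis unfolding st
          by (rule ends_mono[OF Cons.IH[OF L2 q B1 h]]) (use t r in auto)
      qed
    qed
  next
    case (Close b)
    note L = L[unfolded Close]
    show ?thesis
    proof (cases A)
      case Nil
      have r8: "R 8 = Suc (length (map Open A @ F))" using Cons.prems(2) Nil by simp
      show ?thesis
      proof (rule ends_Loop_True[OF r17], rule ends_mono[OF pass_body_close(1)[OF L B r8]], elim conjE exE)
        fix t :: nat and st R1 M1
        assume t: "t \<le> 21" and st: "st = (R1, M1)" and r: "R1 4 = R 4" "R1 9 = 1"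
            "R1 8 = Suc (Suc (length (map Open A @ F)))" "R1 10 = R 10"
          and L1: "layout s n nx R1 M1 (Close b # map Open A @ F) [] rest
            (X @ map (\<lambda>p. 2 * s * i + 2 * fst p) g) (Y @ map (\<lambda>p. 2 * s * i + 2 * snd p) g)"
        have L2: "layout s n nx R1 M1 (map Open [] @ Close b # F) [] rest
            (X @ map (\<lambda>p. 2 * s * i + 2 * fst p) g) (Y @ map (\<lambda>p. 2 * s * i + 2 * snd p) g)"
          using L1 Nil by simp
        have q: "R1 8 = Suc (length (Close b # F))" "R1 9 = of_bool True" "R1 10 = 2 * s * i"
          using Cons.prems(4) r Nil by auto
        have h: "pass rest (Close b # F) [] True g = (T, gs)" using Cons.prems(6) Close Nil by simp
        show "ends B (Loop 17 pass_body) st (\<lambda>t'. ?P (t + t' + 2))" unfolding st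
          by (rule ends_mono[OF Cons.IH[OF L2 q B1 h]]) (use t r in auto)
      qed
    next
      case A: (Cons a A')
      have S: "map Open A @ F = Open a # map Open A' @ F" "R 8 \<le> length (map Open A @ F)"
        using A Cons.prems(2) by auto
      show ?thesis
      proof (rule ends_Loop_True[OF r17], rule ends_mono[OF pass_body_close(2)[OF L B S]], elim conjE exE)
        fix t :: nat and st R1 M1
        assume t: "t \<le> 21" and st: "st = (R1, M1)" and r: "R1 4 = R 4" "R1 9 = 1" "R1 8 = R 8" "R1 10 = R 10"
          and L1: "layout s n nx R1 M1 (map Open A' @ F) [] rest
            ((X @ map (\<lambda>p. 2 * s * i + 2 * fst p) g) @ [2 * a + R 10])
            ((Y @ map (\<lambda>p. 2 * s * i + 2 * snd p) g) @ [2 * b + R 10])"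
        have L2: "layout s n nx R1 M1 (map Open A' @ F) [] rest
            (X @ map (\<lambda>p. 2 * s * i + 2 * fst p) (g @ [(a, b)]))
            (Y @ map (\<lambda>p. 2 * s * i + 2 * snd p) (g @ [(a, b)]))"
          using L1 Cons.prems(4) by (simp add: add.commute)
        have q: "R1 8 = Suc (length F)" "R1 9 = of_bool True" "R1 10 = 2 * s * i"
          using Cons.prems(2,4) r by auto
        have h: "pass rest F A' True (g @ [(a, b)]) = (T, gs)" using Cons.prems(6) Close A by simp
        show "ends B (Loop 17 pass_body) st (\<lambda>t'. ?P (t + t' + 2))" unfolding st
          by (rule ends_mono[OF Cons.IH[OF L2 q B1 h]]) (use t r in auto)
      qed
    qed
  qed
qed

text \<open>Register 4 holds the length of the current string and register 19 the decrease achieved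
  by the pass, which is the guard of the outer loop. Advancing register 10 closes the last group of
  the pass.\<close>

definition passes_body :: com where
  "passes_body = Seq (prog [Ins (Add 6 1 0), Ins (Add 7 1 0), Ins (Add 8 1 0), Ins (Const 9 1), Ins (Add 17 4 0)])
    (Seq (Loop 17 pass_body)
      (prog [Ins (Add 10 10 3), Ins (Sub 14 7 1), Ins (Sub 19 4 14), Ins (Add 4 14 0)]))"

text \<open>A stack lies in memory from bottom to top, so the result of one pass already is, in
  place, the input of the next; only the pointers are reset.\<close>

lemma layout_reset:
  assumes "layout s n nx R M (rev w) [] [] X Y" "consts_ok s n R'"
    "R' 6 = 1" "R' 7 = 1" "R' 17 = length w" "R' 11 = R 11" "R' 12 = R 12"
  shows "layout s n nx R' M [] [] w X Y"
proof -
  have "mem_ok n nx M (R 6) (rev w) [] X Y" using assms(1) by (simp add: layout_def)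
  then have "mem_ok n nx M 1 [] w X Y" by (auto simp: mem_ok_def)
  moreover have "opens (rev w) = opens w" "closes (rev w) = closes w"
    by (simp_all add: opens_def closes_def flip: rev_filter)
  ultimately show ?thesis using assms by (simp add: layout_def)
qed

lemma passes_body_ends:
  assumes L: "layout s n nx R M (rev w) [] [] X Y" and r: "R 4 = length w" "R 10 = 2 * s * i"
    and B: "2 * s * (i + length w + 3) + 2 * n + 5 \<le> B" and h: "pass w [] [] True [] = (T, gs)"
  shows "ends B passes_body (R, M) (\<lambda>t st. t \<le> 23 * length w + 10 \<and>
    (\<exists>R' M'. st = (R', M') \<and> R' 4 = length T \<and> R' 10 = 2 * s * (i + length gs) \<and>
      R' 19 = length w - length T \<and>
      layout s n nx R' M' T [] [] (X @ tagged s fst i gs) (Y @ tagged s snd i gs)))"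
    (is "ends B _ _ ?P")
proof -
  note d = layoutD[OF L]
  have C: "consts_ok s n R" using L by (simp add: layout_def)
  let ?R = "R(6 := 1, 7 := 1, 8 := 1, 9 := 1, 17 := length w)"
  have "5 \<le> B" and wB: "length w \<le> B" using B d(8) by auto
  then have s1: "ends B (prog [Ins (Add 6 1 0), Ins (Add 7 1 0), Ins (Add 8 1 0), Ins (Const 9 1), Ins (Add 17 4 0)])
    (R, M) (\<lambda>t st. t = 5 \<and> st = (?R, M))"
    using d r by (simp add: ends_simps)
  have "layout s n nx ?R M [] [] w X Y" by (rule layout_reset[OF L]) (use C in simp_all)
  then have L2: "layout s n nx ?R M (map Open [] @ []) [] w
      (X @ map (\<lambda>p. 2 * s * i + 2 * fst p) []) (Y @ map (\<lambda>p. 2 * s * i + 2 * snd p) [])" by simp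
  have q: "?R 8 = Suc (length [])" "?R 9 = of_bool True" "?R 10 = 2 * s * i"
    "2 * s * (i + length w + 2) + 2 * n + 5 \<le> B" using r B by (auto simp: algebra_simps)
  show ?thesis unfolding passes_body_def ends_Seq[of B "prog _"]
  proof (rule ends_mono[OF s1], elim conjE)
    fix t :: nat and st assume t: "t = 5" and st: "st = (?R, M)"
    show "ends B (Seq (Loop 17 pass_body)
        (prog [Ins (Add 10 10 3), Ins (Sub 14 7 1), Ins (Sub 19 4 14), Ins (Add 4 14 0)])) st (\<lambda>t'. ?P (t + t'))"
      unfolding st ends_Seq[of B "Loop _ _"]
    proof (rule ends_mono[OF pass_loop_ends[OF L2 q h]], elim conjE exE)
      fix t1 :: nat and st1 R1 M1
      assume t1: "t1 \<le> 23 * length w + 1" and st1: "st1 = (R1, M1)" and r1: "R1 4 = ?R 4"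
        "R1 10 + 2 * s = 2 * s * (i + length gs)"
        and L1: "layout s n nx R1 M1 T [] [] (X @ tagged s fst i gs) (Y @ tagged s snd i gs)"
      have "2 * s * (i + length gs) \<le> 2 * s * (i + length w + 3)"
        using pass_length(3)[OF h] by (intro mult_le_mono2) simp
      then have "2 * s * (i + length gs) \<le> B" using B by linarith
      moreover have "length T \<le> B" using layoutD(8)[OF L1] B by linarith
      ultimately show "ends B (prog [Ins (Add 10 10 3), Ins (Sub 14 7 1), Ins (Sub 19 4 14), Ins (Add 4 14 0)])
        st1 (\<lambda>t'. ?P (t + (t1 + t')))"
        using t t1 r r1 L1 layoutD[OF L1] unfolding st1 by (simp add: ends_simps)
    qed
  qed
qed

lemma passes_loop_ends:
  assumes "layout s n nx R M (rev w) [] [] X Y" "R 4 = length w" "R 10 = 2 * s * i" "R 19 \<noteq> 0"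
    "2 * s * (i + Suc (length w) * (length w + 3)) + 2 * n + 5 \<le> B"
  shows "\<exists>gs r p. passes w gs r p \<and> ends B (Loop 19 passes_body) (R, M) (\<lambda>t st.
    t \<le> 23 * p * Suc (length w) + 1 \<and>
    (\<exists>R' M'. st = (R', M') \<and> R' 4 = length r \<and>
      layout s n nx R' M' (rev r) [] [] (X @ tagged s fst i gs) (Y @ tagged s snd i gs)))"
  using assms
proof (induction "length w" arbitrary: w R M X Y i rule: less_induct)
  case less
  note L = less.prems(1)
  obtain T gs where h: "pass w [] [] True [] = (T, gs)" by fastforce
  have "2 * s * (i + length w + 3) \<le> 2 * s * (i + Suc (length w) * (length w + 3))"
    by (intro mult_le_mono2) simp
  then have B: "2 * s * (i + length w + 3) + 2 * n + 5 \<le> B" using less.prems(5) by linarith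
  note body = passes_body_ends[OF L less.prems(2,3) B h]
  have r19: "fst (R, M) 19 \<noteq> 0" using less.prems(4) by simp
  show ?case
  proof (cases "length T < length w")
    case True
    from body obtain t R1 M1 where b: "big_step B passes_body (R, M) t (R1, M1)"
      "t \<le> 23 * length w + 10" "R1 4 = length T" "R1 10 = 2 * s * (i + length gs)"
      "R1 19 = length w - length T"
      "layout s n nx R1 M1 T [] [] (X @ tagged s fst i gs) (Y @ tagged s snd i gs)"
      unfolding ends_def by blast
    have L1: "layout s n nx R1 M1 (rev (rev T)) [] [] (X @ tagged s fst i gs) (Y @ tagged s snd i gs)"
      using b(6) by simp
    \<comment> \<open>A potential for the number of groups: one pass creates at most
      \<open>Suc (length w)\<close> of them, and since \<open>T\<close> is shorter than
      \<open>w\<close>, its product is at most \<open>length w * (length w + 2)\<close>.\<close>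
    have "length gs + Suc (length T) * (length T + 3) \<le> Suc (length w) + length w * (length w + 2)"
      using pass_length(3)[OF h] mult_le_mono[of "Suc (length T)" "length w" "length T + 3" "length w + 2"] True
      by linarith
    also have "\<dots> \<le> Suc (length w) * (length w + 3)" by (simp add: algebra_simps)
    finally have "2 * s * ((i + length gs) + Suc (length T) * (length T + 3))
      \<le> 2 * s * (i + Suc (length w) * (length w + 3))" by (intro mult_le_mono2) simp
    then have B1: "2 * s * ((i + length gs) + Suc (length (rev T)) * (length (rev T) + 3)) + 2 * n + 5 \<le> B"
      using less.prems(5) unfolding length_rev by linarith
    have "length (rev T) < length w" "R1 4 = length (rev T)" "R1 19 \<noteq> 0" using True b by auto
    from less.hyps[OF this(1) L1 this(2) b(4) this(3) B1] obtain hs r p where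
      P: "passes (rev T) hs r p" and
      E: "ends B (Loop 19 passes_body) (R1, M1) (\<lambda>t st.
        t \<le> 23 * p * Suc (length (rev T)) + 1 \<and> (\<exists>R' M'. st = (R', M') \<and> R' 4 = length r \<and>
        layout s n nx R' M' (rev r) [] [] ((X @ tagged s fst i gs) @ tagged s fst (i + length gs) hs)
          ((Y @ tagged s snd i gs) @ tagged s snd (i + length gs) hs)))" by blast
    have "23 * p * Suc (length (rev T)) \<le> 23 * p * Suc (length w)" using True by (intro mult_le_mono2) simp
    moreover have "23 * Suc p * Suc (length w) = 23 * p * Suc (length w) + 23 * length w + 23"
      by (simp add: algebra_simps)
    ultimately have time: "t + t' + 2 \<le> 23 * Suc p * Suc (length w) + 1"
      if "t' \<le> 23 * p * Suc (length (rev T)) + 1" for t'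
      using that b(2) by linarith
    have "ends B (Loop 19 passes_body) (R, M) (\<lambda>t st.
      t \<le> 23 * Suc p * Suc (length w) + 1 \<and> (\<exists>R' M'. st = (R', M') \<and> R' 4 = length r \<and>
      layout s n nx R' M' (rev r) [] [] (X @ tagged s fst i (gs @ hs)) (Y @ tagged s snd i (gs @ hs))))"
      by (rule ends_Loop_True[OF r19], rule endsI[OF b(1)], rule ends_mono[OF E])
        (use time in \<open>auto simp: tagged_append\<close>)
    with passes.more[OF h True P] show ?thesis by blast
  next
    case False
    then have T: "length T = length w" using pass_length(1)[OF h] by simp
    have "ends B (Loop 19 passes_body) (R, M) (\<lambda>t st.
      t \<le> 23 * 1 * Suc (length w) + 1 \<and> (\<exists>R' M'. st = (R', M') \<and> R' 4 = length (rev T) \<and>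
      layout s n nx R' M' (rev (rev T)) [] [] (X @ tagged s fst i gs) (Y @ tagged s snd i gs)))"
      by (rule ends_Loop_True[OF r19], rule ends_mono[OF body], elim conjE exE, rule ends_Loop_False)
        (use T in auto)
    with passes.last[OF h T] show ?thesis by blast
  qed
qed

definition finish_body :: com where
  "finish_body = Seq read_com
    (Cond 15 (prog [Ins (Store 12 18), Ins (Add 12 12 1)]) (prog [Ins (Store 11 1), Ins (Add 11 11 1)]))"

lemma finish_body_ends:
  assumes L: "layout s n nx R M [] [] (p # rest) X Y" and B: "2 * s + 2 * n + 5 \<le> B"
  shows "ends B finish_body (R, M) (\<lambda>t st. t \<le> 10 \<and> (\<exists>R' M'. st = (R', M') \<and>
    layout s n nx R' M' [] [] rest (X @ replicate (opens [p]) 1) (Y @ replicate (closes [p]) 3)))"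
    (is "ends B _ _ ?P")
  unfolding finish_body_def ends_Seq[of B read_com]
proof (rule ends_mono[OF read_com_ends[OF L B]], elim conjE exE)
  fix t :: nat and st R1
  assume t: "t = 6" and st: "st = (R1, M)" and L1: "layout s n nx R1 M [] [p] rest X Y"
    and k1: "keeps R R1" and r13: "R1 13 = paren_code p" and r15: "R1 15 = of_bool (\<not> is_open p)"
  have C: "consts_ok s n R1" and M: "mem_ok n nx M (R1 6) [] rest X Y" using L1 by (auto simp: layout_def)
  note bounds = layout_bounds[OF L1]
  show "ends B (Cond 15 (prog [Ins (Store 12 18), Ins (Add 12 12 1)]) (prog [Ins (Store 11 1), Ins (Add 11 11 1)]))
    st (\<lambda>t'. ?P (t + t'))"
  proof (cases p)
    case (Open a)
    have l: "length X < nx" using L1 Open by (simp add: layout_def)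
    have "Suc (n + 3 + length X) \<le> B" using bounds B l by linarith
    then show ?thesis
      using L1 C consts_okD[OF C] mem_ok_left[OF M l, of 1] Open r15 t unfolding st layout_def
      by (simp add: ends_simps is_open_def)
  next
    case (Close a)
    have l: "length Y < n - nx" using L1 Close by (simp add: layout_def)
    have "Suc (n + 3 + nx + length Y) \<le> B" using bounds B l by linarith
    then show ?thesis
      using L1 C consts_okD[OF C] mem_ok_right[OF M l, of 3] Close r15 t unfolding st layout_def
      by (simp add: ends_simps is_open_def)
  qed
qed

lemma finish_loop_ends:
  assumes "layout s n nx R M [] [] rest X Y" "2 * s + 2 * n + 5 \<le> B"
  shows "ends B (Loop 17 finish_body) (R, M) (\<lambda>t st. t \<le> 12 * length rest + 1 \<and> (\<exists>R' M'. st = (R', M') \<and>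
    layout s n nx R' M' [] [] [] (X @ replicate (opens rest) 1) (Y @ replicate (closes rest) 3)))"
  using assms(1)
proof (induction rest arbitrary: R M X Y)
  case Nil
  then show ?case using layoutD(5)[OF Nil.prems(1)] by (intro ends_Loop_False) auto
next
  case (Cons p rest)
  have r17: "fst (R, M) 17 \<noteq> 0" using layoutD(5)[OF Cons.prems] by simp
  have o: "replicate (opens [p]) (1::nat) @ replicate (opens rest) 1 = replicate (opens (p # rest)) 1"
    "replicate (closes [p]) (3::nat) @ replicate (closes rest) 3 = replicate (closes (p # rest)) 3"
    using opens_closes_simps(4)[of "[p]" rest] opens_closes_simps(8)[of "[p]" rest]
    by (simp_all only: replicate_add[symmetric] append.simps)
  show ?case (is "ends _ _ _ ?P")
  proof (rule ends_Loop_True[OF r17], rule ends_mono[OF finish_body_ends[OF Cons.prems assms(2)]], elim conjE exE)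
    fix t :: nat and st R1 M1
    assume t: "t \<le> 10" and st: "st = (R1, M1)" and L1: "layout s n nx R1 M1 [] [] rest
      (X @ replicate (opens [p]) 1) (Y @ replicate (closes [p]) 3)"
    show "ends B (Loop 17 finish_body) st (\<lambda>t'. ?P (t + t' + 2))" unfolding st
      by (rule ends_mono[OF Cons.IH[OF L1, unfolded append.assoc o]]) (use t in auto)
  qed
qed

text \<open>The second string starts right behind the first, so the number of open parentheses must
  be known before the first pair is written; it is obtained by counting the close ones.\<close>

definition count_body :: com where
  "count_body = Seq read_com (Ins (Add 16 16 15))"

lemma count_loop_ends:
  assumes "consts_ok s n R" "seg M (R 6) (map paren_code rest)" "R 17 = length rest"
    "R 6 + length rest \<le> Suc n" "R 16 + length rest \<le> n" "set rest \<subseteq> parens s" "2 * s + 2 * n + 5 \<le> B"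
  shows "ends B (Loop 17 count_body) (R, M) (\<lambda>t st. t \<le> 9 * length rest + 1 \<and> (\<exists>R'. st = (R', M) \<and>
    consts_ok s n R' \<and> R' 4 = R 4 \<and> R' 10 = R 10 \<and> R' 16 = R 16 + closes rest))"
  using assms
proof (induction rest arbitrary: R)
  case Nil
  then show ?case by (intro ends_Loop_False) auto
next
  case (Cons p rest)
  have r17: "fst (R, M) 17 \<noteq> 0" using Cons.prems(3) by simp
  have p: "paren_code p < 2 * s" using Cons.prems(6) paren_code_less by simp
  have par: "paren_code p - (paren_code p div 2 + paren_code p div 2) = closes [p]"
    by (cases p) auto
  have cl: "closes (p # rest) = closes [p] + closes rest" "closes [p] \<le> 1"
    using opens_closes_simps(8)[of "[p]" rest] by (simp, cases p) auto
  have q: "paren_code p div 2 + paren_code p div 2 \<le> B" "Suc (R 6) \<le> B" "R 16 + closes [p] \<le> B"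
    using p Cons.prems(4,5,7) cl(2) by auto
  let ?R = "R(13 := paren_code p, 6 := Suc (R 6), 17 := length rest,
    14 := paren_code p div 2 + paren_code p div 2, 15 := closes [p], 16 := R 16 + closes [p])"
  have body: "ends B count_body (R, M) (\<lambda>t st. t = 7 \<and> st = (?R, M))"
    using Cons.prems consts_okD[OF Cons.prems(1)] q par
    unfolding count_body_def read_com_def by (simp add: ends_simps)
  show ?case (is "ends _ _ _ ?P")
  proof (rule ends_Loop_True[OF r17], rule ends_mono[OF body], elim conjE)
    fix t :: nat and st assume t: "t = 7" and st: "st = (?R, M)"
    have C': "consts_ok s n ?R" using Cons.prems(1) by simp
    have "ends B (Loop 17 count_body) (?R, M) (\<lambda>t st. t \<le> 9 * length rest + 1 \<and> (\<exists>R'. st = (R', M) \<and>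
      consts_ok s n R' \<and> R' 4 = ?R 4 \<and> R' 10 = ?R 10 \<and> R' 16 = ?R 16 + closes rest))"
      by (rule Cons.IH[OF C']) (use Cons.prems cl in auto)
    then show "ends B (Loop 17 count_body) st (\<lambda>t'. ?P (t + t' + 2))" unfolding st
      by (rule ends_mono) (use t cl in auto)
  qed
qed

definition init_com :: "nat \<Rightarrow> com" where
  "init_com s = prog [Ins (Const 1 1), Ins (Const 2 2), Ins (Const 3 (2 * s)), Ins (Const 18 3), Ins (Load 4 0),
    Ins (Add 5 4 1), Ins (Add 6 1 0), Ins (Add 17 4 0)]"

definition header_com :: com where
  "header_com = prog [Ins (Sub 14 4 16), Ins (Store 5 14), Ins (Add 11 5 1), Ins (Store 11 16), Ins (Add 11 11 1),
    Ins (Add 12 11 14), Ins (Store 0 1), Ins (Add 6 1 0), Ins (Add 7 1 0), Ins (Add 17 4 0)]"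

definition prepare_com :: "nat \<Rightarrow> com" where
  "prepare_com s = Seq (init_com s) (Seq (Loop 17 count_body) (Seq header_com (Seq (Loop 17 reduce_body)
    (Seq (prog [Ins (Sub 4 7 1), Ins (Const 19 1)]) (Seq (Loop 19 passes_body)
    (Seq (prog [Ins (Add 6 1 0), Ins (Add 7 1 0), Ins (Add 17 4 0)]) (Loop 17 finish_body)))))))"

lemma header_ends:
  fixes \<sigma> :: "paren list"
  defines "n \<equiv> length \<sigma>"
  assumes \<sigma>: "\<sigma> \<in> lists (parens s)" and B: "2 * s + 2 * n + 5 \<le> B"
  shows "ends B (Seq (init_com s) (Seq (Loop 17 count_body) header_com)) (\<lambda>_. 0, mem (paren_input \<sigma>))
    (\<lambda>t st. t \<le> 9 * n + 19 \<and> (\<exists>R M. st = (R, M) \<and> layout s n (opens \<sigma>) R M [] [] \<sigma> [] [] \<and>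
      R 4 = n \<and> R 10 = 0))"
    (is "ends B _ _ ?P")
proof -
  let ?M = "mem (paren_input \<sigma>)"
  have M0: "?M 0 = n" and M1: "seg ?M 1 (map paren_code \<sigma>)" and M2: "\<forall>a > n. ?M a = 0"
    by (auto simp: paren_input_def initial_def seg_def n_def)
  let ?R = "(\<lambda>_ :: nat. 0 :: nat)(1 := 1, 2 := 2, 3 := 2 * s, 18 := 3, 4 := n, 5 := Suc n, 6 := 1, 17 := n)"
  have s1: "ends B (init_com s) (\<lambda>_. 0, ?M) (\<lambda>t st. t = 8 \<and> st = (?R, ?M))"
    using M0 B unfolding init_com_def by (simp add: ends_simps)
  have s2: "ends B (Loop 17 count_body) (?R, ?M) (\<lambda>t st. t \<le> 9 * length \<sigma> + 1 \<and> (\<exists>R'. st = (R', ?M) \<and>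
    consts_ok s n R' \<and> R' 4 = ?R 4 \<and> R' 10 = ?R 10 \<and> R' 16 = ?R 16 + closes \<sigma>))"
    by (rule count_loop_ends) (use M1 \<sigma> B in \<open>auto simp: consts_ok_def n_def\<close>)
  have oc: "opens \<sigma> + closes \<sigma> = n"
    unfolding n_def opens_def closes_def using sum_length_filter_compl[of is_open \<sigma>] by (simp add: comp_def)
  have s3: "ends B header_com (R, ?M) (\<lambda>t st. t = 10 \<and> (\<exists>R' M'. st = (R', M') \<and>
      layout s n (opens \<sigma>) R' M' [] [] \<sigma> [] [] \<and> R' 4 = n \<and> R' 10 = 0))"
    if C: "consts_ok s n R" and r: "R 4 = n" "R 10 = 0" "R 16 = closes \<sigma>" for R
  proof -
    have nx: "n - closes \<sigma> = opens \<sigma>" "closes \<sigma> = n - opens \<sigma>" "opens \<sigma> \<le> n" "closes \<sigma> \<le> n" using oc by auto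
    have M': "mem_ok n (opens \<sigma>) (?M(Suc n := opens \<sigma>, Suc (Suc n) := closes \<sigma>, 0 := 1)) 1 [] \<sigma> [] []"
      using M1 M2 nx by (auto simp: mem_ok_def n_def)
    have \<sigma>': "set \<sigma> \<subseteq> parens s" using \<sigma> by auto
    show ?thesis
      using C consts_okD[OF C] r B nx oc M' \<sigma>' unfolding header_com_def layout_def
      by (simp add: ends_simps n_def)
  qed
  show ?thesis unfolding ends_Seq[of B "init_com s"]
  proof (rule ends_mono[OF s1], elim conjE)
    fix t :: nat and st assume 1: "t = 8" "st = (?R, ?M)"
    show "ends B (Seq (Loop 17 count_body) header_com) st (\<lambda>t'. ?P (t + t'))"
      unfolding 1(2) ends_Seq
    proof (rule ends_mono[OF s2], elim conjE exE)
      fix t1 :: nat and st1 R1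
      assume 2: "t1 \<le> 9 * length \<sigma> + 1" "st1 = (R1, ?M)" "consts_ok s n R1" "R1 4 = ?R 4" "R1 10 = ?R 10"
        "R1 16 = ?R 16 + closes \<sigma>"
      have "R1 4 = n" "R1 10 = 0" "R1 16 = closes \<sigma>" using 2 by auto
      from s3[OF 2(3) this] show "ends B header_com st1 (\<lambda>t'. ?P (t + (t1 + t')))"
        unfolding 2(2) by (rule ends_mono) (use 1 2(1) in \<open>auto simp: n_def\<close>)
    qed
  qed
qed

lemma ends_assoc: "ends B (Seq (Seq a (Seq b c)) d) st Q \<longleftrightarrow> ends B (Seq a (Seq b (Seq c d))) st Q"
  by (simp add: ends_Seq add.assoc)

lemma layout_final:
  assumes L: "layout s n nx R M [] [] [] X Y"
  shows "R 5 = Suc n" "\<forall>r \<ge> 20. R r = 0" "M (Suc n + a) = mem (string_input X Y) a"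
proof -
  have len: "length X = nx" "length Y = n - nx" "nx \<le> n" using L by (auto simp: layout_def mem_ok_def)
  show "R 5 = Suc n" "\<forall>r \<ge> 20. R r = 0" using L by (auto simp: layout_def consts_ok_def)
  have M: "seg M (n + 3) X" "seg M (n + 3 + nx) Y" "M (n + 1) = nx" "M (n + 2) = n - nx"
    "\<forall>a \<ge> 2 * n + 3. M a = 0" using L by (auto simp: layout_def mem_ok_def)
  show "M (Suc n + a) = mem (string_input X Y) a"
  proof (cases "a < n + 2")
    case False
    then show ?thesis using M(5) len by (simp add: string_input_def initial_def)
  next
    case True
    have "seg M (Suc n) (length X # length Y # X @ Y)"
      using M(1-4) len by (simp add: numeral_3_eq_3)
    then have "M (Suc n + a) = (length X # length Y # X @ Y) ! a"
      unfolding seg_def using True len by (metis add.commute length_Cons length_append le_add_diff_inverse add_2_eq_Suc')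
    then show ?thesis using True len by (simp add: string_input_def initial_def)
  qed
qed

lemma prepare_com_ends:
  fixes \<sigma> :: "paren list"
  defines "n \<equiv> length \<sigma>"
  assumes \<sigma>: "\<sigma> \<in> lists (parens s)" and B: "2 * s * (n + Suc n * (n + 3)) + 2 * s + 2 * n + 5 \<le> B"
  shows "\<exists>T gs hs r p. reduce s \<sigma> [] = (T, gs) \<and> passes (rev T) hs r p \<and>
    ends B (prepare_com s) (\<lambda>_. 0, mem (paren_input \<sigma>)) (\<lambda>t st. t \<le> 100 * p * Suc n \<and>
      (\<exists>R M. st = (R, M) \<and> R 5 = Suc n \<and> (\<forall>r \<ge> 20. R r = 0) \<and> (\<forall>a. M (Suc n + a) =
        mem (string_input (left_string s (gs @ hs) r) (right_string s (gs @ hs) r)) a)))"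
proof -
  obtain T gs where h: "reduce s \<sigma> [] = (T, gs)" by fastforce
  have R0: "reduces \<sigma> gs (rev T)" and gs: "length gs \<le> n" using reduce_props[OF h] n_def by auto
  have B0: "2 * s + 2 * n + 5 \<le> B" using B by linarith
  have "n + 2 \<le> n + Suc n * (n + 3)" by simp
  then have "2 * s * (n + 2) \<le> 2 * s * (n + Suc n * (n + 3))" by (rule mult_le_mono2)
  then have B1: "2 * s * (0 + length \<sigma> + 2) + 2 * n + 5 \<le> B"
    using B unfolding n_def[symmetric] add_0 by linarith
  from header_ends[OF \<sigma>, of B] B0 obtain t1 R1 M1 where
    s1: "big_step B (Seq (init_com s) (Seq (Loop 17 count_body) header_com)) (\<lambda>_. 0, mem (paren_input \<sigma>)) t1 (R1, M1)"
    and t1: "t1 \<le> 9 * n + 19" and L1: "layout s n (opens \<sigma>) R1 M1 [] [] \<sigma> [] []" and r1: "R1 4 = n" "R1 10 = 2 * s * 0"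
    unfolding ends_def n_def by auto
  from reduce_loop_ends[OF L1 r1(2) B1 h] obtain t2 R2 M2 where
    s2: "big_step B (Loop 17 reduce_body) (R1, M1) t2 (R2, M2)" and t2: "t2 \<le> 29 * n + 1"
    and r2: "R2 4 = R1 4" "R2 10 = 2 * s * (0 + length gs)"
    and L2: "layout s n (opens \<sigma>) R2 M2 T [] [] ([] @ tagged s fst 0 gs) ([] @ tagged s snd 0 gs)"
    unfolding ends_def n_def by blast
  have T: "length T \<le> n" using layoutD(8)[OF L2] .
  let ?R3 = "R2(4 := length T, 19 := 1)"
  have "ends B (prog [Ins (Sub 4 7 1), Ins (Const 19 1)]) (R2, M2) (\<lambda>t st. t = 2 \<and> st = (?R3, M2))"
    using layoutD[OF L2] B0 by (simp add: ends_simps)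
  then have s3: "big_step B (prog [Ins (Sub 4 7 1), Ins (Const 19 1)]) (R2, M2) 2 (?R3, M2)"
    unfolding ends_def by blast
  have L3: "layout s n (opens \<sigma>) ?R3 M2 (rev (rev T)) [] [] (tagged s fst 0 gs) (tagged s snd 0 gs)"
    using L2 by simp
  have q3: "?R3 4 = length (rev T)" "?R3 10 = 2 * s * length gs" "?R3 19 \<noteq> 0" using r2 by auto
  have "length gs + Suc (length (rev T)) * (length (rev T) + 3) \<le> n + Suc n * (n + 3)"
    using T gs by (intro add_le_mono mult_le_mono) auto
  then have "2 * s * (length gs + Suc (length (rev T)) * (length (rev T) + 3)) \<le> 2 * s * (n + Suc n * (n + 3))"
    by (rule mult_le_mono2)
  then have B3: "2 * s * (length gs + Suc (length (rev T)) * (length (rev T) + 3)) + 2 * n + 5 \<le> B"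
    using B by linarith
  from passes_loop_ends[OF L3 q3 B3] obtain hs r p where P: "passes (rev T) hs r p" and
    E: "ends B (Loop 19 passes_body) (?R3, M2) (\<lambda>t st. t \<le> 23 * p * Suc (length (rev T)) + 1 \<and>
      (\<exists>R' M'. st = (R', M') \<and> R' 4 = length r \<and> layout s n (opens \<sigma>) R' M' (rev r) [] []
        (tagged s fst 0 gs @ tagged s fst (length gs) hs) (tagged s snd 0 gs @ tagged s snd (length gs) hs)))"
    by blast
  from E obtain t4 R4 M4 where
    s4: "big_step B (Loop 19 passes_body) (?R3, M2) t4 (R4, M4)"
    and t4: "t4 \<le> 23 * p * Suc (length (rev T)) + 1" and r4: "R4 4 = length r"
    and L4: "layout s n (opens \<sigma>) R4 M4 (rev r) [] []
      (tagged s fst 0 gs @ tagged s fst (length gs) hs) (tagged s snd 0 gs @ tagged s snd (length gs) hs)"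
    unfolding ends_def by blast
  have C4: "consts_ok s n R4" using L4 by (simp add: layout_def)
  have r: "length r \<le> n" using layoutD(8)[OF L4] by simp
  let ?R5 = "R4(6 := 1, 7 := 1, 17 := length r)"
  have "ends B (prog [Ins (Add 6 1 0), Ins (Add 7 1 0), Ins (Add 17 4 0)]) (R4, M4) (\<lambda>t st. t = 3 \<and> st = (?R5, M4))"
    using layoutD[OF L4] r4 B0 r by (simp add: ends_simps)
  then have s5: "big_step B (prog [Ins (Add 6 1 0), Ins (Add 7 1 0), Ins (Add 17 4 0)]) (R4, M4) 3 (?R5, M4)"
    unfolding ends_def by blast
  have L5: "layout s n (opens \<sigma>) ?R5 M4 [] [] r
      (tagged s fst 0 gs @ tagged s fst (length gs) hs) (tagged s snd 0 gs @ tagged s snd (length gs) hs)"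
    by (rule layout_reset[OF L4]) (use C4 in simp_all)
  from finish_loop_ends[OF L5 B0] obtain t6 R6 M6 where
    s6: "big_step B (Loop 17 finish_body) (?R5, M4) t6 (R6, M6)" and t6: "t6 \<le> 12 * length r + 1" and
    L6: "layout s n (opens \<sigma>) R6 M6 [] [] []
      ((tagged s fst 0 gs @ tagged s fst (length gs) hs) @ replicate (opens r) 1)
      ((tagged s snd 0 gs @ tagged s snd (length gs) hs) @ replicate (closes r) 3)"
    unfolding ends_def by blast
  have L7: "layout s n (opens \<sigma>) R6 M6 [] [] [] (left_string s (gs @ hs) r) (right_string s (gs @ hs) r)"
    using L6 by (simp add: left_string_def right_string_def tagged_append opens_def closes_def)
  \<comment> \<open>The time besides \<open>23 * p * Suc n\<close> for the passes sums up to
    \<open>50 * n + 27\<close>; since \<open>p\<close> is positive, it fits into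
    \<open>75 * (p * Suc n)\<close>.\<close>
  have "0 < p" using P by (cases rule: passes.cases) auto
  have "23 * p * Suc (length (rev T)) \<le> 23 * p * Suc n" using T by (intro mult_le_mono2) simp
  moreover have "Suc n \<le> p * Suc n" using mult_le_mono1[of 1 p "Suc n"] \<open>0 < p\<close> by simp
  moreover have "100 * p * Suc n = 23 * p * Suc n + 75 * (p * Suc n) + 2 * (p * Suc n)" by simp
  ultimately have time: "t1 + (t2 + (2 + (t4 + (3 + t6)))) \<le> 100 * p * Suc n"
    using t1 t2 t4 t6 r by linarith
  have "big_step B (Seq (Seq (init_com s) (Seq (Loop 17 count_body) header_com)) (Seq (Loop 17 reduce_body)
    (Seq (prog [Ins (Sub 4 7 1), Ins (Const 19 1)]) (Seq (Loop 19 passes_body)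
    (Seq (prog [Ins (Add 6 1 0), Ins (Add 7 1 0), Ins (Add 17 4 0)]) (Loop 17 finish_body))))))
    (\<lambda>_. 0, mem (paren_input \<sigma>)) (t1 + (t2 + (2 + (t4 + (3 + t6))))) (R6, M6)"
    by (intro big_step.Seq[OF s1] big_step.Seq[OF s2] big_step.Seq[OF s3] big_step.Seq[OF s4] big_step.Seq[OF s5] s6)
  then have "ends B (prepare_com s) (\<lambda>_. 0, mem (paren_input \<sigma>)) (\<lambda>t st. t \<le> 100 * p * Suc n \<and>
      (\<exists>R M. st = (R, M) \<and> R 5 = Suc n \<and> (\<forall>r \<ge> 20. R r = 0) \<and> (\<forall>a. M (Suc n + a) =
        mem (string_input (left_string s (gs @ hs) r) (right_string s (gs @ hs) r)) a)))"
    unfolding prepare_com_def ends_assoc[of B "init_com s", symmetric]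
    by (rule endsI) (use time layout_final[OF L7] in auto)
  with h P show ?thesis by blast
qed

subsection \<open>Running the string edit distance algorithm in a sandbox\<close>

text \<open>The registers of the simulated program are shifted by 20, its memory by the content of register 5.
  Every instruction becomes exactly two, and jumps out of the program lead to its end.\<close>

fun sandbox :: "nat \<Rightarrow> nat \<Rightarrow> instr \<Rightarrow> instr list" where
  "sandbox off len (Const r v) = [Const 6 0, Const (r + 20) v]"
| "sandbox off len (Add r i j) = [Const 6 0, Add (r + 20) (i + 20) (j + 20)]"
| "sandbox off len (Sub r i j) = [Const 6 0, Sub (r + 20) (i + 20) (j + 20)]"
| "sandbox off len (Mul r i j) = [Const 6 0, Mul (r + 20) (i + 20) (j + 20)]"
| "sandbox off len (Div r i j) = [Const 6 0, Div (r + 20) (i + 20) (j + 20)]"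
| "sandbox off len (Load r i) = [Add 6 5 (i + 20), Load (r + 20) 6]"
| "sandbox off len (Store i r) = [Add 6 5 (i + 20), Store 6 (r + 20)]"
| "sandbox off len (Jump l) = [Const 6 0, Jump (off + 2 * min l len)]"
| "sandbox off len (JumpZero r l) = [Const 6 0, JumpZero (r + 20) (off + 2 * min l len)]"
| "sandbox off len (Coin r) = [Const 6 0, Coin (r + 20)]"

definition sandbox_program :: "nat \<Rightarrow> program \<Rightarrow> program" where
  "sandbox_program off Q = concat (map (sandbox off (length Q)) Q)"

text \<open>The final instruction doubles the result, which makes up for the factor 2 in
  \<open>dyck_dist_le_edit_dist\<close>. Leaving the simulated code always leads to it.\<close>

definition sandboxed :: "program \<Rightarrow> program \<Rightarrow> program" where
  "sandboxed pre Q = pre @ sandbox_program (length pre) Q @ [Add 0 20 20]"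

lemma length_sandbox: "length (sandbox off len i) = 2"
  by (cases i) auto

lemma length_concat_const:
  assumes "\<And>x. x \<in> set xs \<Longrightarrow> length (f x) = 2"
  shows "length (concat (map f xs)) = 2 * length xs"
  using assms by (induction xs) auto

lemma concat_const_nth:
  assumes "\<And>x. length (f x) = 2" "k < length xs" "b < 2"
  shows "concat (map f xs) ! (2 * k + b) = f (xs ! k) ! b"
  using assms(2)
proof (induction xs arbitrary: k)
  case (Cons x xs)
  show ?case
  proof (cases k)
    case 0
    then show ?thesis using assms(1,3) by (simp add: nth_append)
  next
    case (Suc k')
    then show ?thesis using Cons assms(1) by (simp add: nth_append)
  qed
qed simp

text \<open>Register 6 holds shifted addresses, at most \<open>base + B'\<close>, and the final
  doubling produces at most \<open>2 * B'\<close>.\<close>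

locale simulation =
  fixes pre :: program and Q :: program and base B B' :: nat
  assumes bound: "base + B' \<le> B" "2 * B' \<le> B"
begin

abbreviation off :: nat where "off \<equiv> length pre"

abbreviation P :: program where "P \<equiv> sandboxed pre Q"

lemma length_P: "length P = off + 2 * length Q + 1"
  by (simp add: sandboxed_def sandbox_program_def length_concat_const length_sandbox)

lemma P_nth: "k < length Q \<Longrightarrow> b < 2 \<Longrightarrow> P ! (off + (2 * k + b)) = sandbox off (length Q) (Q ! k) ! b"
  by (simp add: sandboxed_def nth_append sandbox_program_def length_concat_const length_sandbox concat_const_nth)

lemma P_last: "P ! (off + 2 * length Q) = Add 0 20 20"
  by (simp add: sandboxed_def nth_append sandbox_program_def length_concat_const length_sandbox)

definition sim :: "config \<Rightarrow> config \<Rightarrow> bool" where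
  "sim c q \<longleftrightarrow> pc c = off + 2 * min (pc q) (length Q) \<and> (\<forall>r. regs c (r + 20) = regs q r) \<and>
    regs c 5 = base \<and> (\<forall>a. mem c (base + a) = mem q a) \<and> bounded_by B c"

definition fin :: "config \<Rightarrow> config \<Rightarrow> bool" where
  "fin c q \<longleftrightarrow> halted P c \<and> result c = 2 * result q \<and> bounded_by B c"

lemma sim_regs: "sim c q \<Longrightarrow> regs c (r + 20) = regs q r"
  by (simp add: sim_def)

lemma bounded_by_set_reg: "bounded_by B c \<Longrightarrow> v \<le> B \<Longrightarrow> bounded_by B (set_reg r v c)"
  by (simp add: bounded_by_def set_reg_def)

lemma sim_set_reg:
  assumes "sim c q" "pc q < length Q" "v \<le> B" "w \<le> B"
  shows "sim (set_reg (r + 20) v (set_reg 6 w c)) (set_reg r v q)"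
  using assms unfolding sim_def
  by (auto simp: set_reg_def bounded_by_def)

lemma sim_jump:
  assumes "sim c q" "w \<le> B"
  shows "sim ((set_reg 6 w c)\<lparr>pc := off + 2 * min l (length Q)\<rparr>) (q\<lparr>pc := l\<rparr>)"
  using assms unfolding sim_def by (auto simp: set_reg_def bounded_by_def)

lemma sim_next:
  assumes "sim c q" "pc q < length Q" "w \<le> B"
  shows "sim ((set_reg 6 w c)\<lparr>pc := Suc (Suc (pc c))\<rparr>) (q\<lparr>pc := Suc (pc q)\<rparr>)"
  using assms unfolding sim_def by (auto simp: set_reg_def bounded_by_def)

lemma sim_store:
  assumes "sim c q" "pc q < length Q" "w \<le> B" "v \<le> B"
  shows "sim ((set_reg 6 w c)\<lparr>pc := Suc (Suc (pc c)), mem := (mem c)(base + a := v)\<rparr>)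
    (q\<lparr>pc := Suc (pc q), mem := (mem q)(a := v)\<rparr>)"
  using assms unfolding sim_def by (auto simp: set_reg_def bounded_by_def)

lemma sim_first_step:
  assumes S: "sim c q" and k: "pc q < length Q" and q: "bounded_by B' q"
  obtains w where "step P c = return_pmf (set_reg 6 w c)" "w \<le> B"
    "(\<exists>r i. Q ! pc q = Load r i \<and> w = base + regs q i) \<or> (\<exists>r i. Q ! pc q = Store i r \<and> w = base + regs q i) \<or>
     (\<forall>r i. Q ! pc q \<noteq> Load r i \<and> Q ! pc q \<noteq> Store i r)"
proof -
  have pc: "pc c = off + (2 * pc q + 0)" using S k by (simp add: sim_def)
  then have nh: "\<not> halted P c" using k by (simp add: halted_def length_P)
  have st: "step P c = exec (sandbox off (length Q) (Q ! pc q) ! 0) c"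
    using nh P_nth[OF k, of 0] pc by (simp add: step_def)
  have b: "base + regs q i \<le> B" for i
    using q bound(1) unfolding bounded_by_def by (meson add_le_mono le_refl le_trans)
  have r5: "regs c 5 = base" using S by (simp add: sim_def)
  show thesis
  proof (cases "Q ! pc q")
    case (Load r i)
    then show thesis using st r5 sim_regs[OF S] b by (intro that[of "base + regs q i"]) auto
  next
    case (Store i r)
    then show thesis using st r5 sim_regs[OF S] b by (intro that[of "base + regs q i"]) auto
  qed (use st in \<open>auto intro!: that[of 0]\<close>)
qed

lemma sim_second_step:
  assumes S: "sim c q" and k: "pc q < length Q" and w: "w \<le> B"
    and ww: "(\<exists>r i. Q ! pc q = Load r i \<and> w = base + regs q i) \<or>
      (\<exists>r i. Q ! pc q = Store i r \<and> w = base + regs q i) \<or>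
      (\<forall>r i. Q ! pc q \<noteq> Load r i \<and> Q ! pc q \<noteq> Store i r)"
    and q: "bounded_by B' q" "\<forall>q' \<in> set_pmf (step Q q). bounded_by B' q'"
    and c': "c' \<in> set_pmf (step P (set_reg 6 w c))"
  shows "\<exists>q' \<in> set_pmf (step Q q). sim c' q'"
proof -
  let ?c = "set_reg 6 w c"
  have pc: "pc ?c = off + (2 * pc q + 1)" using S k by (simp add: sim_def set_reg_def)
  then have nh: "\<not> halted P ?c" using k by (simp add: halted_def length_P)
  have st: "step P ?c = exec (sandbox off (length Q) (Q ! pc q) ! 1) ?c"
    using nh P_nth[OF k, of 1] pc by (simp add: step_def)
  have stq: "step Q q = exec (Q ! pc q) q" using k by (simp add: step_def halted_def)
  have R: "regs ?c (i + 20) = regs q i" for i using sim_regs[OF S] by (simp add: set_reg_def)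
  have BB: "B' \<le> B" using bound(1) by simp
  \<comment> \<open>No arithmetic is repeated: a written value is bounded because it appears in a
    successor of \<open>q\<close>, and all successors are bounded by \<open>B'\<close>.\<close>
  have setr: "v \<le> B" if "set_reg r v q \<in> set_pmf (step Q q)" for r v
  proof -
    have "bounded_by B' (set_reg r v q)" using q that by blast
    then have "regs (set_reg r v q) r \<le> B'" unfolding bounded_by_def by blast
    then show ?thesis using BB by (simp add: set_reg_def)
  qed
  have reg: "?thesis" if "c' = set_reg (r + 20) v ?c" "set_reg r v q \<in> set_pmf (step Q q)" for r v
    using sim_set_reg[OF S k setr[OF that(2)] w] that by blast
  have M: "mem ?c (base + a) = mem q a" for a using S by (simp add: sim_def set_reg_def)
  show ?thesis
  proof (cases "Q ! pc q")
    case (Const r v)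
    show ?thesis by (rule reg[of r v]) (use c' in \<open>auto simp: st stq Const\<close>)
  next
    case (Add r i j)
    show ?thesis by (rule reg[of r "regs q i + regs q j"]) (use c' R in \<open>auto simp: st stq Add\<close>)
  next
    case (Sub r i j)
    show ?thesis by (rule reg[of r "regs q i - regs q j"]) (use c' R in \<open>auto simp: st stq Sub\<close>)
  next
    case (Mul r i j)
    show ?thesis by (rule reg[of r "regs q i * regs q j"]) (use c' R in \<open>auto simp: st stq Mul\<close>)
  next
    case (Div r i j)
    show ?thesis by (rule reg[of r "regs q i div regs q j"]) (use c' R in \<open>auto simp: st stq Div\<close>)
  next
    case (Load r i)
    have "regs ?c 6 = base + regs q i" using ww Load by (auto simp: set_reg_def)
    then show ?thesis by (intro reg[of r "mem q (regs q i)"]) (use c' M in \<open>auto simp: st stq Load\<close>)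
  next
    case (Store i r)
    have w': "w = base + regs q i" using ww Store by auto
    have "regs q r \<le> B" using q(1) BB unfolding bounded_by_def by (meson le_trans)
    moreover have "c' = ?c\<lparr>pc := Suc (pc ?c), mem := (mem ?c)(regs ?c 6 := regs q r)\<rparr>"
      using c' R[of r] by (simp add: st Store)
    then have "c' = ?c\<lparr>pc := Suc (Suc (pc c)), mem := (mem c)(base + regs q i := regs q r)\<rparr>"
      using w' by (simp add: set_reg_def)
    ultimately show ?thesis using sim_store[OF S k w, of "regs q r" "regs q i"] by (simp add: stq Store)
  next
    case (Jump l)
    from sim_jump[OF S w, of l] show ?thesis using c' by (auto simp: st stq Jump)
  next
    case (JumpZero r l)
    have "c' = ?c\<lparr>pc := (if regs q r = 0 then off + 2 * min l (length Q) else Suc (pc ?c))\<rparr>"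
      using c' R[of r] by (simp add: st JumpZero)
    moreover have "pc ?c = Suc (pc c)" by (simp add: set_reg_def)
    ultimately show ?thesis using sim_jump[OF S w, of l] sim_next[OF S k w] by (simp add: stq JumpZero)
  next
    case (Coin r)
    from c' obtain b where "b \<in> set_pmf (bernoulli_pmf (1/2))" "c' = set_reg (r + 20) (of_bool b) ?c"
      by (auto simp: st Coin)
    then show ?thesis by (intro reg[of r "of_bool b"]) (auto simp: stq Coin)
  qed
qed

text \<open>If \<open>Q\<close> has halted, the first of the two steps performs the doubling and
  halts, and from then on nothing changes. Hence the second claim also provides \<open>fin\<close>
  for a halted \<open>q\<close>.\<close>

lemma two_steps:
  assumes S: "sim c q \<or> halted Q q \<and> fin c q" and q: "bounded_by B' q"
    "\<forall>q' \<in> set_pmf (step Q q). bounded_by B' q'" and c1: "c1 \<in> set_pmf (step P c)"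
  shows "bounded_by B c1"
    and "c2 \<in> set_pmf (step P c1) \<Longrightarrow>
      (\<exists>q' \<in> set_pmf (step Q q). sim c2 q' \<or> halted Q q' \<and> fin c2 q') \<and> (halted Q q \<longrightarrow> fin c2 q)"
proof -
  have "bounded_by B c1 \<and> (c2 \<in> set_pmf (step P c1) \<longrightarrow>
      (\<exists>q' \<in> set_pmf (step Q q). sim c2 q' \<or> halted Q q' \<and> fin c2 q') \<and> (halted Q q \<longrightarrow> fin c2 q))"
  proof (cases "halted Q q")
    case True
    then have sq: "set_pmf (step Q q) = {q}" by (simp add: step_def)
    show ?thesis
    proof (cases "fin c q")
      case True
      then have "set_pmf (step P c) = {c}" by (simp add: fin_def step_def)
      with c1 True sq \<open>halted Q q\<close> show ?thesis by (auto simp: fin_def)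
    next
      case False
      with S have S: "sim c q" by simp
      have pc: "pc c = off + 2 * length Q" using S True by (simp add: sim_def halted_def min_def)
      then have "step P c = exec (Add 0 20 20) c"
        using P_last by (simp add: step_def halted_def length_P)
      then have c1': "c1 = set_reg 0 (2 * regs q 0) c" using c1 sim_regs[OF S, of 0] by (auto simp: mult_2)
      have "2 * regs q 0 \<le> B" using q(1) bound(2) unfolding bounded_by_def
        by (meson le_trans mult_le_mono2)
      then have b: "bounded_by B c1" unfolding c1' using S by (intro bounded_by_set_reg) (auto simp: sim_def)
      have h: "halted P c1" unfolding c1' by (simp add: halted_def set_reg_def pc length_P)
      then have "fin c1 q" using b unfolding fin_def c1' by (simp add: result_def set_reg_def)
      moreover have "set_pmf (step P c1) = {c1}" using h by (simp add: step_def)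
      ultimately show ?thesis using b sq True by auto
    qed
  next
    case False
    with S have S: "sim c q" by simp
    from False have k: "pc q < length Q" by (simp add: halted_def)
    obtain w where w: "step P c = return_pmf (set_reg 6 w c)" "w \<le> B"
      "(\<exists>r i. Q ! pc q = Load r i \<and> w = base + regs q i) \<or> (\<exists>r i. Q ! pc q = Store i r \<and> w = base + regs q i) \<or>
       (\<forall>r i. Q ! pc q \<noteq> Load r i \<and> Q ! pc q \<noteq> Store i r)"
      by (rule sim_first_step[OF S k q(1)])
    have c1': "c1 = set_reg 6 w c" using c1 w(1) by simp
    have "bounded_by B c1" unfolding c1' using S w(2) by (intro bounded_by_set_reg) (auto simp: sim_def)
    with sim_second_step[OF S k w(2,3) q] False c1' show ?thesis by blast
  qed
  then show "bounded_by B c1" "c2 \<in> set_pmf (step P c1) \<Longrightarrow>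
      (\<exists>q' \<in> set_pmf (step Q q). sim c2 q' \<or> halted Q q' \<and> fin c2 q') \<and> (halted Q q \<longrightarrow> fin c2 q)" by auto
qed

text \<open>Comparing supports suffices, as the guarantee of the simulated algorithm holds for every
  outcome of its coins. The runs correspond at even times; at odd times only the word bound is
  recorded. Two extra steps leave time for the final doubling.\<close>

lemma sim_run:
  assumes S: "sim c0 q0" and W: "word_bounded Q q0 B'"
  shows "c \<in> set_pmf (run P (2 * t) c0) \<Longrightarrow>
      \<exists>q \<in> set_pmf (run Q t q0). sim c q \<or> halted Q q \<and> fin c q"
    and "c \<in> set_pmf (run P k c0) \<Longrightarrow> bounded_by B c"
    and "\<forall>q \<in> set_pmf (run Q t q0). halted Q q \<Longrightarrow> c \<in> set_pmf (run P (2 * t + 2) c0) \<Longrightarrow>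
      \<exists>q \<in> set_pmf (run Q t q0). fin c q"
proof -
  have bq: "bounded_by B' q" if "q \<in> set_pmf (run Q t q0)" for q t
    using W that unfolding word_bounded_def bounded_by_def by blast
  have bq': "\<forall>q' \<in> set_pmf (step Q q). bounded_by B' q'" if "q \<in> set_pmf (run Q t q0)" for q t
    using bq[of _ "Suc t"] that by auto
  have even: "\<exists>q \<in> set_pmf (run Q t q0). sim c q \<or> halted Q q \<and> fin c q"
    if "c \<in> set_pmf (run P (2 * t) c0)" for c t
    using that
  proof (induction t arbitrary: c)
    case 0
    then show ?case using S by simp
  next
    case (Suc t)
    from Suc.prems obtain c' c1 where c: "c' \<in> set_pmf (run P (2 * t) c0)" "c1 \<in> set_pmf (step P c')"
      "c \<in> set_pmf (step P c1)" by auto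
    from Suc.IH[OF c(1)] obtain q where q: "q \<in> set_pmf (run Q t q0)" "sim c' q \<or> halted Q q \<and> fin c' q"
      by blast
    from two_steps(2)[OF q(2) bq[OF q(1)] bq'[OF q(1)] c(2,3)] q(1) show ?case by auto
  qed
  then show "c \<in> set_pmf (run P (2 * t) c0) \<Longrightarrow>
      \<exists>q \<in> set_pmf (run Q t q0). sim c q \<or> halted Q q \<and> fin c q" .
  show "bounded_by B c" if c: "c \<in> set_pmf (run P k c0)"
  proof (cases "even k")
    case True
    then obtain t where "k = 2 * t" by blast
    with even[of c t] c show ?thesis by (auto simp: sim_def fin_def)
  next
    case False
    then obtain t where "k = Suc (2 * t)" by (metis oddE Suc_eq_plus1)
    with c obtain c' where c': "c' \<in> set_pmf (run P (2 * t) c0)" "c \<in> set_pmf (step P c')" by auto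
    from even[OF c'(1)] obtain q where q: "q \<in> set_pmf (run Q t q0)" "sim c' q \<or> halted Q q \<and> fin c' q"
      by blast
    from two_steps(1)[OF q(2) bq[OF q(1)] bq'[OF q(1)] c'(2)] show ?thesis .
  qed
  show "\<exists>q \<in> set_pmf (run Q t q0). fin c q"
    if h: "\<forall>q \<in> set_pmf (run Q t q0). halted Q q" and "c \<in> set_pmf (run P (2 * t + 2) c0)"
  proof -
    from that(2) obtain c' c1 where c: "c' \<in> set_pmf (run P (2 * t) c0)" "c1 \<in> set_pmf (step P c')"
      "c \<in> set_pmf (step P c1)" by auto
    from even[OF c(1)] obtain q where q: "q \<in> set_pmf (run Q t q0)" "sim c' q \<or> halted Q q \<and> fin c' q"
      by blast
    from two_steps(2)[OF q(2) bq[OF q(1)] bq'[OF q(1)] c(2,3)] q(1) h show ?thesis by blast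
  qed
qed

end

lemma run_halted_mono:
  assumes "\<forall>c \<in> set_pmf (run P t c0). halted P c \<and> A c" "t \<le> u"
  shows "\<forall>c \<in> set_pmf (run P u c0). halted P c \<and> A c"
  using assms(2)
proof (induction u rule: dec_induct)
  case (step u)
  then show ?case by (auto simp: step_def)
qed (use assms(1) in blast)

subsection \<open>The approximation algorithm\<close>

lemma oc_le_length: "oc b w \<le> length w"
  by (induction b w rule: oc.induct) auto

text \<open>Turns the number of passes into at most order \<open>log n\<close>, as the running time
  requires.\<close>

lemma num_blocks_le_length: "num_blocks s \<sigma> \<le> length \<sigma>"
proof -
  have "length (push s p st) \<le> Suc (length st)" for p st
    by (induction s p st rule: push.induct) auto
  then have "length (fold (push s) w st) \<le> length w + length st" for w st
    by (induction w arbitrary: st) (simp, metis add_Suc_right fold_simps(2) length_Cons add_Suc le_trans add_le_mono le_refl)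
  from this[of \<sigma> "[]"] show ?thesis
    unfolding num_blocks_eq_oc using oc_le_length[of False "rev (fold (push s) \<sigma> [])"] by simp
qed

definition dyck_program :: "nat \<Rightarrow> program \<Rightarrow> program" where
  "dyck_program s Q = sandboxed (compile 0 (prepare_com s)) Q"

text \<open>With \<open>N = n + s + 2\<close> everything is at most a constant times
  \<open>N ^ 3\<close>, and \<open>N \<ge> 4\<close> makes the two further factors \<open>N\<close>
  at least 16, which absorbs the constant. The first bound is for the reduction, the second for
  input length plus alphabet size of the instance.\<close>

lemma word_size_bounds:
  fixes n s :: nat
  assumes "2 \<le> s"
  shows "2 * s * (n + Suc n * (n + 3)) + 2 * s + 2 * n + 5 \<le> (n + s + 2) ^ 5"
    and "n + (2 * s * (Suc n * Suc (Suc n)) + 4) + 2 \<le> (n + s + 2) ^ 5"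
proof -
  define N where "N = n + s + 2"
  have N: "4 \<le> N" "s \<le> N" "n + 4 \<le> N" using assms by (auto simp: N_def)
  define c where "c = N * (N * N)"
  have sq: "16 \<le> N * N" using mult_le_mono[OF N(1) N(1)] by simp
  have Nc: "N \<le> c" "N * N \<le> c"
    using mult_le_mono2[of 1 "N * N" N] mult_le_mono1[of 1 N "N * N"] sq N by (auto simp: c_def)
  have p5: "N ^ 5 = (N * N) * c" by (simp add: c_def eval_nat_numeral)
  have big: "16 * c \<le> N ^ 5" unfolding p5 using sq by (rule mult_le_mono1)
  have "Suc n * (n + 3) \<le> N * N" using N by (intro mult_le_mono) auto
  then have "s * (n + Suc n * (n + 3)) \<le> N * (N + N * N)" using N by (intro mult_le_mono) auto
  also have "\<dots> = N * N + c" by (simp add: c_def algebra_simps)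
  finally show "2 * s * (n + Suc n * (n + 3)) + 2 * s + 2 * n + 5 \<le> (n + s + 2) ^ 5"
    unfolding N_def[symmetric] using Nc N big unfolding mult.assoc by linarith
  have "Suc n * Suc (Suc n) \<le> N * N" using N by (intro mult_le_mono) auto
  then have "s * (Suc n * Suc (Suc n)) \<le> c" unfolding c_def using N by (intro mult_le_mono) auto
  then show "n + (2 * s * (Suc n * Suc (Suc n)) + 4) + 2 \<le> (n + s + 2) ^ 5"
    unfolding N_def[symmetric] using Nc N big unfolding mult.assoc by linarith
qed

lemma dyck_program_run:
  fixes \<alpha> \<beta> :: "nat \<Rightarrow> real" and \<sigma> :: "paren list"
  defines "n \<equiv> length \<sigma>"
  assumes alg: "\<forall>k x y n. set x \<subseteq> {..<k} \<and> set y \<subseteq> {..<k} \<and> n = length x + length y \<longrightarrow>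
        word_bounded Q (string_input x y) ((n + k + 2) ^ e) \<and>
        (\<forall>c \<in> set_pmf (run Q (nat \<lfloor>\<alpha> n\<rfloor>) (string_input x y)).
           halted Q c \<and> edit_dist x y \<le> result c \<and> real (result c) \<le> \<beta> n * real (edit_dist x y))"
    and s: "2 \<le> s" and \<sigma>: "\<sigma> \<in> lists (parens s)"
  shows "word_bounded (dyck_program s Q) (paren_input \<sigma>) ((n + s + 2) ^ (5 * e + 5)) \<and>
    (\<exists>p E. (p = 1 \<or> 2 \<le> p \<and> 2 ^ (p - 2) \<le> num_blocks s \<sigma>) \<and> E \<le> (4 * p + 2) * dyck_dist s \<sigma> \<and>
      (\<forall>u \<ge> 100 * p * Suc n + 2 * nat \<lfloor>\<alpha> n\<rfloor> + 2. \<forall>c \<in> set_pmf (run (dyck_program s Q) u (paren_input \<sigma>)).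
        halted (dyck_program s Q) c \<and> dyck_dist s \<sigma> \<le> result c \<and> real (result c) \<le> 2 * (\<beta> n * real E)))"
proof -
  let ?P = "dyck_program s Q"
  define N where "N = n + s + 2"
  \<comment> \<open>The instance has \<open>n + k + 2 \<le> N ^ 5\<close>, so the simulated
    algorithm stays below \<open>N ^ (5 * e)\<close>; another factor \<open>N ^ 5\<close>
    accommodates the base address, the doubling and the reduction itself.\<close>
  define B where "B = N ^ (5 * e + 5)"
  have N: "1 \<le> N" by (simp add: N_def)
  have pos: "1 \<le> N ^ k" for k using N one_le_power by blast
  have BN: "B = N ^ 5 * N ^ (5 * e)" by (simp add: B_def power_add mult.commute)
  have N5: "N ^ 5 \<le> B" using pos[of "5 * e"] unfolding BN by (metis mult.right_neutral mult_le_mono2)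
  have B1: "2 * s * (n + Suc n * (n + 3)) + 2 * s + 2 * n + 5 \<le> B"
    using word_size_bounds(1)[OF s, of n] N5 unfolding N_def by linarith
  from prepare_com_ends[OF \<sigma>, of B] B1 obtain T gs hs r p where
    red: "reduce s \<sigma> [] = (T, gs)" and pas: "passes (rev T) hs r p" and
    E: "ends B (prepare_com s) (\<lambda>_. 0, mem (paren_input \<sigma>)) (\<lambda>t st. t \<le> 100 * p * Suc n \<and>
      (\<exists>R M. st = (R, M) \<and> R 5 = Suc n \<and> (\<forall>r \<ge> 20. R r = 0) \<and> (\<forall>a. M (Suc n + a) =
        mem (string_input (left_string s (gs @ hs) r) (right_string s (gs @ hs) r)) a)))"
    unfolding n_def by blast
  define x where "x = left_string s (gs @ hs) r"
  define y where "y = right_string s (gs @ hs) r"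
  define k where "k = 2 * s * length (gs @ hs) + 4"
  define B' where "B' = (n + k + 2) ^ e"
  have "2 * s * length (gs @ hs) \<le> 2 * s * (Suc n * Suc (Suc n))"
    unfolding n_def by (intro mult_le_mono2 passes_le_length(2)[OF \<sigma> red pas])
  then have "n + k + 2 \<le> N ^ 5" using word_size_bounds(2)[OF s, of n] unfolding k_def N_def by linarith
  then have B'N: "B' \<le> N ^ (5 * e)" unfolding B'_def power_mult by (rule power_mono) simp
  have "2 * N ^ (5 * e) \<le> N ^ 5 * N ^ (5 * e)" "(Suc n + 1) * N ^ (5 * e) \<le> N ^ 5 * N ^ (5 * e)"
    using word_size_bounds(2)[OF s, of n] unfolding N_def[symmetric] by (intro mult_le_mono1; linarith)+
  moreover have "Suc n + N ^ (5 * e) \<le> (Suc n + 1) * N ^ (5 * e)"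
    using pos[of "5 * e"] mult_le_mono2[of 1 "N ^ (5 * e)" "Suc n"] by simp
  ultimately have "Suc n + B' \<le> B" "2 * B' \<le> B" using B'N unfolding BN by linarith+
  then interpret simulation "compile 0 (prepare_com s)" Q "Suc n" B B' by unfold_locales
  have PP: "P = ?P" by (simp add: dyck_program_def)
  have xy: "n = length x + length y" "set x \<subseteq> {..<k}" "set y \<subseteq> {..<k}"
    using length_strings[OF \<sigma> red pas] set_strings[OF \<sigma> red pas] unfolding x_def y_def n_def k_def by auto
  then have W: "word_bounded Q (string_input x y) B'" and
    H: "\<forall>c \<in> set_pmf (run Q (nat \<lfloor>\<alpha> n\<rfloor>) (string_input x y)).
      halted Q c \<and> edit_dist x y \<le> result c \<and> real (result c) \<le> \<beta> n * real (edit_dist x y)"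
    using alg unfolding B'_def by blast+
  from E obtain t0 R M where st: "big_step B (prepare_com s) (\<lambda>_. 0, mem (paren_input \<sigma>)) t0 (R, M)"
    and t0: "t0 \<le> 100 * p * Suc n" and RM: "R 5 = Suc n" "\<forall>r \<ge> 20. R r = 0"
      "\<forall>a. M (Suc n + a) = mem (string_input x y) a"
    unfolding ends_def x_def y_def by blast
  let ?c0 = "at_store 0 (\<lambda>_. 0, mem (paren_input \<sigma>))"
  let ?c1 = "at_store (code_size (prepare_com s)) (R, M)"
  have c0: "?c0 = paren_input \<sigma>" by (simp add: at_store_def paren_input_def initial_def)
  have b0: "bounded_by B ?c0"
  proof -
    have "mem (paren_input \<sigma>) i \<le> B" for i
    proof (cases "i < Suc n \<and> 0 < i")
      case True
      then have "mem (paren_input \<sigma>) i = paren_code (\<sigma> ! (i - 1))" "\<sigma> ! (i - 1) \<in> set \<sigma>"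
        by (auto simp: paren_input_def initial_def n_def)
      moreover from this(2) \<sigma> have "\<sigma> ! (i - 1) \<in> parens s" by (auto simp: in_lists_conv_set)
      then have "paren_code (\<sigma> ! (i - 1)) < 2 * s" by (rule paren_code_less)
      ultimately show ?thesis using B1 by linarith
    next
      case False
      then have "mem (paren_input \<sigma>) i \<le> n" by (auto simp: paren_input_def initial_def n_def)
      then show ?thesis using B1 by linarith
    qed
    then show ?thesis by (simp add: bounded_by_def at_store_def)
  qed
  have "code_at P 0 (compile 0 (prepare_com s))"
    unfolding code_at_def sandboxed_def by (rule exI[of _ "[]"]) auto
  from runs_to_compile[OF st b0 this] have rt: "runs_to P B ?c0 t0 ?c1" and b1: "bounded_by B ?c1" by simp_all
  have S: "sim ?c1 (string_input x y)"
    using RM b1 unfolding sim_def by (simp add: at_store_def string_input_def initial_def)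
  have run1: "run P (t0 + j) ?c0 = run P j ?c1" for j
    using rt unfolding run_add runs_to_def by (simp add: bind_return_pmf)
  have "word_bounded P ?c0 B"
  proof -
    have "bounded_by B c" if "c \<in> set_pmf (run P t ?c0)" for c t
    proof (cases "t \<le> t0")
      case True
      with that rt show ?thesis unfolding runs_to_def by blast
    next
      case False
      then obtain j where "t = t0 + j" by (metis le_add_diff_inverse nat_le_linear)
      with that run1 sim_run(2)[OF S W] show ?thesis by auto
    qed
    then show ?thesis unfolding word_bounded_def bounded_by_def by blast
  qed
  moreover have "\<forall>c \<in> set_pmf (run P u ?c0). halted P c \<and>
      (dyck_dist s \<sigma> \<le> result c \<and> real (result c) \<le> 2 * (\<beta> n * real (edit_dist x y)))"
    if u: "100 * p * Suc n + 2 * nat \<lfloor>\<alpha> n\<rfloor> + 2 \<le> u" for u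
  proof (rule run_halted_mono)
    show "t0 + (2 * nat \<lfloor>\<alpha> n\<rfloor> + 2) \<le> u" using t0 u by linarith
    show "\<forall>c \<in> set_pmf (run P (t0 + (2 * nat \<lfloor>\<alpha> n\<rfloor> + 2)) ?c0). halted P c \<and>
      (dyck_dist s \<sigma> \<le> result c \<and> real (result c) \<le> 2 * (\<beta> n * real (edit_dist x y)))"
    proof
      fix c assume c: "c \<in> set_pmf (run P (t0 + (2 * nat \<lfloor>\<alpha> n\<rfloor> + 2)) ?c0)"
      have h: "\<forall>q \<in> set_pmf (run Q (nat \<lfloor>\<alpha> n\<rfloor>) (string_input x y)). halted Q q" using H by blast
      from sim_run(3)[OF S W h] c[unfolded run1] obtain q where
        q: "q \<in> set_pmf (run Q (nat \<lfloor>\<alpha> n\<rfloor>) (string_input x y))" "fin c q" by blast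
      have "dyck_dist s \<sigma> \<le> 2 * edit_dist x y"
        using dyck_dist_le_edit_dist[OF \<sigma> red pas] unfolding x_def y_def .
      moreover have "edit_dist x y \<le> result q" "real (result q) \<le> \<beta> n * real (edit_dist x y)" using H q(1) by auto
      ultimately show "halted P c \<and> (dyck_dist s \<sigma> \<le> result c \<and>
          real (result c) \<le> 2 * (\<beta> n * real (edit_dist x y)))"
        using q(2) unfolding fin_def by simp
    qed
  qed
  moreover have "edit_dist x y \<le> (4 * p + 2) * dyck_dist s \<sigma>"
    using edit_dist_le_dyck_dist[OF \<sigma> red pas] unfolding x_def y_def .
  moreover have "p = 1 \<or> 2 \<le> p \<and> 2 ^ (p - 2) \<le> num_blocks s \<sigma>" by (rule passes_num_blocks[OF \<sigma> red pas])
  ultimately show ?thesis unfolding PP c0 B_def N_def by blast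
qed

text \<open>The strings \<open>replicate n 0\<close> and \<open>[]\<close> have positive distance.
  The output register is initially 0, so at least one step is needed; and \<open>\<beta> n\<close>
  times that distance bounds a natural number from above.\<close>

lemma str_edit_algorithm_pos:
  assumes "str_edit_algorithm Q \<alpha> \<beta>" "1 \<le> n"
  shows "1 \<le> \<alpha> n" "0 \<le> \<beta> n"
proof -
  let ?x = "replicate n 0 :: nat list"
  have H: "\<forall>c \<in> set_pmf (run Q (nat \<lfloor>\<alpha> n\<rfloor>) (string_input ?x [])).
    edit_dist ?x [] \<le> result c \<and> real (result c) \<le> \<beta> n * real (edit_dist ?x [])"
  proof -
    obtain e where alg: "\<forall>k x y n. set x \<subseteq> {..<k} \<and> set y \<subseteq> {..<k} \<and> n = length x + length y \<longrightarrow>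
        word_bounded Q (string_input x y) ((n + k + 2) ^ e) \<and>
        (\<forall>c \<in> set_pmf (run Q (nat \<lfloor>\<alpha> n\<rfloor>) (string_input x y)).
           halted Q c \<and> edit_dist x y \<le> result c \<and> real (result c) \<le> \<beta> n * real (edit_dist x y))"
      using assms(1) unfolding str_edit_algorithm_def by blast
    have "set ?x \<subseteq> {..<1} \<and> set [] \<subseteq> {..<1::nat} \<and> n = length ?x + length ([] :: nat list)"
      by auto
    from alg[THEN spec, THEN spec, THEN spec, THEN spec, THEN mp, OF this] show ?thesis by blast
  qed
  have "edit_dist ?x [] \<noteq> 0"
  proof
    assume "edit_dist ?x [] = 0"
    with edit_steps_edit_dist[of ?x "[]"] have "?x = []" by simp
    with assms(2) show False by simp
  qed
  then have pos: "1 \<le> edit_dist ?x []" by simp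
  show "1 \<le> \<alpha> n"
  proof (rule ccontr)
    assume "\<not> 1 \<le> \<alpha> n"
    then have "nat \<lfloor>\<alpha> n\<rfloor> = 0" by linarith
    with H have "edit_dist ?x [] \<le> result (string_input ?x [])" by simp
    with pos show False by (simp add: result_def string_input_def initial_def)
  qed
  obtain c where "c \<in> set_pmf (run Q (nat \<lfloor>\<alpha> n\<rfloor>) (string_input ?x []))"
    using set_pmf_not_empty by fastforce
  with H have "0 \<le> \<beta> n * real (edit_dist ?x [])" by (meson of_nat_0_le_iff order_trans)
  with pos show "0 \<le> \<beta> n" by (simp add: zero_le_mult_iff)
qed

theorem theorem3:
  fixes \<alpha> \<beta> :: "nat \<Rightarrow> real" and StrEdit :: program
  assumes "str_edit_algorithm StrEdit \<alpha> \<beta>"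
  shows "\<exists>C > 0. \<forall>s \<ge> 2. \<exists>P. fits_words P s \<and>
    (\<forall>\<sigma> n d z. \<sigma> \<in> lists (parens s) \<and> n = length \<sigma> \<and> n \<ge> 1 \<and>
        d = dyck_dist s \<sigma> \<and> z = num_blocks s \<sigma> \<longrightarrow>
      success_prob P s \<sigma>
        (C * (real n * log 2 (real n) + \<alpha> n))
        (C * (\<beta> n * max 1 (log 2 (real z)) * sqrt (log 2 (real d))))
      \<ge> 1 - 1 / real n - 1 / real d)"
proof -
  obtain e where alg: "\<forall>k x y n. set x \<subseteq> {..<k} \<and> set y \<subseteq> {..<k} \<and> n = length x + length y \<longrightarrow>
        word_bounded StrEdit (string_input x y) ((n + k + 2) ^ e) \<and>
        (\<forall>c \<in> set_pmf (run StrEdit (nat \<lfloor>\<alpha> n\<rfloor>) (string_input x y)).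
           halted StrEdit c \<and> edit_dist x y \<le> result c \<and> real (result c) \<le> \<beta> n * real (edit_dist x y))"
    using assms unfolding str_edit_algorithm_def by blast
  have main: "success_prob (dyck_program s StrEdit) s \<sigma>
        (1000 * (real n * log 2 (real n) + \<alpha> n))
        (1000 * (\<beta> n * max 1 (log 2 (real z)) * sqrt (log 2 (real d))))
      \<ge> 1 - 1 / real n - 1 / real d"
    if s: "2 \<le> s" and \<sigma>: "\<sigma> \<in> lists (parens s)" and n: "n = length \<sigma>" "1 \<le> n"
      and d: "d = dyck_dist s \<sigma>" and z: "z = num_blocks s \<sigma>" for s \<sigma> n d z
  proof (cases "n = 1 \<or> d = 1")
    case True
    \<comment> \<open>The required probability is at most 0 here. For \<open>d = 1\<close> the
      claimed factor vanishes together with \<open>log 2 1\<close>.\<close>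
    then have "1 - 1 / real n - 1 / real d \<le> 0" by auto
    also have "0 \<le> success_prob (dyck_program s StrEdit) s \<sigma>
        (1000 * (real n * log 2 (real n) + \<alpha> n))
        (1000 * (\<beta> n * max 1 (log 2 (real z)) * sqrt (log 2 (real d))))"
      unfolding success_prob_def by simp
    finally show ?thesis .
  next
    case False
    with n have n2: "2 \<le> n" by simp
    have \<alpha>: "1 \<le> \<alpha> n" and \<beta>: "0 \<le> \<beta> n" using str_edit_algorithm_pos[OF assms n(2)] by auto
    from dyck_program_run[OF alg s \<sigma>] obtain p E where
      p: "p = 1 \<or> 2 \<le> p \<and> 2 ^ (p - 2) \<le> z" and E: "E \<le> (4 * p + 2) * d" and
      run: "\<forall>u \<ge> 100 * p * Suc n + 2 * nat \<lfloor>\<alpha> n\<rfloor> + 2.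
        \<forall>c \<in> set_pmf (run (dyck_program s StrEdit) u (paren_input \<sigma>)).
        halted (dyck_program s StrEdit) c \<and> d \<le> result c \<and> real (result c) \<le> 2 * (\<beta> n * real E)"
      unfolding n(1) d z by blast
    define L where "L = log 2 (real n)"
    define m where "m = max 1 (log 2 (real z))"
    have L1: "1 \<le> L" using n2 unfolding L_def by (simp add: le_log_iff)
    have m1: "1 \<le> m" by (simp add: m_def)
    have mL: "m \<le> L"
    proof (cases "z = 0")
      case True
      then show ?thesis using L1 by (simp add: m_def log_def)
    next
      case False
      have "z \<le> n" using num_blocks_le_length[of s \<sigma>] z n by simp
      with False have "log 2 (real z) \<le> L" unfolding L_def by simp
      with L1 show ?thesis by (simp add: m_def)
    qed
    \<comment> \<open>\<open>p - 2 \<le> log 2 z\<close> gives \<open>p \<le> 2 + m\<close>, and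
      \<open>m \<ge> 1\<close>.\<close>
    have pm: "real p \<le> 3 * m"
    proof (cases "p = 1")
      case False
      with p have "2 \<le> p" and z2: "2 ^ (p - 2) \<le> z" by auto
      have "real (p - 2) = log 2 (2 ^ (p - 2))" by (simp add: log_nat_power)
      also have "\<dots> \<le> log 2 (real z)"
      proof -
        have "(2::real) ^ (p - 2) \<le> real z" using z2 by (metis of_nat_le_iff of_nat_numeral of_nat_power)
        then show ?thesis by (intro log_mono) auto
      qed
      finally show ?thesis using \<open>2 \<le> p\<close> m1 by (simp add: m_def of_nat_diff)
    qed (use m1 in simp)
    let ?t = "1000 * (real n * L + \<alpha> n)"
    have "real (100 * p * Suc n + 2 * nat \<lfloor>\<alpha> n\<rfloor> + 2) \<le> ?t"
    proof -
      \<comment> \<open>\<open>p \<le> 3 * L\<close> and \<open>Suc n \<le> 2 * n\<close> turn the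
        100 into 600; the additive 2 is absorbed by \<open>n * L \<ge> 1\<close> and
        \<open>\<alpha> n \<ge> 1\<close>.\<close>
      have "real p * real (Suc n) \<le> (3 * L) * (2 * real n)"
        using pm mL n2 L1 by (intro mult_mono) auto
      then have A: "real (100 * p * Suc n) \<le> 600 * (real n * L)" by (simp add: algebra_simps)
      have T: "real (nat \<lfloor>\<alpha> n\<rfloor>) \<le> \<alpha> n" using \<alpha> by simp
      have v: "1 \<le> real n * L" using L1 n2 mult_mono[of 1 "real n" 1 L] by simp
      have sum: "A + 2 * T + 2 \<le> 1000 * (v + a)"
        if "A \<le> 600 * v" "T \<le> a" "1 \<le> v" "1 \<le> a" for A T v a :: real
        using that by argo
      have "real (100 * p * Suc n + 2 * nat \<lfloor>\<alpha> n\<rfloor> + 2)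
        = real (100 * p * Suc n) + 2 * real (nat \<lfloor>\<alpha> n\<rfloor>) + 2"
        by (simp only: of_nat_add of_nat_mult of_nat_numeral)
      also have "\<dots> \<le> ?t" by (rule sum[OF A T v \<alpha>])
      finally show ?thesis .
    qed
    then have "100 * p * Suc n + 2 * nat \<lfloor>\<alpha> n\<rfloor> + 2 \<le> nat \<lfloor>?t\<rfloor>" by (rule le_nat_floor)
    with run have all: "\<forall>c \<in> set_pmf (run (dyck_program s StrEdit) (nat \<lfloor>?t\<rfloor>) (paren_input \<sigma>)).
        halted (dyck_program s StrEdit) c \<and> d \<le> result c \<and> real (result c) \<le> 2 * (\<beta> n * real E)" by blast
    have le: "2 * (\<beta> n * real E) \<le> 1000 * (\<beta> n * m * sqrt (log 2 (real d))) * real d"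
    proof (cases "d = 0")
      case True
      then show ?thesis using E by simp
    next
      case d0: False
      with False have "2 \<le> d" by simp
      \<comment> \<open>From \<open>d = 2\<close> on the square root is at least 1, so multiplying
        by it only weakens the bound.\<close>
      then have sq: "1 \<le> sqrt (log 2 (real d))" by (simp add: le_log_iff)
      have "real E \<le> real ((4 * p + 2) * d)" using E by (simp only: of_nat_le_iff)
      also have "\<dots> = (4 * real p + 2) * real d" by (simp only: of_nat_add of_nat_mult of_nat_numeral)
      \<comment> \<open>\<open>4 * p + 2\<close> is at most \<open>12 * m + 2\<close>, and
        \<open>m \<ge> 1\<close>.\<close>
      also have "\<dots> \<le> (14 * m) * real d" using pm m1 by (intro mult_right_mono) auto
      finally have "\<beta> n * real E \<le> \<beta> n * ((14 * m) * real d)" using \<beta> by (rule mult_left_mono)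
      moreover have "\<beta> n * m * real d * 1 \<le> \<beta> n * m * real d * sqrt (log 2 (real d))"
        using \<beta> m1 sq by (intro mult_left_mono) auto
      moreover have "0 \<le> \<beta> n * m * real d" using \<beta> m1 by simp
      ultimately show ?thesis by (simp add: algebra_simps)
    qed
    have "set_pmf (run (dyck_program s StrEdit) (nat \<lfloor>?t\<rfloor>) (paren_input \<sigma>)) \<subseteq>
      {c. halted (dyck_program s StrEdit) c \<and> d \<le> result c \<and>
        real (result c) \<le> 1000 * (\<beta> n * m * sqrt (log 2 (real d))) * real d}"
      using all le by (blast intro: order_trans)
    then have "success_prob (dyck_program s StrEdit) s \<sigma> ?t (1000 * (\<beta> n * m * sqrt (log 2 (real d)))) = 1"
      unfolding success_prob_def d by (simp add: measure_pmf.prob_eq_1 AE_measure_pmf_iff subset_iff)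
    moreover have "0 \<le> 1 / real n" "0 \<le> 1 / real d" by simp_all
    ultimately show ?thesis unfolding L_def m_def by linarith
  qed
  have fits: "fits_words (dyck_program s StrEdit) s" if s: "2 \<le> s" for s
    unfolding fits_words_def using dyck_program_run[OF alg s] by blast
  show ?thesis
    by (rule exI[of _ 1000]) (use main fits in \<open>blast intro: zero_less_numeral\<close>)
qed

end
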